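(* Let $(M,L)$ be a Finsler manifold with Finsler metric $g$ and let $\nabla$ be its Cartan connection, with (h)hv-torsion $T$, curvatures $R,P,S$, contracted curvatures $\widehat R,\widehat P$, connection map $K$ and horizontal map $\beta$. Then for all $\pi$-vector fields $X,Y,Z,W$: (a) $R(X,Y,Z,W)=-R(Y,X,Z,W)$; (b) $R(X,Y,Z,W)=-R(X,Y,W,Z)$; (c) $\widehat R(X,Y)=-K\,\mathfrak R(\beta X,\beta Y)$, where $\mathfrak R$ is the curvature of the Barthel connection; (d) $\mathfrak S_{X,Y,Z}\{R(X,Y)Z-T(\widehat R(X,Y),Z)\}=0$; (e) $\mathfrak S_{X,Y,Z}\{(\nabla_{\beta X}R)(Y,Z,W)+P(X,\widehat R(Y,Z))W\}=0$; (f) $(\nabla_{\gamma X}R)(Y,Z,W)+(\nabla_{\beta Y}P)(Z,X,W)-(\nabla_{\beta Z}P)(Y,X,W)-P(Z,\widehat P(Y,X))W+R(T(X,Y),Z)W-S(\widehat R(Y,Z),X)W+P(Y,\widehat P(Z,X))W-R(T(X,Z),Y)W=0$; (g) $(\nabla_{\gamma\eta}R)(X,Y,Z)=0$.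
   Context: $M$ is a real paracompact $C^\infty$ manifold of finite dimension, $\mathcal TM\subset TM$ is the set of nonzero tangent vectors, $\pi:\mathcal TM\to M$ the projection, $\pi^{-1}(TM)\to\mathcal TM$ the pullback of $TM$ by $\pi$; everything is $C^\infty$. Sections of $\pi^{-1}(TM)$ are called $\pi$-vector fields. $\eta$ is the $\pi$-vector field $\eta(u)=(u,u)$. $\rho:T(\mathcal TM)\to\pi^{-1}(TM)$ is $\rho(A)=(u,d\pi(A))$ for $A\in T_u(\mathcal TM)$, and $\gamma:\pi^{-1}(TM)\to T(\mathcal TM)$ is the vertical lift $\gamma(u,v)=\frac{d}{dt}|_{t=0}(u+tv)$; $V=\ker\rho=\operatorname{im}\gamma$; $J=\gamma\circ\rho$. $(M,L)$ is a Finsler manifold: $L:TM\to[0,\infty)$ is smooth and positive on $\mathcal TM$, positively homogeneous of degree 1 on fibres, and the fibrewise Hessian of $E=\frac12L^2$ is positive definite on $\mathcal TM$; this Hessian (in coordinates $g_{ij}=\frac12\partial^2L^2/\partial y^i\partial y^j$) is the Finsler metric $g$ on $\pi^{-1}(TM)$. For a linear connection $D$ on $\pi^{-1}(TM)$, put $K(A)=D_A\eta$ (connection map) and $H=\ker K$. $D$ is regular if $T(\mathcal TM)=V\oplus H$; then $\beta:=(\rho|_H)^{-1}:\pi^{-1}(TM)\to H$ (horizontal map). Torsion: $\mathbf T(A,B)=D_A\rho B-D_B\rho A-\rho[A,B]$; curvature (note the sign): $\mathbf K(A,B)\rho C=-D_AD_B\rho C+D_BD_A\rho C+D_{[A,B]}\rho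 C$. $Q(X,Y)=\mathbf T(\beta X,\beta Y)$, $T(X,Y)=\mathbf T(\gamma X,\beta Y)$; h-, hv-, v-curvatures $R(X,Y)Z=\mathbf K(\beta X,\beta Y)Z$, $P(X,Y)Z=\mathbf K(\beta X,\gamma Y)Z$, $S(X,Y)Z=\mathbf K(\gamma X,\gamma Y)Z$; $\widehat R(X,Y)=R(X,Y)\eta$, $\widehat P(X,Y)=P(X,Y)\eta$. The Cartan connection $\nabla$ is the unique regular connection on $\pi^{-1}(TM)$ with $\nabla g=0$, $Q=0$, and $g(T(X,Y),Z)=g(T(X,Z),Y)$. Barthel connection: $\Gamma=[J,G]$, i.e. $\Gamma(A)=[JA,G]-J[A,G]$, where $G$ is the canonical spray defined by $i_G\,dd_JE=-dE$ ($d_JE=dE\circ J$). Its projectors are $h=\frac12(I+\Gamma)$, $v=\frac12(I-\Gamma)$ and its curvature is $\mathfrak R(A,B)=-v[hA,hB]$. It is a known fact that $\Gamma=2\beta\circ\rho-I$ for the horizontal map $\beta$ of $\nabla$, so $h=\beta\circ\rho$. Notation: $R(X,Y,Z,W):=g(R(X,Y)Z,W)$. For $B\in\{R,P\}$, $(\nabla_AB)(X,Y,Z)=\nabla_A(B(X,Y)Z)-B(\nabla_AX,Y)Z-B(X,\nabla_AY)Z-B(X,Y)\nabla_AZ$ (vector-valued). $\mathfrak S_{X,Y,Z}$ is the cyclic sum. *)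

theory Defs
  imports "HOL-Analysis.Analysis" "HOL-Library.Function_Algebras"
begin

section \<open>Smooth manifolds\<close>

primrec Ck_on :: "nat \<Rightarrow> ('a::real_normed_vector \<Rightarrow> 'b::real_normed_vector) \<Rightarrow> 'a set \<Rightarrow> bool" where
  "Ck_on 0 f S \<longleftrightarrow> continuous_on S f"
| "Ck_on (Suc k) f S \<longleftrightarrow>
     (\<forall>x\<in>S. f differentiable (at x)) \<and> (\<forall>v. Ck_on k (\<lambda>x. frechet_derivative f (at x) v) S)"

text \<open>\<open>C\<^sup>\<infinity>\<close> on \<open>S\<close>, for open \<open>S\<close> only (derivatives are taken in the full space).\<close>
definition smooth_on :: "('a::euclidean_space \<Rightarrow> 'b::euclidean_space) \<Rightarrow> 'a set \<Rightarrow> bool" where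
  "smooth_on f S \<longleftrightarrow> (\<forall>k. Ck_on k f S)"

text \<open>A chart is a domain together with a coordinate map, whose values off the domain are irrelevant.\<close>
type_synonym ('m, 'e) chart = "'m set \<times> ('m \<Rightarrow> 'e)"

definition chart_image :: "('m, 'e) chart \<Rightarrow> 'e set" where
  "chart_image c = snd c ` fst c"

definition chart_inv :: "('m, 'e) chart \<Rightarrow> 'e \<Rightarrow> 'm" where
  "chart_inv c = the_inv_into (fst c) (snd c)"

definition carrier_of :: "('m, 'e) chart set \<Rightarrow> 'm set" where
  "carrier_of \<A> = (\<Union>c\<in>\<A>. fst c)"

definition chart_at :: "('m, 'e) chart set \<Rightarrow> 'm \<Rightarrow> ('m, 'e) chart" where
  "chart_at \<A> p = (SOME c. c \<in> \<A> \<and> p \<in> fst c)"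

definition smooth_atlas :: "'m topology \<Rightarrow> ('m, 'e::euclidean_space) chart set \<Rightarrow> bool" where
  "smooth_atlas X \<A> \<longleftrightarrow>
     carrier_of \<A> = topspace X \<and>
     (\<forall>c\<in>\<A>. openin X (fst c) \<and> open (chart_image c) \<and>
        homeomorphic_map (subtopology X (fst c)) (top_of_set (chart_image c)) (snd c)) \<and>
     (\<forall>c\<in>\<A>. \<forall>c'\<in>\<A>. smooth_on (snd c' \<circ> chart_inv c) (snd c ` (fst c \<inter> fst c')))"

definition paracompact_space :: "'m topology \<Rightarrow> bool" where
  "paracompact_space X \<longleftrightarrow>
     (\<forall>\<U>. (\<forall>U\<in>\<U>. openin X U) \<and> \<Union>\<U> = topspace X \<longrightarrow>
        (\<exists>\<V>. (\<forall>V\<in>\<V>. openin X V \<and> (\<exists>U\<in>\<U>. V \<subseteq> U)) \<and> \<Union>\<V> = topspace X \<and>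
             locally_finite_in X \<V>))"

definition smooth_manifold :: "'m topology \<Rightarrow> ('m, 'e::euclidean_space) chart set \<Rightarrow> bool" where
  "smooth_manifold X \<A> \<longleftrightarrow> Hausdorff_space X \<and> paracompact_space X \<and> smooth_atlas X \<A>"


section \<open>Tangent vectors and vector fields\<close>

text \<open>A tangent vector is the family of its components in all charts of the atlas around the base
  point, related by the derivatives of the transition maps. The components in all
  other charts are set to \<open>0\<close>, so that equality of tangent vectors at a point is equality of functions
  and the vector space operations are pointwise.\<close>
type_synonym ('m, 'e) tvec = "('m, 'e) chart \<Rightarrow> 'e"

definition tangent_space :: "('m, 'e::euclidean_space) chart set \<Rightarrow> 'm \<Rightarrow> ('m, 'e) tvec set" where
  "tangent_space \<A> p = {v.
     (\<forall>c\<in>\<A>. \<forall>c'\<in>\<A>. p \<in> fst c \<inter> fst c' \<longrightarrow>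
        v c' = frechet_derivative (snd c' \<circ> chart_inv c) (at (snd c p)) (v c)) \<and>
     (\<forall>c. \<not> (c \<in> \<A> \<and> p \<in> fst c) \<longrightarrow> v c = 0)}"

definition tscale :: "real \<Rightarrow> ('m, 'e::euclidean_space) tvec \<Rightarrow> ('m, 'e) tvec" where
  "tscale r v = (\<lambda>c. r *\<^sub>R v c)"

text \<open>The differential of a map into another manifold; the value does not depend on the
  chart of the source around \<open>p\<close>.\<close>
definition tangent_map :: "('m, 'e::euclidean_space) chart set \<Rightarrow> ('n, 'f::euclidean_space) chart set \<Rightarrow>
    ('m \<Rightarrow> 'n) \<Rightarrow> 'm \<Rightarrow> ('m, 'e) tvec \<Rightarrow> ('n, 'f) tvec" where
  "tangent_map \<A> \<B> F p v = (\<lambda>c'. if c' \<in> \<B> \<and> F p \<in> fst c'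
     then (let c = chart_at \<A> p in
       frechet_derivative (snd c' \<circ> F \<circ> chart_inv c) (at (snd c p)) (v c))
     else 0)"

definition differential :: "('m, 'e::euclidean_space) chart set \<Rightarrow> ('m \<Rightarrow> real) \<Rightarrow>
    'm \<Rightarrow> ('m, 'e) tvec \<Rightarrow> real" where
  "differential \<A> f p v = (let c = chart_at \<A> p in
     frechet_derivative (f \<circ> chart_inv c) (at (snd c p)) (v c))"

text \<open>The tangent vector at parameter \<open>0\<close> of a curve.\<close>
definition velocity :: "('m, 'e::euclidean_space) chart set \<Rightarrow> (real \<Rightarrow> 'm) \<Rightarrow> ('m, 'e) tvec" where
  "velocity \<A> \<sigma> = (\<lambda>c. if c \<in> \<A> \<and> \<sigma> 0 \<in> fst c
     then vector_derivative (\<lambda>t. snd c (\<sigma> t)) (at 0) else 0)"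

definition smooth_functions :: "('m, 'e::euclidean_space) chart set \<Rightarrow> ('m \<Rightarrow> real) set" where
  "smooth_functions \<A> = {f. \<forall>c\<in>\<A>. smooth_on (f \<circ> chart_inv c) (chart_image c)}"

text \<open>Fields are normalised to be \<open>0\<close> off the manifold.\<close>
definition vector_fields :: "('m, 'e::euclidean_space) chart set \<Rightarrow> ('m \<Rightarrow> ('m, 'e) tvec) set" where
  "vector_fields \<A> = {A.
     (\<forall>p\<in>carrier_of \<A>. A p \<in> tangent_space \<A> p) \<and>
     (\<forall>p. p \<notin> carrier_of \<A> \<longrightarrow> A p = 0) \<and>
     (\<forall>c\<in>\<A>. smooth_on (\<lambda>x. A (chart_inv c x) c) (chart_image c))}"

text \<open>In coordinates \<open>[A,B]\<^sup>i = A\<^sup>j \<partial>\<^sub>j B\<^sup>i - B\<^sup>j \<partial>\<^sub>j A\<^sup>i\<close>, that is \<open>[A,B] f = A (B f) - B (A f)\<close>.\<close>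
definition lie_bracket :: "('m, 'e::euclidean_space) chart set \<Rightarrow> ('m \<Rightarrow> ('m, 'e) tvec) \<Rightarrow>
    ('m \<Rightarrow> ('m, 'e) tvec) \<Rightarrow> 'm \<Rightarrow> ('m, 'e) tvec" where
  "lie_bracket \<A> A B p = (\<lambda>c. if c \<in> \<A> \<and> p \<in> fst c
     then frechet_derivative (\<lambda>x. B (chart_inv c x) c) (at (snd c p)) (A p c)
        - frechet_derivative (\<lambda>x. A (chart_inv c x) c) (at (snd c p)) (B p c)
     else 0)"

text \<open>Exterior derivative of a 1-form, normalised without the factor \<open>1/2\<close>.\<close>
definition ext_deriv :: "('m, 'e::euclidean_space) chart set \<Rightarrow> ('m \<Rightarrow> ('m, 'e) tvec \<Rightarrow> real) \<Rightarrow>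
    ('m \<Rightarrow> ('m, 'e) tvec) \<Rightarrow> ('m \<Rightarrow> ('m, 'e) tvec) \<Rightarrow> 'm \<Rightarrow> real" where
  "ext_deriv \<A> \<omega> A B p =
     differential \<A> (\<lambda>q. \<omega> q (B q)) p (A p) - differential \<A> (\<lambda>q. \<omega> q (A q)) p (B p)
     - \<omega> p (lie_bracket \<A> A B p)"


section \<open>The slit tangent bundle and the pullback bundle\<close>

type_synonym ('m, 'e) tpoint = "'m \<times> ('m, 'e) tvec"

definition tangent_bundle :: "('m, 'e::euclidean_space) chart set \<Rightarrow> ('m, 'e) tpoint set" where
  "tangent_bundle \<A> = {(p, v). p \<in> carrier_of \<A> \<and> v \<in> tangent_space \<A> p}"

definition slit_bundle :: "('m, 'e::euclidean_space) chart set \<Rightarrow> ('m, 'e) tpoint set" where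
  "slit_bundle \<A> = {(p, v) \<in> tangent_bundle \<A>. v \<noteq> 0}"

definition slit_chart :: "('m, 'e::euclidean_space) chart set \<Rightarrow> ('m, 'e) chart \<Rightarrow>
    (('m, 'e) tpoint, 'e \<times> 'e) chart" where
  "slit_chart \<A> c = ({u \<in> slit_bundle \<A>. fst u \<in> fst c}, \<lambda>(p, v). (snd c p, v c))"

definition slit_atlas :: "('m, 'e::euclidean_space) chart set \<Rightarrow>
    (('m, 'e) tpoint, 'e \<times> 'e) chart set" where
  "slit_atlas \<A> = slit_chart \<A> ` \<A>"

text \<open>Tangent vectors of and vector fields on the slit tangent bundle.\<close>
type_synonym ('m, 'e) svec = "(('m, 'e) tpoint, 'e \<times> 'e) tvec"
type_synonym ('m, 'e) sfield = "('m, 'e) tpoint \<Rightarrow> ('m, 'e) svec"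

text \<open>The fibre at \<open>u\<close> of the pullback bundle is \<open>{u} \<times> T\<^bsub>\<pi>(u)\<^esub>M\<close>. We identify it with
  \<open>T\<^bsub>\<pi>(u)\<^esub>M\<close>, so a \<open>\<pi>\<close>-vector field is given by the second component of its values.\<close>
type_synonym ('m, 'e) pifield = "('m, 'e) tpoint \<Rightarrow> ('m, 'e) tvec"

definition pi_fields :: "('m, 'e::euclidean_space) chart set \<Rightarrow> ('m, 'e) pifield set" where
  "pi_fields \<A> = {X.
     (\<forall>u\<in>slit_bundle \<A>. X u \<in> tangent_space \<A> (fst u)) \<and>
     (\<forall>u. u \<notin> slit_bundle \<A> \<longrightarrow> X u = 0) \<and>
     (\<forall>c\<in>\<A>. smooth_on (\<lambda>x. X (chart_inv (slit_chart \<A> c) x) c) (chart_image (slit_chart \<A> c)))}"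

text \<open>The map on fields induced by a fibre-preserving map of bundles over the slit tangent bundle.\<close>
definition on_fields :: "('m, 'e::euclidean_space) chart set \<Rightarrow> (('m, 'e) tpoint \<Rightarrow> 'a \<Rightarrow> 'b::zero) \<Rightarrow>
    (('m, 'e) tpoint \<Rightarrow> 'a) \<Rightarrow> ('m, 'e) tpoint \<Rightarrow> 'b" where
  "on_fields \<A> F X u = (if u \<in> slit_bundle \<A> then F u (X u) else 0)"

definition eta :: "('m, 'e::euclidean_space) chart set \<Rightarrow> ('m, 'e) pifield" where
  "eta \<A> u = (if u \<in> slit_bundle \<A> then snd u else 0)"

definition rho :: "('m, 'e::euclidean_space) chart set \<Rightarrow>
    ('m, 'e) tpoint \<Rightarrow> ('m, 'e) svec \<Rightarrow> ('m, 'e) tvec" where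
  "rho \<A> = tangent_map (slit_atlas \<A>) \<A> fst"

definition gam :: "('m, 'e::euclidean_space) chart set \<Rightarrow>
    ('m, 'e) tpoint \<Rightarrow> ('m, 'e) tvec \<Rightarrow> ('m, 'e) svec" where
  "gam \<A> u v = velocity (slit_atlas \<A>) (\<lambda>t. (fst u, snd u + tscale t v))"

definition vert_endo :: "('m, 'e::euclidean_space) chart set \<Rightarrow>
    ('m, 'e) tpoint \<Rightarrow> ('m, 'e) svec \<Rightarrow> ('m, 'e) svec" where
  "vert_endo \<A> u a = gam \<A> u (rho \<A> u a)"


section \<open>Finsler manifolds and the Barthel connection\<close>

definition energy :: "(('m, 'e) tpoint \<Rightarrow> real) \<Rightarrow> ('m, 'e) tpoint \<Rightarrow> real" where
  "energy L u = (L u)\<^sup>2 / 2"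

text \<open>The Hessian at \<open>u\<close> of the restriction of the energy to the fibre through \<open>u\<close>.\<close>
definition finsler_metric :: "(('m, 'e::euclidean_space) tpoint \<Rightarrow> real) \<Rightarrow>
    ('m, 'e) tpoint \<Rightarrow> ('m, 'e) tvec \<Rightarrow> ('m, 'e) tvec \<Rightarrow> real" where
  "finsler_metric L u v w =
     deriv (\<lambda>s. deriv (\<lambda>t. energy L (fst u, snd u + tscale s v + tscale t w)) 0) 0"

definition finsler_manifold :: "'m topology \<Rightarrow> ('m, 'e::euclidean_space) chart set \<Rightarrow>
    (('m, 'e) tpoint \<Rightarrow> real) \<Rightarrow> bool" where
  "finsler_manifold X \<A> L \<longleftrightarrow>
     smooth_manifold X \<A> \<and>
     (\<forall>u\<in>tangent_bundle \<A>. L u \<ge> 0) \<and>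
     (\<forall>u\<in>slit_bundle \<A>. L u > 0) \<and>
     L \<in> smooth_functions (slit_atlas \<A>) \<and>
     (\<forall>(p, v)\<in>tangent_bundle \<A>. \<forall>r>0. L (p, tscale r v) = r * L (p, v)) \<and>
     (\<forall>u\<in>slit_bundle \<A>. \<forall>v\<in>tangent_space \<A> (fst u). v \<noteq> 0 \<longrightarrow> finsler_metric L u v v > 0)"

definition dJE :: "('m, 'e::euclidean_space) chart set \<Rightarrow> (('m, 'e) tpoint \<Rightarrow> real) \<Rightarrow>
    ('m, 'e) tpoint \<Rightarrow> ('m, 'e) svec \<Rightarrow> real" where
  "dJE \<A> L u a = differential (slit_atlas \<A>) (energy L) u (vert_endo \<A> u a)"

definition canonical_spray :: "('m, 'e::euclidean_space) chart set \<Rightarrow> (('m, 'e) tpoint \<Rightarrow> real) \<Rightarrow>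
    ('m, 'e) sfield" where
  "canonical_spray \<A> L = (THE G. G \<in> vector_fields (slit_atlas \<A>) \<and>
     (\<forall>A\<in>vector_fields (slit_atlas \<A>). \<forall>u\<in>slit_bundle \<A>.
        ext_deriv (slit_atlas \<A>) (dJE \<A> L) G A u
          = - differential (slit_atlas \<A>) (energy L) u (A u)))"

definition barthel :: "('m, 'e::euclidean_space) chart set \<Rightarrow> (('m, 'e) tpoint \<Rightarrow> real) \<Rightarrow>
    ('m, 'e) sfield \<Rightarrow> ('m, 'e) sfield" where
  "barthel \<A> L A = (let J = on_fields \<A> (vert_endo \<A>); G = canonical_spray \<A> L in
     lie_bracket (slit_atlas \<A>) (J A) G - J (lie_bracket (slit_atlas \<A>) A G))"

definition barthel_h :: "('m, 'e::euclidean_space) chart set \<Rightarrow> (('m, 'e) tpoint \<Rightarrow> real) \<Rightarrow>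
    ('m, 'e) sfield \<Rightarrow> ('m, 'e) sfield" where
  "barthel_h \<A> L A = (\<lambda>u. tscale (1/2) (A u + barthel \<A> L A u))"

definition barthel_v :: "('m, 'e::euclidean_space) chart set \<Rightarrow> (('m, 'e) tpoint \<Rightarrow> real) \<Rightarrow>
    ('m, 'e) sfield \<Rightarrow> ('m, 'e) sfield" where
  "barthel_v \<A> L A = (\<lambda>u. tscale (1/2) (A u - barthel \<A> L A u))"

definition barthel_curvature :: "('m, 'e::euclidean_space) chart set \<Rightarrow> (('m, 'e) tpoint \<Rightarrow> real) \<Rightarrow>
    ('m, 'e) sfield \<Rightarrow> ('m, 'e) sfield \<Rightarrow> ('m, 'e) sfield" where
  "barthel_curvature \<A> L A B =
     - barthel_v \<A> L (lie_bracket (slit_atlas \<A>) (barthel_h \<A> L A) (barthel_h \<A> L B))"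


section \<open>Linear connections on the pullback bundle\<close>

text \<open>\<open>D u a X\<close> is the covariant derivative of the \<open>\<pi>\<close>-vector field \<open>X\<close> in the direction of the
  tangent vector \<open>a\<close> of the slit tangent bundle at \<open>u\<close>.\<close>
type_synonym ('m, 'e) connection = "('m, 'e) tpoint \<Rightarrow> ('m, 'e) svec \<Rightarrow> ('m, 'e) pifield \<Rightarrow> ('m, 'e) tvec"

text \<open>\<open>cov \<A> D A X\<close> is \<open>D\<^sub>A X\<close> for vector fields \<open>A\<close>.\<close>
definition cov :: "('m, 'e::euclidean_space) chart set \<Rightarrow> ('m, 'e) connection \<Rightarrow>
    ('m, 'e) sfield \<Rightarrow> ('m, 'e) pifield \<Rightarrow> ('m, 'e) pifield" where
  "cov \<A> D A X = on_fields \<A> (\<lambda>u a. D u a X) A"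

definition linear_connection :: "('m, 'e::euclidean_space) chart set \<Rightarrow> ('m, 'e) connection \<Rightarrow> bool" where
  "linear_connection \<A> D \<longleftrightarrow>
     (\<forall>u\<in>slit_bundle \<A>. \<forall>X\<in>pi_fields \<A>. \<forall>a\<in>tangent_space (slit_atlas \<A>) u.
        D u a X \<in> tangent_space \<A> (fst u) \<and>
        (\<forall>b\<in>tangent_space (slit_atlas \<A>) u. D u (a + b) X = D u a X + D u b X) \<and>
        (\<forall>r. D u (tscale r a) X = tscale r (D u a X)) \<and>
        (\<forall>Y\<in>pi_fields \<A>. D u a (X + Y) = D u a X + D u a Y) \<and>
        (\<forall>f\<in>smooth_functions (slit_atlas \<A>).
           D u a (\<lambda>w. tscale (f w) (X w))
             = tscale (differential (slit_atlas \<A>) f u a) (X u) + tscale (f u) (D u a X))) \<and>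
     (\<forall>A\<in>vector_fields (slit_atlas \<A>). \<forall>X\<in>pi_fields \<A>. cov \<A> D A X \<in> pi_fields \<A>)"

definition connection_map :: "('m, 'e::euclidean_space) chart set \<Rightarrow> ('m, 'e) connection \<Rightarrow>
    ('m, 'e) tpoint \<Rightarrow> ('m, 'e) svec \<Rightarrow> ('m, 'e) tvec" where
  "connection_map \<A> D u a = D u a (eta \<A>)"

definition vertical_space :: "('m, 'e::euclidean_space) chart set \<Rightarrow>
    ('m, 'e) tpoint \<Rightarrow> ('m, 'e) svec set" where
  "vertical_space \<A> u = {a \<in> tangent_space (slit_atlas \<A>) u. rho \<A> u a = 0}"

definition horizontal_space :: "('m, 'e::euclidean_space) chart set \<Rightarrow> ('m, 'e) connection \<Rightarrow>
    ('m, 'e) tpoint \<Rightarrow> ('m, 'e) svec set" where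
  "horizontal_space \<A> D u = {a \<in> tangent_space (slit_atlas \<A>) u. connection_map \<A> D u a = 0}"

definition regular_connection :: "('m, 'e::euclidean_space) chart set \<Rightarrow> ('m, 'e) connection \<Rightarrow> bool" where
  "regular_connection \<A> D \<longleftrightarrow> linear_connection \<A> D \<and>
     (\<forall>u\<in>slit_bundle \<A>.
        vertical_space \<A> u \<inter> horizontal_space \<A> D u = {0} \<and>
        tangent_space (slit_atlas \<A>) u
          = {a + b | a b. a \<in> vertical_space \<A> u \<and> b \<in> horizontal_space \<A> D u})"

definition horizontal_map :: "('m, 'e::euclidean_space) chart set \<Rightarrow> ('m, 'e) connection \<Rightarrow>
    ('m, 'e) tpoint \<Rightarrow> ('m, 'e) tvec \<Rightarrow> ('m, 'e) svec" where
  "horizontal_map \<A> D u = the_inv_into (horizontal_space \<A> D u) (rho \<A> u)"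

definition gam_field :: "('m, 'e::euclidean_space) chart set \<Rightarrow>
    ('m, 'e) pifield \<Rightarrow> ('m, 'e) sfield" where
  "gam_field \<A> = on_fields \<A> (gam \<A>)"

definition rho_field :: "('m, 'e::euclidean_space) chart set \<Rightarrow>
    ('m, 'e) sfield \<Rightarrow> ('m, 'e) pifield" where
  "rho_field \<A> = on_fields \<A> (rho \<A>)"

definition beta_field :: "('m, 'e::euclidean_space) chart set \<Rightarrow> ('m, 'e) connection \<Rightarrow>
    ('m, 'e) pifield \<Rightarrow> ('m, 'e) sfield" where
  "beta_field \<A> D = on_fields \<A> (horizontal_map \<A> D)"

definition K_field :: "('m, 'e::euclidean_space) chart set \<Rightarrow> ('m, 'e) connection \<Rightarrow>
    ('m, 'e) sfield \<Rightarrow> ('m, 'e) pifield" where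
  "K_field \<A> D = on_fields \<A> (connection_map \<A> D)"

definition torsion :: "('m, 'e::euclidean_space) chart set \<Rightarrow> ('m, 'e) connection \<Rightarrow>
    ('m, 'e) sfield \<Rightarrow> ('m, 'e) sfield \<Rightarrow> ('m, 'e) pifield" where
  "torsion \<A> D A B = cov \<A> D A (rho_field \<A> B) - cov \<A> D B (rho_field \<A> A)
     - rho_field \<A> (lie_bracket (slit_atlas \<A>) A B)"

text \<open>Note the sign. Every \<open>\<pi>\<close>-vector field \<open>Z\<close> is \<open>\<rho> C\<close> for some vector field \<open>C\<close>.\<close>
definition curvature :: "('m, 'e::euclidean_space) chart set \<Rightarrow> ('m, 'e) connection \<Rightarrow>
    ('m, 'e) sfield \<Rightarrow> ('m, 'e) sfield \<Rightarrow> ('m, 'e) pifield \<Rightarrow> ('m, 'e) pifield" where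
  "curvature \<A> D A B Z = - cov \<A> D A (cov \<A> D B Z) + cov \<A> D B (cov \<A> D A Z)
     + cov \<A> D (lie_bracket (slit_atlas \<A>) A B) Z"

definition h_torsion :: "('m, 'e::euclidean_space) chart set \<Rightarrow> ('m, 'e) connection \<Rightarrow>
    ('m, 'e) pifield \<Rightarrow> ('m, 'e) pifield \<Rightarrow> ('m, 'e) pifield" where
  "h_torsion \<A> D X Y = torsion \<A> D (beta_field \<A> D X) (beta_field \<A> D Y)"

definition hv_torsion :: "('m, 'e::euclidean_space) chart set \<Rightarrow> ('m, 'e) connection \<Rightarrow>
    ('m, 'e) pifield \<Rightarrow> ('m, 'e) pifield \<Rightarrow> ('m, 'e) pifield" where
  "hv_torsion \<A> D X Y = torsion \<A> D (gam_field \<A> X) (beta_field \<A> D Y)"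

definition h_curvature :: "('m, 'e::euclidean_space) chart set \<Rightarrow> ('m, 'e) connection \<Rightarrow>
    ('m, 'e) pifield \<Rightarrow> ('m, 'e) pifield \<Rightarrow> ('m, 'e) pifield \<Rightarrow> ('m, 'e) pifield" where
  "h_curvature \<A> D X Y = curvature \<A> D (beta_field \<A> D X) (beta_field \<A> D Y)"

definition hv_curvature :: "('m, 'e::euclidean_space) chart set \<Rightarrow> ('m, 'e) connection \<Rightarrow>
    ('m, 'e) pifield \<Rightarrow> ('m, 'e) pifield \<Rightarrow> ('m, 'e) pifield \<Rightarrow> ('m, 'e) pifield" where
  "hv_curvature \<A> D X Y = curvature \<A> D (beta_field \<A> D X) (gam_field \<A> Y)"

definition v_curvature :: "('m, 'e::euclidean_space) chart set \<Rightarrow> ('m, 'e) connection \<Rightarrow>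
    ('m, 'e) pifield \<Rightarrow> ('m, 'e) pifield \<Rightarrow> ('m, 'e) pifield \<Rightarrow> ('m, 'e) pifield" where
  "v_curvature \<A> D X Y = curvature \<A> D (gam_field \<A> X) (gam_field \<A> Y)"

definition cov_curv :: "('m, 'e::euclidean_space) chart set \<Rightarrow> ('m, 'e) connection \<Rightarrow> ('m, 'e) sfield \<Rightarrow>
    (('m, 'e) pifield \<Rightarrow> ('m, 'e) pifield \<Rightarrow> ('m, 'e) pifield \<Rightarrow> ('m, 'e) pifield) \<Rightarrow>
    ('m, 'e) pifield \<Rightarrow> ('m, 'e) pifield \<Rightarrow> ('m, 'e) pifield \<Rightarrow> ('m, 'e) pifield" where
  "cov_curv \<A> D A B X Y Z = cov \<A> D A (B X Y Z)
     - B (cov \<A> D A X) Y Z - B X (cov \<A> D A Y) Z - B X Y (cov \<A> D A Z)"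

definition metric_field :: "(('m, 'e::euclidean_space) tpoint \<Rightarrow> real) \<Rightarrow>
    ('m, 'e) pifield \<Rightarrow> ('m, 'e) pifield \<Rightarrow> ('m, 'e) tpoint \<Rightarrow> real" where
  "metric_field L X Y u = finsler_metric L u (X u) (Y u)"

definition metric_connection :: "('m, 'e::euclidean_space) chart set \<Rightarrow> (('m, 'e) tpoint \<Rightarrow> real) \<Rightarrow>
    ('m, 'e) connection \<Rightarrow> bool" where
  "metric_connection \<A> L D \<longleftrightarrow>
     (\<forall>A\<in>vector_fields (slit_atlas \<A>). \<forall>X\<in>pi_fields \<A>. \<forall>Y\<in>pi_fields \<A>. \<forall>u\<in>slit_bundle \<A>.
        differential (slit_atlas \<A>) (metric_field L X Y) u (A u)
          = metric_field L (cov \<A> D A X) Y u + metric_field L X (cov \<A> D A Y) u)"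

definition cartan_connection :: "('m, 'e::euclidean_space) chart set \<Rightarrow> (('m, 'e) tpoint \<Rightarrow> real) \<Rightarrow>
    ('m, 'e) connection \<Rightarrow> bool" where
  "cartan_connection \<A> L D \<longleftrightarrow>
     regular_connection \<A> D \<and>
     metric_connection \<A> L D \<and>
     (\<forall>X\<in>pi_fields \<A>. \<forall>Y\<in>pi_fields \<A>. \<forall>u\<in>slit_bundle \<A>. h_torsion \<A> D X Y u = 0) \<and>
     (\<forall>X\<in>pi_fields \<A>. \<forall>Y\<in>pi_fields \<A>. \<forall>Z\<in>pi_fields \<A>. \<forall>u\<in>slit_bundle \<A>.
        metric_field L (hv_torsion \<A> D X Y) Z u = metric_field L (hv_torsion \<A> D X Z) Y u)"

definition cyclic_sum :: "('a \<Rightarrow> 'a \<Rightarrow> 'a \<Rightarrow> 'b::plus) \<Rightarrow> 'a \<Rightarrow> 'a \<Rightarrow> 'a \<Rightarrow> 'b" where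
  "cyclic_sum F X Y Z = F X Y Z + F Y Z X + F Z X Y"

end

theory Submission
  imports Defs
begin

text \<open>
  All identities are consequences of the Jacobi identity, in the form of the two Bianchi identities
  for vector fields on the slit tangent bundle, once the brackets \<open>[\<beta> X, \<beta> Y]\<close> and \<open>[\<gamma> X, \<beta> Y]\<close> are
  split into horizontal and vertical parts. The splitting uses \<open>K \<circ> \<gamma> = id\<close>, that is \<open>T(X, \<eta>) = 0\<close>,
  which together with \<open>T(\<eta>, X) = 0\<close> comes from Euler's theorem for the energy, since \<open>2 g(T(Z, X), Y)\<close> is
  the derivative of \<open>g(X, Y)\<close> along \<open>\<gamma> Z\<close> for \<open>X\<close>, \<open>Y\<close> constant on the fibres. The torsion Bianchi identities and the symmetry properties of \<open>T\<close> then
  give \<open>P(X, \<eta>) = 0\<close> and \<open>S(X, \<eta>) = 0\<close>, hence (g), and \<open>P(\<eta>, X)\<eta> = 0\<close>, which together with \<open>G = \<beta> \<eta>\<close>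
  shows that the Barthel connection is \<open>2 \<beta> \<circ> \<rho> - I\<close>, hence (c).
  The horizontal map \<open>\<beta>\<close> preserves smoothness because it solves a linear system with smooth coefficients.
\<close>

section \<open>The algebra of a Cartan connection\<close>

text \<open>The curvatures and torsions act on global fields, so the identities are proved for
  fields and evaluated at points only at the end. The algebra works without multiplication by
  functions: fields form abelian groups, and \<open>f + f = 0\<close> replaces
  \<open>2 f = 0\<close>. The \<open>fibre\<close> assumptions rest on the fact that
  \<open>rh (br (ga Z) (be Y))\<close> is, in coordinates, the derivative of the components of
  \<open>Y\<close> in the fibre direction \<open>Z\<close>, whatever \<beta> is. They say that the
  derivative of the metric along \<gamma> \<eta> is 0, that its derivative along \<gamma> Z is 0
  once an argument is \<eta>, and that \<eta> has derivative \<open>Z\<close>. The analytic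
  obstacle: a connection is assumed to give smooth results for globally defined smooth fields only,
  while \<beta> is given by a linear condition in each single tangent space. Its coefficients in a
  chart are smooth because coordinate fields can be cut off to global ones; extending by 0 is smooth
  since compact sets are closed in a Hausdorff space. For P(X, \<eta>) no symmetric expression is at
  hand as for S(X, \<eta>), so a Koszul-type permutation of the arguments determines it.\<close>

locale cartan_algebra =
  fixes V :: "'v::ab_group_add set" and Pi :: "'p::ab_group_add set"
    and br :: "'v \<Rightarrow> 'v \<Rightarrow> 'v" and cv :: "'v \<Rightarrow> 'p \<Rightarrow> 'p"
    and rh :: "'v \<Rightarrow> 'p" and be ga :: "'p \<Rightarrow> 'v" and et :: 'p
    and g :: "'p \<Rightarrow> 'p \<Rightarrow> 'u \<Rightarrow> real" and df :: "'v \<Rightarrow> ('u \<Rightarrow> real) \<Rightarrow> 'u \<Rightarrow> real"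
  assumes V_0 [simp]: "0 \<in> V"
    and V_add [simp]: "\<lbrakk>A \<in> V; B \<in> V\<rbrakk> \<Longrightarrow> A + B \<in> V"
    and V_minus [simp]: "A \<in> V \<Longrightarrow> - A \<in> V"
    and Pi_0 [simp]: "0 \<in> Pi"
    and Pi_add [simp]: "\<lbrakk>X \<in> Pi; Y \<in> Pi\<rbrakk> \<Longrightarrow> X + Y \<in> Pi"
    and Pi_minus [simp]: "X \<in> Pi \<Longrightarrow> - X \<in> Pi"
    and br_closed [simp]: "\<lbrakk>A \<in> V; B \<in> V\<rbrakk> \<Longrightarrow> br A B \<in> V"
    and br_add: "\<lbrakk>A \<in> V; B \<in> V; C \<in> V\<rbrakk> \<Longrightarrow> br (A + B) C = br A C + br B C"
    and br_anti: "\<lbrakk>A \<in> V; B \<in> V\<rbrakk> \<Longrightarrow> br A B = - br B A"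
    and jacobi: "\<lbrakk>A \<in> V; B \<in> V; C \<in> V\<rbrakk> \<Longrightarrow> br A (br B C) + br B (br C A) + br C (br A B) = 0"
    and cv_closed [simp]: "\<lbrakk>A \<in> V; X \<in> Pi\<rbrakk> \<Longrightarrow> cv A X \<in> Pi"
    and cv_add_left: "\<lbrakk>A \<in> V; B \<in> V; X \<in> Pi\<rbrakk> \<Longrightarrow> cv (A + B) X = cv A X + cv B X"
    and cv_add_right: "\<lbrakk>A \<in> V; X \<in> Pi; Y \<in> Pi\<rbrakk> \<Longrightarrow> cv A (X + Y) = cv A X + cv A Y"
    and rh_closed [simp]: "A \<in> V \<Longrightarrow> rh A \<in> Pi"
    and rh_add: "\<lbrakk>A \<in> V; B \<in> V\<rbrakk> \<Longrightarrow> rh (A + B) = rh A + rh B"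
    and be_closed [simp]: "X \<in> Pi \<Longrightarrow> be X \<in> V"
    and be_add: "\<lbrakk>X \<in> Pi; Y \<in> Pi\<rbrakk> \<Longrightarrow> be (X + Y) = be X + be Y"
    and ga_closed [simp]: "X \<in> Pi \<Longrightarrow> ga X \<in> V"
    and ga_add: "\<lbrakk>X \<in> Pi; Y \<in> Pi\<rbrakk> \<Longrightarrow> ga (X + Y) = ga X + ga Y"
    and et [simp]: "et \<in> Pi"
    and rh_be [simp]: "X \<in> Pi \<Longrightarrow> rh (be X) = X"
    and rh_ga [simp]: "X \<in> Pi \<Longrightarrow> rh (ga X) = 0"
    and K_be [simp]: "X \<in> Pi \<Longrightarrow> cv (be X) et = 0"
    and vh_zero: "\<lbrakk>A \<in> V; rh A = 0; cv A et = 0\<rbrakk> \<Longrightarrow> A = 0"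
    and rh_br_ga [simp]: "\<lbrakk>X \<in> Pi; Y \<in> Pi\<rbrakk> \<Longrightarrow> rh (br (ga X) (ga Y)) = 0"
    and g_add: "\<lbrakk>X \<in> Pi; Y \<in> Pi; Z \<in> Pi\<rbrakk> \<Longrightarrow> g (X + Y) Z = g X Z + g Y Z"
    and g_sym: "\<lbrakk>X \<in> Pi; Y \<in> Pi\<rbrakk> \<Longrightarrow> g X Y = g Y X"
    and g_definite: "\<lbrakk>X \<in> Pi; g X X = 0\<rbrakk> \<Longrightarrow> X = 0"
    and metric: "\<lbrakk>A \<in> V; X \<in> Pi; Y \<in> Pi\<rbrakk> \<Longrightarrow> df A (g X Y) = g (cv A X) Y + g X (cv A Y)"
    and df_br: "\<lbrakk>A \<in> V; B \<in> V; X \<in> Pi; Y \<in> Pi\<rbrakk> \<Longrightarrow>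
      df (br A B) (g X Y) = df A (df B (g X Y)) - df B (df A (g X Y))"
    and df_add: "\<lbrakk>A \<in> V; X \<in> Pi; Y \<in> Pi; Z \<in> Pi; W \<in> Pi\<rbrakk> \<Longrightarrow>
      df A (g X Y + g Z W) = df A (g X Y) + df A (g Z W)"
    and Q_zero: "\<lbrakk>X \<in> Pi; Y \<in> Pi\<rbrakk> \<Longrightarrow>
      cv (be X) (rh (be Y)) - cv (be Y) (rh (be X)) - rh (br (be X) (be Y)) = 0"
    and T_symmetric: "\<lbrakk>X \<in> Pi; Y \<in> Pi; Z \<in> Pi\<rbrakk> \<Longrightarrow>
      g (cv (ga X) (rh (be Y)) - cv (be Y) (rh (ga X)) - rh (br (ga X) (be Y))) Z =
      g (cv (ga X) (rh (be Z)) - cv (be Z) (rh (ga X)) - rh (br (ga X) (be Z))) Y"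
    and fibre_eta: "\<lbrakk>X \<in> Pi; Y \<in> Pi\<rbrakk> \<Longrightarrow>
      df (ga et) (g X Y) = g (rh (br (ga et) (be X))) Y + g X (rh (br (ga et) (be Y)))"
    and fibre_g_eta: "\<lbrakk>Z \<in> Pi; Y \<in> Pi\<rbrakk> \<Longrightarrow>
      df (ga Z) (g et Y) = g Z Y + g et (rh (br (ga Z) (be Y)))"
    and fibre_id [simp]: "Z \<in> Pi \<Longrightarrow> rh (br (ga Z) (be et)) = Z"
begin

section \<open>Torsion and curvature as biadditive operations on fields\<close>

definition tor :: "'v \<Rightarrow> 'v \<Rightarrow> 'p" where
  "tor A B = cv A (rh B) - cv B (rh A) - rh (br A B)"

definition curv :: "'v \<Rightarrow> 'v \<Rightarrow> 'p \<Rightarrow> 'p" where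
  "curv A B Z = - cv A (cv B Z) + cv B (cv A Z) + cv (br A B) Z"

lemma V_diff [simp]: "\<lbrakk>A \<in> V; B \<in> V\<rbrakk> \<Longrightarrow> A - B \<in> V"
  using V_add[of A "- B"] by simp

lemma Pi_diff [simp]: "\<lbrakk>X \<in> Pi; Y \<in> Pi\<rbrakk> \<Longrightarrow> X - Y \<in> Pi"
  using Pi_add[of X "- Y"] by simp

lemma br_zero_left [simp]: "C \<in> V \<Longrightarrow> br 0 C = 0"
  using br_add[of 0 0 C] by simp
lemma br_add_right: "\<lbrakk>A \<in> V; B \<in> V; C \<in> V\<rbrakk> \<Longrightarrow> br C (A + B) = br C A + br C B"
  by (simp add: br_anti[of C] br_add)
lemma br_zero_right [simp]: "C \<in> V \<Longrightarrow> br C 0 = 0"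
  using br_add_right[of 0 0 C] by simp

lemma cv_zero_left [simp]: "X \<in> Pi \<Longrightarrow> cv 0 X = 0"
  using cv_add_left[of 0 0 X] by simp
lemma cv_zero_right [simp]: "A \<in> V \<Longrightarrow> cv A 0 = 0"
  using cv_add_right[of A 0 0] by simp
lemma cv_minus_left: "\<lbrakk>A \<in> V; X \<in> Pi\<rbrakk> \<Longrightarrow> cv (- A) X = - cv A X"
  using cv_add_left[of A "- A" X] by (simp add: eq_neg_iff_add_eq_0 add.commute)
lemma cv_minus_right: "\<lbrakk>A \<in> V; X \<in> Pi\<rbrakk> \<Longrightarrow> cv A (- X) = - cv A X"
  using cv_add_right[of A X "- X"] by (simp add: eq_neg_iff_add_eq_0 add.commute)
lemma cv_diff_left: "\<lbrakk>A \<in> V; B \<in> V; X \<in> Pi\<rbrakk> \<Longrightarrow> cv (A - B) X = cv A X - cv B X"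
  using cv_add_left[of A "- B" X] by (simp add: cv_minus_left)
lemma cv_diff_right: "\<lbrakk>A \<in> V; X \<in> Pi; Y \<in> Pi\<rbrakk> \<Longrightarrow> cv A (X - Y) = cv A X - cv A Y"
  using cv_add_right[of A X "- Y"] by (simp add: cv_minus_right)

lemma rh_zero [simp]: "rh 0 = 0"
  using rh_add[of 0 0] by simp
lemma rh_minus: "A \<in> V \<Longrightarrow> rh (- A) = - rh A"
  using rh_add[of A "- A"] by (simp add: eq_neg_iff_add_eq_0 add.commute)
lemma rh_diff: "\<lbrakk>A \<in> V; B \<in> V\<rbrakk> \<Longrightarrow> rh (A - B) = rh A - rh B"
  using rh_add[of A "- B"] by (simp add: rh_minus)
lemma be_zero [simp]: "be 0 = 0"
  using be_add[of 0 0] by simp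
lemma be_minus: "X \<in> Pi \<Longrightarrow> be (- X) = - be X"
  using be_add[of X "- X"] by (simp add: eq_neg_iff_add_eq_0 add.commute)
lemma be_diff: "\<lbrakk>X \<in> Pi; Y \<in> Pi\<rbrakk> \<Longrightarrow> be (X - Y) = be X - be Y"
  using be_add[of X "- Y"] by (simp add: be_minus)
lemma ga_zero [simp]: "ga 0 = 0"
  using ga_add[of 0 0] by simp
lemma ga_minus: "X \<in> Pi \<Longrightarrow> ga (- X) = - ga X"
  using ga_add[of X "- X"] by (simp add: eq_neg_iff_add_eq_0 add.commute)
lemma ga_diff: "\<lbrakk>X \<in> Pi; Y \<in> Pi\<rbrakk> \<Longrightarrow> ga (X - Y) = ga X - ga Y"
  using ga_add[of X "- Y"] by (simp add: ga_minus)

lemma g_zero_left [simp]: "Z \<in> Pi \<Longrightarrow> g 0 Z = 0"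
  using g_add[of 0 0 Z] by simp
lemma g_minus_left: "\<lbrakk>X \<in> Pi; Z \<in> Pi\<rbrakk> \<Longrightarrow> g (- X) Z = - g X Z"
  using g_add[of X "- X" Z] by (simp add: eq_neg_iff_add_eq_0 add.commute)
lemma g_diff: "\<lbrakk>X \<in> Pi; Y \<in> Pi; Z \<in> Pi\<rbrakk> \<Longrightarrow> g (X - Y) Z = g X Z - g Y Z"
  using g_add[of X "- Y" Z] by (simp add: g_minus_left)
lemma g_zero_right [simp]: "Z \<in> Pi \<Longrightarrow> g Z 0 = 0"
  by (simp add: g_sym[of Z])
lemma g_nondegenerate:
  assumes "X \<in> Pi" and "\<And>Y. Y \<in> Pi \<Longrightarrow> g X Y = 0"
  shows "X = 0"
  using assms g_definite by blast

text \<open>The algebra has no scalar multiplication, so arguments that play symmetry against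
  skewness end with a doubled function.\<close>

lemma double_eq_zero: "f + f = 0 \<Longrightarrow> f = 0" for f :: "'u \<Rightarrow> real"
  by (auto simp: fun_eq_iff)

lemma tor_closed [simp]: "\<lbrakk>A \<in> V; B \<in> V\<rbrakk> \<Longrightarrow> tor A B \<in> Pi"
  by (simp add: tor_def)
lemma curv_closed [simp]: "\<lbrakk>A \<in> V; B \<in> V; Z \<in> Pi\<rbrakk> \<Longrightarrow> curv A B Z \<in> Pi"
  by (simp add: curv_def)

lemma tor_anti: "\<lbrakk>A \<in> V; B \<in> V\<rbrakk> \<Longrightarrow> tor A B = - tor B A"
  by (simp add: tor_def br_anti[of A B] rh_minus)
lemma tor_add: "\<lbrakk>A \<in> V; B \<in> V; C \<in> V\<rbrakk> \<Longrightarrow> tor (A + B) C = tor A C + tor B C"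
  by (simp add: tor_def br_add rh_add cv_add_left cv_add_right)
lemma tor_zero_left [simp]: "C \<in> V \<Longrightarrow> tor 0 C = 0"
  by (simp add: tor_def)

lemma tor_minus: "\<lbrakk>A \<in> V; C \<in> V\<rbrakk> \<Longrightarrow> tor (- A) C = - tor A C"
  using tor_add[of A "- A" C] by (simp add: eq_neg_iff_add_eq_0 add.commute)
lemma tor_diff: "\<lbrakk>A \<in> V; B \<in> V; C \<in> V\<rbrakk> \<Longrightarrow> tor (A - B) C = tor A C - tor B C"
  using tor_add[of A "- B" C] by (simp add: tor_minus)

lemma tor_add_right: "\<lbrakk>A \<in> V; B \<in> V; C \<in> V\<rbrakk> \<Longrightarrow> tor C (A + B) = tor C A + tor C B"
  by (simp add: tor_anti[of C] tor_add)
lemma tor_diff_right: "\<lbrakk>A \<in> V; B \<in> V; C \<in> V\<rbrakk> \<Longrightarrow> tor C (A - B) = tor C A - tor C B"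
  by (simp add: tor_anti[of C] tor_diff)
lemma tor_zero_right [simp]: "C \<in> V \<Longrightarrow> tor C 0 = 0"
  by (simp add: tor_anti[of C])

lemma curv_anti: "\<lbrakk>A \<in> V; B \<in> V; Z \<in> Pi\<rbrakk> \<Longrightarrow> curv A B Z = - curv B A Z"
  by (simp add: curv_def br_anti[of A B] cv_minus_left)
lemma curv_add: "\<lbrakk>A \<in> V; B \<in> V; C \<in> V; Z \<in> Pi\<rbrakk> \<Longrightarrow> curv (A + B) C Z = curv A C Z + curv B C Z"
  by (simp add: curv_def br_add cv_add_left cv_add_right)
lemma curv_zero_left [simp]: "\<lbrakk>C \<in> V; Z \<in> Pi\<rbrakk> \<Longrightarrow> curv 0 C Z = 0"
  by (simp add: curv_def)
lemma curv_zero_mid [simp]: "\<lbrakk>C \<in> V; Z \<in> Pi\<rbrakk> \<Longrightarrow> curv C 0 Z = 0"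
  by (simp add: curv_def)
lemma curv_zero_right [simp]: "\<lbrakk>A \<in> V; B \<in> V\<rbrakk> \<Longrightarrow> curv A B 0 = 0"
  by (simp add: curv_def)
lemma curv_minus: "\<lbrakk>A \<in> V; C \<in> V; Z \<in> Pi\<rbrakk> \<Longrightarrow> curv (- A) C Z = - curv A C Z"
  using curv_add[of A "- A" C Z] by (simp add: eq_neg_iff_add_eq_0 add.commute)
lemma curv_diff: "\<lbrakk>A \<in> V; B \<in> V; C \<in> V; Z \<in> Pi\<rbrakk> \<Longrightarrow> curv (A - B) C Z = curv A C Z - curv B C Z"
  using curv_add[of A "- B" C Z] by (simp add: curv_minus)

section \<open>Bianchi identities for arbitrary fields and skewness of the curvature\<close>

lemma bianchi_first:
  assumes [simp]: "A \<in> V" "B \<in> V" "C \<in> V"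
  shows "cv A (tor B C) + cv B (tor C A) + cv C (tor A B)
      - tor (br A B) C - tor (br B C) A - tor (br C A) B
    = - (curv A B (rh C) + curv B C (rh A) + curv C A (rh B))"
proof -
  \<comment> \<open>After expansion everything cancels except \<rho> of the double brackets, whose
    sum is \<rho> of the Jacobi sum. The minus sign on the right of the goal reflects the sign
    convention of the curvature.\<close>
  have "rh (br A (br B C) + br B (br C A) + br C (br A B)) = 0"
    by (simp add: jacobi)
  then have J: "rh (br A (br B C)) + rh (br B (br C A)) + rh (br C (br A B)) = 0"
    by (simp add: rh_add)
  show ?thesis
    using J
    by (simp add: tor_def curv_def cv_diff_right cv_add_right br_anti[of "br A B" C] br_anti[of "br B C" A]
        br_anti[of "br C A" B] rh_minus algebra_simps)
qed

lemma bianchi_second: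
  assumes [simp]: "A \<in> V" "B \<in> V" "C \<in> V" "W \<in> Pi"
  shows "cv A (curv B C W) - curv B C (cv A W) + cv B (curv C A W) - curv C A (cv B W)
      + cv C (curv A B W) - curv A B (cv C W)
      - curv (br A B) C W - curv (br B C) A W - curv (br C A) B W = 0"
proof -
  \<comment> \<open>The curvatures in the direction of a bracket contain covariant derivatives of
    \<open>W\<close> along double brackets; these add up to the derivative along the Jacobi
    sum.\<close>
  have "cv (br A (br B C) + br B (br C A) + br C (br A B)) W = 0"
    by (simp add: jacobi)
  then have J: "cv (br A (br B C)) W + cv (br B (br C A)) W + cv (br C (br A B)) W = 0"
    by (simp add: cv_add_left)
  show ?thesis
    using J
    by (simp add: curv_def cv_add_right cv_minus_right cv_diff_right br_anti[of "br A B" C] br_anti[of "br B C" A]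
        br_anti[of "br C A" B] cv_minus_left algebra_simps)
qed

text \<open>Expand the action of [A, B] on g(Z, W) by applying the metric condition twice: the
  products of two first derivatives are the same in both orders and cancel in the commutator. The
  first differentiation yields a sum of two metric products, hence \<open>df_add\<close>.\<close>

lemma curv_skew:
  assumes [simp]: "A \<in> V" "B \<in> V" "Z \<in> Pi" "W \<in> Pi"
  shows "g (curv A B Z) W = - g (curv A B W) Z"
  using df_br[of A B Z W]
  by (simp add: metric df_add curv_def g_add g_minus_left g_diff g_sym[of W] g_sym[of _ "cv A W"]
      g_sym[of _ "cv B W"] g_sym[of _ "cv (br A B) W"] g_sym[of _ "cv A (cv B W)"] g_sym[of _ "cv B (cv A W)"] algebra_simps)

section \<open>Torsion of horizontal and vertical lifts, and the splitting of a field\<close>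

lemma tor_ga_be: "\<lbrakk>X \<in> Pi; Y \<in> Pi\<rbrakk> \<Longrightarrow> tor (ga X) (be Y) = cv (ga X) Y - rh (br (ga X) (be Y))"
  by (simp add: tor_def)
lemma tor_be_be [simp]: "\<lbrakk>X \<in> Pi; Y \<in> Pi\<rbrakk> \<Longrightarrow> tor (be X) (be Y) = 0"
  using Q_zero by (simp add: tor_def)
lemma tor_ga_ga [simp]: "\<lbrakk>X \<in> Pi; Y \<in> Pi\<rbrakk> \<Longrightarrow> tor (ga X) (ga Y) = 0"
  by (simp add: tor_def)

lemma rh_br_be_be: "\<lbrakk>X \<in> Pi; Y \<in> Pi\<rbrakk> \<Longrightarrow> rh (br (be X) (be Y)) = cv (be X) Y - cv (be Y) X"
  using Q_zero[of X Y] by (simp add: algebra_simps)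

lemma T_sym: "\<lbrakk>X \<in> Pi; Y \<in> Pi; Z \<in> Pi\<rbrakk> \<Longrightarrow> g (tor (ga X) (be Y)) Z = g (tor (ga X) (be Z)) Y"
  using T_symmetric by (simp add: tor_def)

text \<open>Subtracting \<open>fibre_eta\<close> from the metric condition along \<gamma> \<eta>
  leaves the symmetrization of g(T(\<eta>, X), Y) in X and Y. By the symmetry of T this is twice the
  term itself.\<close>

lemma T_eta_left [simp]:
  assumes [simp]: "X \<in> Pi"
  shows "tor (ga et) (be X) = 0"
proof (rule g_nondegenerate)
  fix Y assume [simp]: "Y \<in> Pi"
  have "g (tor (ga et) (be X)) Y + g (tor (ga et) (be Y)) X = 0"
    using fibre_eta[of X Y] metric[of "ga et" X Y]
    by (simp add: tor_ga_be g_diff g_sym[of X] algebra_simps)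
  then show "g (tor (ga et) (be X)) Y = 0"
    using T_sym[of et X Y] by (simp add: double_eq_zero)
qed simp

text \<open>The same subtraction with \<open>fibre_g_eta\<close>, where now the direction of
  differentiation is arbitrary and \<eta> is an argument of the metric.\<close>

lemma T_eta_right [simp]:
  assumes [simp]: "Z \<in> Pi"
  shows "tor (ga Z) (be et) = 0"
proof (rule g_nondegenerate)
  fix Y assume [simp]: "Y \<in> Pi"
  have "g (tor (ga Z) (be et)) Y + g (tor (ga Z) (be Y)) et = 0"
    using fibre_g_eta[of Z Y] metric[of "ga Z" et Y]
    by (simp add: tor_ga_be g_diff g_sym[of et] algebra_simps)
  then show "g (tor (ga Z) (be et)) Y = 0"
    using T_sym[of Z et Y] by (simp add: double_eq_zero)
qed simp

text \<open>Since \<rho>[\<gamma> Z, \<beta> \<eta>] = Z, the torsion T(Z, \<eta>) is the difference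
  of K(\<gamma> Z) and Z.\<close>

lemma K_ga [simp]: "Z \<in> Pi \<Longrightarrow> cv (ga Z) et = Z"
  using T_eta_right[of Z] by (simp add: tor_ga_be)

text \<open>Both \<rho> and K vanish on the difference of the two sides, the latter because K is a
  left inverse of \<gamma>.\<close>

lemma decompose:
  assumes [simp]: "A \<in> V"
  shows "A = be (rh A) + ga (cv A et)"
proof -
  have "A - (be (rh A) + ga (cv A et)) = 0"
    by (rule vh_zero) (simp_all add: rh_diff rh_add cv_diff_left cv_add_left)
  then show ?thesis by simp
qed

section \<open>Brackets of lifts and the Bianchi identities split into components\<close>

lemma curv_be_be_eta:
  assumes [simp]: "X \<in> Pi" "Y \<in> Pi"
  shows "curv (be X) (be Y) et = cv (br (be X) (be Y)) et"
  by (simp add: curv_def)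

text \<open>The horizontal part expresses the vanishing of the h-torsion. The vertical part is
  K[\<beta> X, \<beta> Y], and this is R(X, Y)\<eta> because K vanishes on horizontal
  fields.\<close>

lemma br_be_be:
  assumes [simp]: "X \<in> Pi" "Y \<in> Pi"
  shows "br (be X) (be Y) = be (cv (be X) Y) - be (cv (be Y) X) + ga (curv (be X) (be Y) et)"
  by (subst decompose) (simp_all add: rh_br_be_be be_diff curv_be_be_eta)

text \<open>K returns X on \<gamma> X instead of vanishing, so besides P(Y, X)\<eta> the vertical
  part contains the derivative of X along \<beta> Y.\<close>

lemma br_ga_be:
  assumes [simp]: "X \<in> Pi" "Y \<in> Pi"
  shows "br (ga X) (be Y) = be (cv (ga X) Y) - be (tor (ga X) (be Y))
    - ga (curv (be Y) (ga X) et) - ga (cv (be Y) X)"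
proof -
  have "cv (br (ga X) (be Y)) et = - curv (be Y) (ga X) et - cv (be Y) X"
    by (simp add: curv_def br_anti[of "ga X"] cv_minus_left)
  moreover have "rh (br (ga X) (be Y)) = cv (ga X) Y - tor (ga X) (be Y)"
    by (simp add: tor_ga_be)
  ultimately show ?thesis
    by (subst decompose) (simp_all add: be_diff ga_diff ga_minus)
qed

text \<open>The torsion of two horizontal fields is 0, so in the first Bianchi identity only the
  vertical parts of the brackets contribute, through T.\<close>

lemma bianchi_h_torsion:
  assumes [simp]: "X \<in> Pi" "Y \<in> Pi" "Z \<in> Pi"
  shows "curv (be X) (be Y) Z - tor (ga (curv (be X) (be Y) et)) (be Z)
    + (curv (be Y) (be Z) X - tor (ga (curv (be Y) (be Z) et)) (be X))
    + (curv (be Z) (be X) Y - tor (ga (curv (be Z) (be X) et)) (be Y)) = 0"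
proof -
  have *: "tor (br (be X) (be Y)) (be Z) = tor (ga (curv (be X) (be Y) et)) (be Z)"
    if [simp]: "X \<in> Pi" "Y \<in> Pi" "Z \<in> Pi" for X Y Z
    by (simp add: br_be_be tor_add flip: be_diff)
  show ?thesis
    using bianchi_first[of "be X" "be Y" "be Z"]
    by (simp add: * algebra_simps)
qed

definition nabla_h :: "'v \<Rightarrow> 'p \<Rightarrow> 'p \<Rightarrow> 'p \<Rightarrow> 'p" where
  "nabla_h A X Y Z = cv A (curv (be X) (be Y) Z) - curv (be (cv A X)) (be Y) Z
     - curv (be X) (be (cv A Y)) Z - curv (be X) (be Y) (cv A Z)"

definition nabla_hv :: "'v \<Rightarrow> 'p \<Rightarrow> 'p \<Rightarrow> 'p \<Rightarrow> 'p" where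
  "nabla_hv A X Y Z = cv A (curv (be X) (ga Y) Z) - curv (be (cv A X)) (ga Y) Z
     - curv (be X) (ga (cv A Y)) Z - curv (be X) (ga Y) (cv A Z)"

lemma curv_br_be_be:
  assumes [simp]: "X \<in> Pi" "Y \<in> Pi" "C \<in> V" "W \<in> Pi"
  shows "curv (br (be X) (be Y)) C W = curv (be (cv (be X) Y)) C W - curv (be (cv (be Y) X)) C W
    + curv (ga (curv (be X) (be Y) et)) C W"
  by (simp add: br_be_be curv_add curv_diff)

lemma curv_br_ga_be:
  assumes [simp]: "X \<in> Pi" "Y \<in> Pi" "C \<in> V" "W \<in> Pi"
  shows "curv (br (ga X) (be Y)) C W = curv (be (cv (ga X) Y)) C W - curv (be (tor (ga X) (be Y))) C W
    - curv (ga (curv (be Y) (ga X) et)) C W - curv (ga (cv (be Y) X)) C W"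
  by (simp add: br_ga_be curv_add curv_diff)

text \<open>In the second Bianchi identity the horizontal parts of the brackets supply the
  correction terms of the covariant derivative of R. The vertical parts become the P-terms after an
  exchange of the two directions.\<close>

lemma bianchi_h:
  assumes [simp]: "X \<in> Pi" "Y \<in> Pi" "Z \<in> Pi" "W \<in> Pi"
  shows "nabla_h (be X) Y Z W + curv (be X) (ga (curv (be Y) (be Z) et)) W
     + (nabla_h (be Y) Z X W + curv (be Y) (ga (curv (be Z) (be X) et)) W)
     + (nabla_h (be Z) X Y W + curv (be Z) (ga (curv (be X) (be Y) et)) W) = 0"
  using bianchi_second[of "be X" "be Y" "be Z" W]
  by (simp add: nabla_h_def curv_br_be_be
      curv_anti[of "be X" "be (cv _ _)"] curv_anti[of "be Y" "be (cv _ _)"] curv_anti[of "be Z" "be (cv _ _)"]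
      curv_anti[of _ "ga (curv _ _ _)"] algebra_simps)

text \<open>Here the brackets of \<open>br_ga_be\<close> enter. Their T-part gives the R-terms with
  T inside, their curvature part gives the terms quadratic in P, and the vertical part of
  [\<beta> Y, \<beta> Z] gives the S-term.\<close>

lemma bianchi_hv:
  assumes [simp]: "X \<in> Pi" "Y \<in> Pi" "Z \<in> Pi" "W \<in> Pi"
  shows "nabla_h (ga X) Y Z W + nabla_hv (be Y) Z X W - nabla_hv (be Z) Y X W
      - curv (be Z) (ga (curv (be Y) (ga X) et)) W + curv (be (tor (ga X) (be Y))) (be Z) W
      - curv (ga (curv (be Y) (be Z) et)) (ga X) W
      + curv (be Y) (ga (curv (be Z) (ga X) et)) W - curv (be (tor (ga X) (be Z))) (be Y) W = 0"
  using bianchi_second[of "ga X" "be Y" "be Z" W]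
  by (simp add: nabla_h_def nabla_hv_def curv_br_be_be curv_br_ga_be br_anti[of "be Z" "ga X"] curv_minus
      curv_anti[of "ga X" "be Y"] cv_minus_right
      curv_anti[of "be Y" "be (cv (ga X) Z)"]
      curv_anti[of "be _" "ga (curv _ _ _)"] curv_anti[of "be _" "ga (cv _ _)"] algebra_simps)

text \<open>This determines the part of P(Y, X)Z antisymmetric in Y and Z in terms of torsions.
  \<open>P_eta\<close> and \<open>Phat_eta\<close> combine it with the skewness of the curvature
  with respect to the metric.\<close>

lemma bianchi_hv_torsion:
  assumes [simp]: "X \<in> Pi" "Y \<in> Pi" "Z \<in> Pi"
  shows "curv (be Y) (ga X) Z - curv (be Z) (ga X) Y =
     - cv (be Y) (tor (ga X) (be Z)) + cv (be Z) (tor (ga X) (be Y))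
     - tor (br (ga X) (be Y)) (be Z) + tor (ga X) (br (be Y) (be Z)) + tor (br (ga X) (be Z)) (be Y)"
  using bianchi_first[of "ga X" "be Y" "be Z"]
  by (simp add: tor_anti[of "be Z" "ga X"] cv_minus_right tor_anti[of "br (be Y) (be Z)" "ga X"]
    curv_anti[of "ga X" "be Y"] br_anti[of "be Z" "ga X"] tor_minus algebra_simps)

section \<open>Curvatures with \<eta> as an argument\<close>

lemma tor_br_ga_be:
  assumes [simp]: "X \<in> Pi" "Y \<in> Pi" "Z \<in> Pi"
  shows "tor (br (ga X) (be Y)) (be Z) =
    - tor (ga (curv (be Y) (ga X) et)) (be Z) - tor (ga (cv (be Y) X)) (be Z)"
  by (simp add: br_ga_be tor_diff)

lemma tor_ga_br_be:
  assumes [simp]: "X \<in> Pi" "Y \<in> Pi" "Z \<in> Pi"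
  shows "tor (ga X) (br (be Y) (be Z)) = tor (ga X) (be (cv (be Y) Z)) - tor (ga X) (be (cv (be Z) Y))"
  by (simp add: br_be_be tor_diff_right tor_add_right)

text \<open>As in the Koszul formula, skewness in one pair of arguments and a known
  antisymmetrization in another pair determine the trilinear form \<open>B\<close>. The result
  contains P only as P(X, \<eta>)\<eta> inside T, and T vanishes when an argument is \<eta>, so
  inserting \<eta> removes the terms one after another.\<close>

lemma P_eta:
  assumes [simp]: "X \<in> Pi" "Y \<in> Pi"
  shows "curv (be X) (ga et) Y = 0"
proof -
  define p where "p X = curv (be X) (ga et) et" for X
  have p [simp]: "p X \<in> Pi" if "X \<in> Pi" for X
    using that by (simp add: p_def)
  define C where "C X Y Z = g (tor (ga X) (be Y)) Z" for X Y Z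
  define B where "B X Y Z = g (curv (be X) (ga et) Y) Z" for X Y Z
  \<comment> \<open>With \<eta> as vertical argument the derivatives of T drop out of
    \<open>bianchi_hv_torsion\<close>, because T(\<eta>, Y) = 0 and \<eta> is parallel along
    horizontal fields.\<close>
  have diff: "B X Y Z - B Y X Z = C (p X) Y Z - C (p Y) X Z"
    if [simp]: "X \<in> Pi" "Y \<in> Pi" "Z \<in> Pi" for X Y Z
  proof -
    have "curv (be X) (ga et) Y - curv (be Y) (ga et) X =
        tor (ga (p X)) (be Y) - tor (ga (p Y)) (be X)"
      using bianchi_hv_torsion[of et X Y] by (simp add: tor_br_ga_be tor_ga_br_be p_def)
    then have "g (curv (be X) (ga et) Y - curv (be Y) (ga et) X) Z =
        g (tor (ga (p X)) (be Y) - tor (ga (p Y)) (be X)) Z"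
      by simp
    then show ?thesis
      by (simp add: g_diff B_def C_def)
  qed
  have skew: "B X Y Z = - B X Z Y" if "X \<in> Pi" "Y \<in> Pi" "Z \<in> Pi" for X Y Z
    using that curv_skew[of "be X" "ga et" Y Z] by (simp add: B_def)
  have C_sym: "C X Y Z = C X Z Y" if "X \<in> Pi" "Y \<in> Pi" "Z \<in> Pi" for X Y Z
    using that T_sym[of X Y Z] by (simp add: C_def)
  have B: "B X Y Z = C (p Z) X Y - C (p Y) X Z"
    if [simp]: "X \<in> Pi" "Y \<in> Pi" "Z \<in> Pi" for X Y Z
  proof -
    \<comment> \<open>The six terms of the Koszul combination: by skewness two of them add up to the
      left-hand side and the other four cancel in pairs.\<close>
    have "B X Y Z + B X Y Z = (B X Y Z - B Y X Z) + (B Z X Y - B X Z Y) - (B Y Z X - B Z Y X)"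
      by (simp add: skew[of X Z Y] skew[of Y Z X] skew[of Z Y X])
    also have "\<dots> = (C (p Z) X Y - C (p Y) X Z) + (C (p Z) X Y - C (p Y) X Z)"
      by (simp add: diff C_sym[of "p X" Y Z] C_sym[of "p Y" Z X] C_sym[of "p Z" Y X])
    finally have "(B X Y Z - (C (p Z) X Y - C (p Y) X Z)) + (B X Y Z - (C (p Z) X Y - C (p Y) X Z)) = 0"
      by (simp add: algebra_simps)
    from double_eq_zero[OF this] show ?thesis by simp
  qed
  have C_eta: "C X et Y = 0" "C X Y et = 0" if "X \<in> Pi" "Y \<in> Pi" for X Y
    using that C_sym[of X Y et] by (simp_all add: C_def)
  \<comment> \<open>Order of elimination: X = Y = \<eta> gives P(\<eta>, \<eta>)\<eta> = 0, then Y =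
    \<eta> gives P(X, \<eta>)\<eta> = 0 for all X, and then no term of the formula for
    \<open>B\<close> is left.\<close>
  have "g (p et) Z = 0" if [simp]: "Z \<in> Pi" for Z
    using B[of et et Z] by (simp add: B_def p_def[symmetric] C_eta)
  then have "p et = 0"
    by (intro g_nondegenerate) simp_all
  then have "g (p X) Z = 0" if [simp]: "X \<in> Pi" "Z \<in> Pi" for X Z
    using B[of X et Z] by (simp add: B_def p_def[symmetric] C_eta) (simp add: C_def)
  then have "p X = 0" if "X \<in> Pi" for X
    using that by (intro g_nondegenerate) simp_all
  then have "B X Y Z = 0" if "Z \<in> Pi" for Z
    using that by (simp add: B) (simp add: C_def)
  then show ?thesis
    by (intro g_nondegenerate) (simp_all add: B_def)
qed

text \<open>It suffices to pair the Bianchi identity with \<eta>. All values of T are orthogonal to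
  \<eta>, this persists under differentiation along \<beta> \<eta> because \<eta> is parallel there,
  and skewness then moves \<eta> to the other argument.\<close>

lemma Phat_eta:
  assumes [simp]: "X \<in> Pi"
  shows "curv (be et) (ga X) et = 0"
proof (rule g_nondegenerate)
  fix Y assume [simp]: "Y \<in> Pi"
  let ?DT = "cv (be et) (tor (ga X) (be Y)) - tor (ga (cv (be et) X)) (be Y) - tor (ga X) (be (cv (be et) Y))"
  have *: "curv (be Y) (ga X) et - curv (be et) (ga X) Y = ?DT - tor (ga (curv (be et) (ga X) et)) (be Y)"
    using bianchi_hv_torsion[of X Y et] by (simp add: tor_br_ga_be tor_ga_br_be)
  have eta: "g (tor (ga U) (be V)) et = 0" if "U \<in> Pi" "V \<in> Pi" for U V
    using that T_sym[of U V et] by simp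
  have "df (be et) (g (tor (ga X) (be Y)) et) = df (be et) (0 :: 'u \<Rightarrow> real)"
    by (simp add: eta)
  moreover have "df (be et) (0 :: 'u \<Rightarrow> real) = 0"
    using metric[of "be et" 0 et] by simp
  ultimately have "g (cv (be et) (tor (ga X) (be Y))) et = 0"
    using metric[of "be et" "tor (ga X) (be Y)" et] by simp
  then have "g (curv (be Y) (ga X) et) et - g (curv (be et) (ga X) Y) et = 0"
    using arg_cong[OF *, of "\<lambda>U. g U et"] by (simp add: g_diff eta)
  moreover have "g (curv (be Y) (ga X) et) et = 0"
    by (rule double_eq_zero) (use curv_skew[of "be Y" "ga X" et et] in simp)
  ultimately show "g (curv (be et) (ga X) et) Y = 0"
    using curv_skew[of "be et" "ga X" et Y] by simp
qed simp

text \<open>The first Bianchi identity expresses \<open>S(X, \<eta>)\<close> through \<open>T\<close> as a \<open>g\<close>-symmetric endomorphism,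
  while the curvature of a metric connection is \<open>g\<close>-skew.\<close>
lemma S_eta:
  assumes [simp]: "X \<in> Pi" "Z \<in> Pi"
  shows "curv (ga X) (ga et) Z = 0"
proof (rule g_nondegenerate)
  fix W assume [simp]: "W \<in> Pi"
  let ?br = "cv (br (ga X) (ga et)) et"
  define F where "F Z = cv (ga et) (tor (ga X) (be Z)) - tor (ga X) (be (cv (ga et) Z))
      + tor (ga ?br) (be Z)" for Z
  have br: "br (ga X) (ga et) = ga ?br"
    by (subst decompose) simp_all
  have F: "curv (ga X) (ga et) Z = F Z" if [simp]: "Z \<in> Pi" for Z
  proof -
    have 1: "tor (be Z) (ga X) = - tor (ga X) (be Z)" "tor (be Z) (ga et) = 0"
      by (simp_all add: tor_anti[of "be Z"])
    have 2: "tor (br (ga et) (be Z)) (ga X) = - tor (ga X) (be (cv (ga et) Z))"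
      by (simp add: br_ga_be tor_diff tor_anti[of "be _" "ga X"])
    have "tor (br (be Z) (ga X)) (ga et) = 0"
      by (simp add: br_anti[of "be Z"] br_ga_be tor_minus tor_diff tor_anti[of "be _" "ga et"])
    moreover have "curv (ga et) (be Z) (rh (ga X)) = 0" "curv (be Z) (ga X) (rh (ga et)) = 0"
      by simp_all
    ultimately show ?thesis
      using bianchi_first[of "ga X" "ga et" "be Z"] 1 2
      by (simp add: F_def cv_minus_right br[symmetric] algebra_simps)
  qed
  \<comment> \<open>The first two terms of \<open>F\<close> are symmetric by differentiating the
    symmetry of T along \<gamma> \<eta> with the metric condition; the third is a value of
    T.\<close>
  have F_sym: "g (F Z) W = g (F W) Z"
  proof -
    have "df (ga et) (g (tor (ga X) (be Z)) W) = df (ga et) (g (tor (ga X) (be W)) Z)"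
      by (simp add: T_sym)
    then have "g (cv (ga et) (tor (ga X) (be Z))) W + g (tor (ga X) (be Z)) (cv (ga et) W)
        = g (cv (ga et) (tor (ga X) (be W))) Z + g (tor (ga X) (be W)) (cv (ga et) Z)"
      by (simp add: metric)
    moreover have "g (tor (ga X) (be Z)) (cv (ga et) W) = g (tor (ga X) (be (cv (ga et) W))) Z"
      "g (tor (ga X) (be W)) (cv (ga et) Z) = g (tor (ga X) (be (cv (ga et) Z))) W"
      by (simp_all add: T_sym)
    ultimately show ?thesis
      using T_sym[of ?br Z W] by (simp add: F_def g_add g_diff algebra_simps)
  qed
  have [simp]: "F Z \<in> Pi" "F W \<in> Pi" by (simp_all add: F_def)
  show "g (curv (ga X) (ga et) Z) W = 0"
    by (rule double_eq_zero) (use curv_skew[of "ga X" "ga et" Z W] F_sym in \<open>simp add: F\<close>)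
qed simp

text \<open>In \<open>bianchi_hv\<close> with vertical direction \<eta> every other term contains T,
  P or S with \<eta> as the argument that makes it vanish. This covers the derivatives of P too,
  because \<eta> is parallel along horizontal fields.\<close>

lemma nabla_eta_h:
  assumes [simp]: "X \<in> Pi" "Y \<in> Pi" "Z \<in> Pi"
  shows "nabla_h (ga et) X Y Z = 0"
  using bianchi_hv[of et X Y Z]
  by (simp add: nabla_hv_def P_eta S_eta)

section \<open>The canonical spray and the Barthel connection in the algebra\<close>

lemma symplectic:
  assumes [simp]: "A \<in> V" "B \<in> V"
  shows "df A (g (rh B) et) - df B (g (rh A) et) - g (rh (br A B)) et
    = g (rh B) (cv A et) - g (rh A) (cv B et)"
proof -
  have eta: "g (tor (ga U) (be V)) et = 0" if "U \<in> Pi" "V \<in> Pi" for U V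
    using that T_sym[of U V et] by simp
  \<comment> \<open>The left-hand side of the goal is dd_JE(A, B) with d_JE(A) = g(\<rho> A,
    \<eta>). The torsion of A and B is a difference of values of T, hence orthogonal to \<eta>, and
    only the terms with K survive.\<close>
  have "tor A B = tor (be (rh A) + ga (cv A et)) (be (rh B) + ga (cv B et))"
    using decompose[of A] decompose[of B] by simp
  also have "\<dots> = tor (ga (cv A et)) (be (rh B)) - tor (ga (cv B et)) (be (rh A))"
    by (simp add: tor_add tor_add_right tor_anti[of "be _" "ga _"])
  finally have "g (tor A B) et = 0"
    by (simp add: g_diff eta)
  then show ?thesis
    by (simp add: metric tor_def g_diff g_add algebra_simps)
qed

text \<open>The right-hand side of the hypothesis is -dE(A), because 2 E = g(\<eta>, \<eta>).
  Testing with vertical fields determines \<rho> G, testing with horizontal ones gives K G =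
  0.\<close>

lemma spray_unique:
  assumes [simp]: "G \<in> V"
    and "\<And>A. A \<in> V \<Longrightarrow> df G (g (rh A) et) - df A (g (rh G) et) - g (rh (br G A)) et = - g (cv A et) et"
  shows "G = be et"
proof -
  have eq: "g (rh A) (cv G et) - g (rh G) (cv A et) = - g (cv A et) et" if "A \<in> V" for A
    using assms(2)[OF that] that by (simp add: symplectic)
  have rh: "rh G = et"
  proof -
    have "g (rh G - et) Y = 0" if [simp]: "Y \<in> Pi" for Y
      using eq[of "ga Y"] by (simp add: g_diff g_sym[of Y et])
    then have "rh G - et = 0"
      by (intro g_nondegenerate) simp_all
    then show ?thesis by simp
  qed
  have "g (cv G et) Y = 0" if [simp]: "Y \<in> Pi" for Y
    using eq[of "be Y"] by (simp add: g_sym[of Y])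
  then have "cv G et = 0"
    by (intro g_nondegenerate) simp_all
  then show ?thesis
    using decompose[of G] rh by simp
qed

lemma spray_be_eta:
  assumes [simp]: "A \<in> V"
  shows "df (be et) (g (rh A) et) - df A (g (rh (be et)) et) - g (rh (br (be et) A)) et
    = - g (cv A et) et"
  by (subst symplectic) (simp_all add: g_sym)

text \<open>The Barthel connection [J A, G] - J[A, G] for J = \<gamma> \<circ> \<rho> and G =
  \<beta> \<eta>.\<close>

definition Gam :: "'v \<Rightarrow> 'v" where
  "Gam A = br (ga (rh A)) (be et) - ga (rh (br A (be et)))"

lemma Gam_closed [simp]: "A \<in> V \<Longrightarrow> Gam A \<in> V"
  by (simp add: Gam_def)

text \<open>The vertical part of [\<gamma> X, \<beta> \<eta>] contains P(\<eta>, X)\<eta>, which is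
  0; the derivative of X along \<beta> \<eta> cancels between the two brackets.\<close>

lemma Gam_be:
  assumes [simp]: "X \<in> Pi"
  shows "Gam (be X) = be X"
  by (simp add: Gam_def br_ga_be rh_br_be_be Phat_eta ga_minus)

lemma Gam_ga:
  assumes [simp]: "X \<in> Pi"
  shows "Gam (ga X) = - ga X"
  by (simp add: Gam_def)

text \<open>For (c) the Barthel connection enters through its values on horizontal fields and
  through this consequence, which gives K \<circ> v = K.\<close>

lemma K_Gam:
  assumes [simp]: "A \<in> V"
  shows "cv (Gam A) et = - cv A et"
proof -
  have "Gam A = Gam (be (rh A) + ga (cv A et))"
    using decompose[of A] by simp
  also have "\<dots> = Gam (be (rh A)) + Gam (ga (cv A et))"
    by (simp add: Gam_def ga_add rh_add br_add)
  finally show ?thesis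
    by (simp add: Gam_be Gam_ga cv_diff_left)
qed

end

section \<open>Smooth maps between Euclidean spaces\<close>

abbreviation fd :: "('a::real_normed_vector \<Rightarrow> 'b::real_normed_vector) \<Rightarrow> 'a \<Rightarrow> 'a \<Rightarrow> 'b" where
  "fd f x \<equiv> frechet_derivative f (at x)"

lemma fd_eqI: "(f has_derivative f') (at x) \<Longrightarrow> fd f x = f'"
  by (rule frechet_derivative_at[symmetric])

lemma fd_works: "f differentiable (at x) \<Longrightarrow> (f has_derivative fd f x) (at x)"
  using frechet_derivative_works by blast

lemma linear_fd: "f differentiable (at x) \<Longrightarrow> linear (fd f x)"
  by (rule linear_frechet_derivative)

lemma fd_cong:
  assumes "open S" "x \<in> S" "\<And>y. y \<in> S \<Longrightarrow> f y = g y"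
  shows "fd f x = fd g x"
proof (cases "f differentiable (at x)")
  case True
  then show ?thesis
    using frechet_derivative_transform_within_open assms by blast
next
  case False
  \<comment> \<open>Where no derivative exists, both sides are the same arbitrary choice because the
    predicates they are chosen from coincide.\<close>
  have *: "(f has_derivative h) (at x) \<longleftrightarrow> (g has_derivative h) (at x)" for h
    using has_derivative_transform_within_open[OF _ assms(1,2)] assms(3) by metis
  show ?thesis
    unfolding frechet_derivative_def * ..
qed

lemma differentiable_cong:
  assumes "open S" "x \<in> S" "\<And>y. y \<in> S \<Longrightarrow> f y = g y" "f differentiable (at x)"
  shows "g differentiable (at x)"
  using assms has_derivative_transform_within_open unfolding differentiable_def by metis

lemma Ck_on_cong:
  "\<lbrakk>open S; \<And>x. x \<in> S \<Longrightarrow> f x = g x; Ck_on k f S\<rbrakk> \<Longrightarrow> Ck_on k g S"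
proof (induction k arbitrary: f g)
  case 0
  then show ?case by (simp cong: continuous_on_cong)
next
  case (Suc k)
  have "\<forall>x\<in>S. g differentiable (at x)"
    using Suc.prems differentiable_cong[of S _ f g] by simp
  moreover have "Ck_on k (\<lambda>x. fd g x v) S" for v
  proof (rule Suc.IH)
    show "Ck_on k (\<lambda>x. fd f x v) S" using Suc.prems by simp
    show "fd f x v = fd g x v" if "x \<in> S" for x
      using Suc.prems fd_cong[of S x f g] that by simp
  qed (use Suc.prems in simp)
  ultimately show ?case by simp
qed

lemma Ck_on_SucD: "Ck_on (Suc k) f S \<Longrightarrow> Ck_on k f S"
proof (induction k arbitrary: f)
  case 0
  then show ?case
    by (auto intro!: continuous_at_imp_continuous_on differentiable_imp_continuous_within)
next
  case (Suc k)
  have "\<forall>x\<in>S. f differentiable (at x)" "\<And>v. Ck_on (Suc k) (\<lambda>x. fd f x v) S"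
    using Suc.prems Ck_on.simps(2)[of "Suc k" f S] by blast+
  then show ?case
    using Suc.IH Ck_on.simps(2)[of k f S] by blast
qed

lemma Ck_on_subset: "\<lbrakk>Ck_on k f S; T \<subseteq> S\<rbrakk> \<Longrightarrow> Ck_on k f T"
  by (induction k arbitrary: f) (auto intro: continuous_on_subset)

lemma Ck_on_const: "Ck_on k (\<lambda>x. c) S"
  by (induction k arbitrary: c) auto

lemma Ck_on_bounded_linear:
  assumes h: "bounded_linear h" and "open S"
  shows "Ck_on k f S \<Longrightarrow> Ck_on k (\<lambda>x. h (f x)) S"
proof (induction k arbitrary: f)
  case 0
  then show ?case using h by (auto intro: bounded_linear.continuous_on)
next
  case (Suc k)
  have d: "((\<lambda>x. h (f x)) has_derivative (\<lambda>v. h (fd f x v))) (at x)" if "x \<in> S" for x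
    using Suc.prems that by (intro bounded_linear.has_derivative[OF h] fd_works) simp
  show ?case
    unfolding Ck_on.simps
  proof (intro conjI ballI allI)
    show "(\<lambda>x. h (f x)) differentiable (at x)" if "x \<in> S" for x
      using d[OF that] by (rule differentiableI)
    show "Ck_on k (\<lambda>x. fd (\<lambda>x. h (f x)) x v) S" for v
      by (rule Ck_on_cong[OF \<open>open S\<close>, of "\<lambda>x. h (fd f x v)"])
        (use d fd_eqI Suc in fastforce)+
  qed
qed

lemma Ck_on_add:
  assumes "open S"
  shows "\<lbrakk>Ck_on k f S; Ck_on k g S\<rbrakk> \<Longrightarrow> Ck_on k (\<lambda>x. f x + g x) S"
proof (induction k arbitrary: f g)
  case 0
  then show ?case by (auto intro: continuous_on_add)
next
  case (Suc k)
  have d: "((\<lambda>x. f x + g x) has_derivative (\<lambda>v. fd f x v + fd g x v)) (at x)" if "x \<in> S" for x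
    using Suc.prems that by (intro has_derivative_add fd_works) simp_all
  show ?case
    unfolding Ck_on.simps
  proof (intro conjI ballI allI)
    show "(\<lambda>x. f x + g x) differentiable (at x)" if "x \<in> S" for x
      using d[OF that] by (rule differentiableI)
    show "Ck_on k (\<lambda>x. fd (\<lambda>x. f x + g x) x v) S" for v
      by (rule Ck_on_cong[OF \<open>open S\<close>, of "\<lambda>x. fd f x v + fd g x v"])
        (use fd_eqI[OF d] Suc in auto)
  qed
qed

lemma Ck_on_sum:
  assumes "open S" "\<And>i. i \<in> I \<Longrightarrow> Ck_on k (f i) S"
  shows "Ck_on k (\<lambda>x. \<Sum>i\<in>I. f i x) S"
  using assms(2)
  by (induction I rule: infinite_finite_induct) (auto intro: Ck_on_const Ck_on_add[OF assms(1)])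

lemma Ck_on_bilinear:
  assumes h: "bounded_bilinear h" and "open S"
  shows "\<lbrakk>Ck_on k f S; Ck_on k g S\<rbrakk> \<Longrightarrow> Ck_on k (\<lambda>x. h (f x) (g x)) S"
proof (induction k arbitrary: f g)
  case 0
  then show ?case using h by (auto intro: bounded_bilinear.continuous_on)
next
  case (Suc k)
  have d: "((\<lambda>x. h (f x) (g x)) has_derivative (\<lambda>v. h (f x) (fd g x v) + h (fd f x v) (g x))) (at x)"
    if "x \<in> S" for x
    using Suc.prems that by (intro bounded_bilinear.FDERIV[OF h] fd_works) simp_all
  show ?case
    unfolding Ck_on.simps
  proof (intro conjI ballI allI)
    show "(\<lambda>x. h (f x) (g x)) differentiable (at x)" if "x \<in> S" for x
      using d[OF that] by (rule differentiableI)
    have "Ck_on k f S" "Ck_on k g S"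
      using Suc.prems Ck_on_SucD by blast+
    then have "Ck_on k (\<lambda>x. h (f x) (fd g x v) + h (fd f x v) (g x)) S" for v
      using Suc by (intro Ck_on_add Suc.IH \<open>open S\<close>) simp_all
    then show "Ck_on k (\<lambda>x. fd (\<lambda>x. h (f x) (g x)) x v) S" for v
      by (rule Ck_on_cong[OF \<open>open S\<close>, rotated]) (use fd_eqI[OF d] in auto)
  qed
qed

text \<open>\<open>Ck_on\<close> controls derivatives in constant directions; this expansion reduces
  directions that depend on the point to constant ones.\<close>

lemma linear_sum_Basis:
  fixes F :: "'a::euclidean_space \<Rightarrow> 'b::real_vector"
  assumes "linear F"
  shows "F v = (\<Sum>b\<in>Basis. (v \<bullet> b) *\<^sub>R F b)"
proof -
  have "F v = F (\<Sum>b\<in>Basis. (v \<bullet> b) *\<^sub>R b)"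
    by (simp add: euclidean_representation)
  then show ?thesis
    by (simp only: linear_sum[OF assms] linear_cmul[OF assms])
qed

text \<open>In the chain rule, with the inner derivative expanded in a basis, \<open>f\<close> is
  replaced by its directional derivatives while \<open>g\<close> stays, so the induction generalises
  over \<open>f\<close> alone.\<close>

lemma Ck_on_compose:
  fixes f :: "'a::euclidean_space \<Rightarrow> 'b::real_normed_vector" and g :: "'c::real_normed_vector \<Rightarrow> 'a"
  assumes "open S" "open T"
  shows "\<lbrakk>Ck_on k f T; Ck_on k g S; g ` S \<subseteq> T\<rbrakk> \<Longrightarrow> Ck_on k (\<lambda>x. f (g x)) S"
proof (induction k arbitrary: f)
  case 0
  then show ?case
    by (auto intro: continuous_on_compose2)
next
  case (Suc k)
  have d: "((\<lambda>x. f (g x)) has_derivative (\<lambda>v. fd f (g x) (fd g x v))) (at x)" if "x \<in> S" for x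
    using Suc.prems that by (intro has_derivative_compose[of g _ x UNIV f] fd_works) auto
  have lin: "linear (fd f (g x))" if "x \<in> S" for x
    using Suc.prems that by (intro linear_fd) auto
  show ?case
    unfolding Ck_on.simps
  proof (intro conjI ballI allI)
    show "(\<lambda>x. f (g x)) differentiable (at x)" if "x \<in> S" for x
      using d[OF that] by (rule differentiableI)
    fix v
    have "Ck_on k g S"
      using Suc.prems Ck_on_SucD by blast
    then have "Ck_on k (\<lambda>x. fd f (g x) b) S" for b
      using Suc.prems by (intro Suc.IH[of "\<lambda>y. fd f y b"]) simp_all
    moreover have "Ck_on k (\<lambda>x. fd g x v \<bullet> b) S" for b
      using Suc.prems by (intro Ck_on_bounded_linear[OF bounded_linear_inner_left \<open>open S\<close>]) simp
    ultimately have "Ck_on k (\<lambda>x. \<Sum>b\<in>Basis. (fd g x v \<bullet> b) *\<^sub>R fd f (g x) b) S"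
      by (intro Ck_on_sum Ck_on_bilinear[OF bounded_bilinear_scaleR] \<open>open S\<close>) simp_all
    then show "Ck_on k (\<lambda>x. fd (\<lambda>x. f (g x)) x v) S"
      by (rule Ck_on_cong[OF \<open>open S\<close>, rotated])
        (use fd_eqI[OF d] linear_sum_Basis[OF lin] in auto)
  qed
qed

lemma Ck_on_local:
  assumes "\<And>x. x \<in> S \<Longrightarrow> \<exists>U. open U \<and> x \<in> U \<and> Ck_on k f U"
  shows "Ck_on k f S"
  using assms
proof (induction k arbitrary: f)
  case 0
  show ?case
    unfolding Ck_on.simps
  proof (intro continuous_at_imp_continuous_on ballI)
    fix x assume "x \<in> S"
    then obtain U where "open U" "x \<in> U" "Ck_on 0 f U" using 0 by blast
    then have "continuous_on U f" by simp
    with \<open>open U\<close> \<open>x \<in> U\<close>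
    show "isCont f x" by (simp add: continuous_on_eq_continuous_at)
  qed
next
  case (Suc k)
  show ?case
    unfolding Ck_on.simps
  proof (intro conjI ballI allI)
    show "f differentiable (at x)" if "x \<in> S" for x
      using Suc.prems[OF that] Ck_on.simps(2) by blast
    show "Ck_on k (\<lambda>x. fd f x v) S" for v
    proof (rule Suc.IH)
      fix x assume "x \<in> S"
      then obtain U where "open U" "x \<in> U" "Ck_on (Suc k) f U" using Suc.prems by blast
      then show "\<exists>U. open U \<and> x \<in> U \<and> Ck_on k (\<lambda>x. fd f x v) U" by auto
    qed
  qed
qed

lemma smooth_on_cong:
  "\<lbrakk>open S; \<And>x. x \<in> S \<Longrightarrow> f x = g x; smooth_on f S\<rbrakk> \<Longrightarrow> smooth_on g S"
  unfolding smooth_on_def using Ck_on_cong by blast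

lemma smooth_on_subset: "\<lbrakk>smooth_on f S; T \<subseteq> S\<rbrakk> \<Longrightarrow> smooth_on f T"
  unfolding smooth_on_def using Ck_on_subset by blast

lemma smooth_on_const [simp]: "smooth_on (\<lambda>x. c) S"
  by (simp add: smooth_on_def Ck_on_const)

lemma smooth_on_differentiable: "\<lbrakk>smooth_on f S; x \<in> S\<rbrakk> \<Longrightarrow> f differentiable (at x)"
  unfolding smooth_on_def using Ck_on.simps(2) by blast

lemma smooth_on_has_derivative: "\<lbrakk>smooth_on f S; x \<in> S\<rbrakk> \<Longrightarrow> (f has_derivative fd f x) (at x)"
  by (intro fd_works smooth_on_differentiable)

lemma smooth_on_linear_fd: "\<lbrakk>smooth_on f S; x \<in> S\<rbrakk> \<Longrightarrow> linear (fd f x)"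
  by (intro linear_fd smooth_on_differentiable)

lemma smooth_on_continuous: "smooth_on f S \<Longrightarrow> continuous_on S f"
  unfolding smooth_on_def using Ck_on.simps(1) by blast

lemma smooth_on_fd: "smooth_on f S \<Longrightarrow> smooth_on (\<lambda>x. fd f x v) S"
  unfolding smooth_on_def using Ck_on.simps(2) by blast

lemma smooth_onI:
  assumes "\<And>x. x \<in> S \<Longrightarrow> f differentiable (at x)" "\<And>v. smooth_on (\<lambda>x. fd f x v) S"
  shows "smooth_on f S"
  unfolding smooth_on_def
proof
  fix k show "Ck_on k f S"
    using assms unfolding smooth_on_def
    by (cases k) (auto intro!: continuous_at_imp_continuous_on differentiable_imp_continuous_within)
qed

lemma smooth_on_bounded_linear:
  "\<lbrakk>smooth_on f S; bounded_linear h; open S\<rbrakk> \<Longrightarrow> smooth_on (\<lambda>x. h (f x)) S"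
  by (simp add: smooth_on_def Ck_on_bounded_linear)

lemma smooth_on_linear:
  "\<lbrakk>smooth_on f S; linear h; open S\<rbrakk> \<Longrightarrow> smooth_on (\<lambda>x. h (f x)) S"
  by (rule smooth_on_bounded_linear) (simp_all add: linear_conv_bounded_linear)

lemma smooth_on_add: "\<lbrakk>smooth_on f S; smooth_on g S; open S\<rbrakk> \<Longrightarrow> smooth_on (\<lambda>x. f x + g x) S"
  by (simp add: smooth_on_def Ck_on_add)

lemma smooth_on_minus: "\<lbrakk>smooth_on f S; open S\<rbrakk> \<Longrightarrow> smooth_on (\<lambda>x. - f x) S"
  by (rule smooth_on_bounded_linear) (auto intro: bounded_linear_minus bounded_linear_ident)

lemma smooth_on_diff: "\<lbrakk>smooth_on f S; smooth_on g S; open S\<rbrakk> \<Longrightarrow> smooth_on (\<lambda>x. f x - g x) S"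
  using smooth_on_add[of f S "\<lambda>x. - g x"] smooth_on_minus[of g S] by simp

lemma smooth_on_sum:
  "\<lbrakk>\<And>i. i \<in> I \<Longrightarrow> smooth_on (f i) S; open S\<rbrakk> \<Longrightarrow> smooth_on (\<lambda>x. \<Sum>i\<in>I. f i x) S"
  by (simp add: smooth_on_def Ck_on_sum)

lemma smooth_on_bilinear:
  "\<lbrakk>bounded_bilinear h; smooth_on f S; smooth_on g S; open S\<rbrakk> \<Longrightarrow> smooth_on (\<lambda>x. h (f x) (g x)) S"
  by (simp add: smooth_on_def Ck_on_bilinear)

lemmas smooth_on_scaleR = smooth_on_bilinear[OF bounded_bilinear_scaleR]
lemmas smooth_on_inner = smooth_on_bilinear[OF bounded_bilinear_inner]

lemma smooth_on_compose:
  "\<lbrakk>smooth_on f T; smooth_on g S; g ` S \<subseteq> T; open S; open T\<rbrakk> \<Longrightarrow> smooth_on (\<lambda>x. f (g x)) S"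
  by (simp add: smooth_on_def Ck_on_compose)

lemma smooth_on_ident [simp]: "smooth_on (\<lambda>x. x) S"
proof (rule smooth_onI)
  show "smooth_on (\<lambda>x. fd (\<lambda>x. x) x v) S" for v :: 'a
    unfolding frechet_derivative_ident by (rule smooth_on_const)
qed simp

lemma smooth_on_id_linear: "linear h \<Longrightarrow> smooth_on h UNIV"
  by (rule smooth_on_linear[OF smooth_on_ident]) auto

lemma smooth_on_fst: "\<lbrakk>smooth_on f S; open S\<rbrakk> \<Longrightarrow> smooth_on (\<lambda>x. fst (f x)) S"
  by (rule smooth_on_bounded_linear[OF _ bounded_linear_fst])

lemma smooth_on_Pair:
  assumes "smooth_on f S" "smooth_on g S" "open S"
  shows "smooth_on (\<lambda>x. (f x, g x)) S"
proof -
  have l: "bounded_linear (\<lambda>x. (x, 0))" "bounded_linear (\<lambda>x. (0, x))"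
    by (intro bounded_linear_Pair bounded_linear_ident bounded_linear_zero)+
  have "smooth_on (\<lambda>x. (f x, 0) + (0, g x)) S"
    by (rule smooth_on_add[OF smooth_on_bounded_linear[OF assms(1) l(1) assms(3)]
          smooth_on_bounded_linear[OF assms(2) l(2) assms(3)] assms(3)])
  then show ?thesis by simp
qed

lemma smooth_on_local:
  "(\<And>x. x \<in> S \<Longrightarrow> \<exists>U. open U \<and> x \<in> U \<and> smooth_on f U) \<Longrightarrow> smooth_on f S"
  unfolding smooth_on_def by (intro allI Ck_on_local) blast

lemma smooth_on_fd_apply:
  assumes "smooth_on f T" "smooth_on p S" "smooth_on w S" "p ` S \<subseteq> T" "open S" "open T"
  shows "smooth_on (\<lambda>x. fd f (p x) (w x)) S"
proof -
  have "smooth_on (\<lambda>x. (w x \<bullet> b) *\<^sub>R fd f (p x) b) S" for b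
    by (rule smooth_on_scaleR[OF smooth_on_bounded_linear[OF assms(3) bounded_linear_inner_left assms(5)]
          smooth_on_compose[OF smooth_on_fd[OF assms(1)] assms(2,4,5,6)] assms(5)])
  then have "smooth_on (\<lambda>x. \<Sum>b\<in>Basis. (w x \<bullet> b) *\<^sub>R fd f (p x) b) S"
    by (rule smooth_on_sum) (rule assms(5))
  moreover have "(\<Sum>b\<in>Basis. (w x \<bullet> b) *\<^sub>R fd f (p x) b) = fd f (p x) (w x)" if "x \<in> S" for x
  proof -
    have "p x \<in> T" using assms(4) that by blast
    then show ?thesis
      by (rule linear_sum_Basis[OF smooth_on_linear_fd[OF assms(1)], symmetric])
  qed
  ultimately show ?thesis
    by (rule smooth_on_cong[OF assms(5), rotated])
qed

lemma smooth_on_compose_has_derivative: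
  assumes "smooth_on f T" "(p has_derivative p') (at x)" "p x \<in> T"
  shows "((\<lambda>x. f (p x)) has_derivative (\<lambda>v. fd f (p x) (p' v))) (at x)"
  using has_derivative_compose[OF assms(2) smooth_on_has_derivative[OF assms(1,3)]] .

text \<open>Transformed components of a field and Lie brackets in a chart have the form Df(p x)(w
  x). The second derivative appears with the direction \<open>w x\<close> frozen, which is the form
  in which its symmetry can be applied.\<close>

lemma has_derivative_fd_apply:
  assumes "smooth_on f T" "(p has_derivative p') (at x)" "(w has_derivative w') (at x)" "p x \<in> T" "open T"
  shows "((\<lambda>x. fd f (p x) (w x)) has_derivative
    (\<lambda>v. fd (\<lambda>y. fd f y (w x)) (p x) (p' v) + fd f (p x) (w' v))) (at x)"
proof -
  have lin: "linear (fd f y)" if "y \<in> T" for y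
    using assms that by (simp add: smooth_on_linear_fd)
  have "\<forall>\<^sub>F y in at x. p y \<in> T"
    using assms(2,4,5) by (metis has_derivative_continuous isCont_def topological_tendstoD)
  \<comment> \<open>The basis expansion of \<open>fd f (p y)\<close> has to hold on a whole
    neighbourhood of \<open>x\<close>.\<close>
  then obtain U where U: "open U" "x \<in> U" "\<And>y. y \<in> U \<Longrightarrow> p y \<in> T"
    using assms(4) unfolding eventually_at_topological by (metis UNIV_I)
  let ?F = "\<lambda>b y. fd f y b"
  have b: "((\<lambda>x. fd f (p x) b) has_derivative (\<lambda>v. fd (?F b) (p x) (p' v))) (at x)" for b
    using assms by (intro smooth_on_compose_has_derivative[of "?F b" T] smooth_on_fd)
  have "((\<lambda>x. \<Sum>b\<in>Basis. (w x \<bullet> b) *\<^sub>R fd f (p x) b) has_derivative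
      (\<lambda>v. \<Sum>b\<in>Basis. (w x \<bullet> b) *\<^sub>R fd (?F b) (p x) (p' v) + (w' v \<bullet> b) *\<^sub>R fd f (p x) b)) (at x)"
    by (intro has_derivative_sum has_derivative_scaleR b has_derivative_inner_left assms)
  moreover have "(\<Sum>b\<in>Basis. (w x \<bullet> b) *\<^sub>R fd (?F b) (p x) u + (w' v \<bullet> b) *\<^sub>R fd f (p x) b)
     = fd (\<lambda>y. fd f y (w x)) (p x) u + fd f (p x) (w' v)" for u v
  proof -
    have "((\<lambda>y. \<Sum>b\<in>Basis. (w x \<bullet> b) *\<^sub>R fd f y b) has_derivative
      (\<lambda>u. \<Sum>b\<in>Basis. (w x \<bullet> b) *\<^sub>R fd (?F b) (p x) u)) (at (p x))"
      using assms(1,4) by (intro has_derivative_sum has_derivative_scaleR_right)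
        (auto intro: smooth_on_has_derivative smooth_on_fd)
    then have "((\<lambda>y. fd f y (w x)) has_derivative
      (\<lambda>u. \<Sum>b\<in>Basis. (w x \<bullet> b) *\<^sub>R fd (?F b) (p x) u)) (at (p x))"
      by (rule has_derivative_transform_within_open[OF _ assms(5,4)])
        (use linear_sum_Basis[OF lin, of _ "w x"] in simp)
    from fd_eqI[OF this] show ?thesis
      using linear_sum_Basis[OF lin[OF assms(4)], of "w' v"] by (simp add: sum.distrib)
  qed
  ultimately have "((\<lambda>x. \<Sum>b\<in>Basis. (w x \<bullet> b) *\<^sub>R fd f (p x) b) has_derivative
     (\<lambda>v. fd (\<lambda>y. fd f y (w x)) (p x) (p' v) + fd f (p x) (w' v))) (at x)"
    by simp
  then show ?thesis
    by (rule has_derivative_transform_within_open[OF _ U(1,2)])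
      (use linear_sum_Basis[OF lin[OF U(3)]] in simp)
qed

section \<open>Symmetry of second derivatives\<close>

lemma smooth_on_line_derivative:
  assumes "smooth_on f S" "x + a *\<^sub>R v \<in> S"
  shows "((\<lambda>a. f (x + a *\<^sub>R v)) has_vector_derivative fd f (x + a *\<^sub>R v) v) (at a)"
proof -
  have "((\<lambda>a. x + a *\<^sub>R v) has_derivative (\<lambda>h. h *\<^sub>R v)) (at a)"
    by (auto intro!: derivative_eq_intros)
  from smooth_on_compose_has_derivative[OF assms(1) this assms(2)]
  show ?thesis
    unfolding has_vector_derivative_def
    by (simp add: linear_cmul[OF smooth_on_linear_fd[OF assms]])
qed

text \<open>The mean value theorem is applied in direction \<open>v\<close> and then in direction
  \<open>w\<close>. The second difference is symmetric in \<open>v\<close> and \<open>w\<close>, so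
  it can be evaluated with either order of differentiation.\<close>

lemma second_difference:
  fixes f :: "'a::euclidean_space \<Rightarrow> real"
  assumes f: "smooth_on f S" and "t > 0"
    and S: "\<And>a b. a \<in> {0..t} \<Longrightarrow> b \<in> {0..t} \<Longrightarrow> x + a *\<^sub>R v + b *\<^sub>R w \<in> S"
  shows "\<exists>a\<in>{0..t}. \<exists>b\<in>{0..t}. f (x + t *\<^sub>R v + t *\<^sub>R w) - f (x + t *\<^sub>R v) - f (x + t *\<^sub>R w) + f x
    = t * (t * fd (\<lambda>y. fd f y v) (x + a *\<^sub>R v + b *\<^sub>R w) w)"
proof -
  let ?\<phi> = "\<lambda>a. f ((x + t *\<^sub>R w) + a *\<^sub>R v) - f (x + a *\<^sub>R v)"
  have "\<exists>a>0. a < t \<and> ?\<phi> t - ?\<phi> 0 =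
      (t - 0) * (fd f ((x + t *\<^sub>R w) + a *\<^sub>R v) v - fd f (x + a *\<^sub>R v) v)"
  proof (rule MVT2[OF \<open>t > 0\<close>])
    fix a assume "0 \<le> a" "a \<le> t"
    then have "x + t *\<^sub>R w + a *\<^sub>R v \<in> S" "x + a *\<^sub>R v \<in> S"
      using S[of a t] S[of a 0] \<open>t > 0\<close> by (simp_all add: algebra_simps)
    then show "(?\<phi> has_real_derivative fd f ((x + t *\<^sub>R w) + a *\<^sub>R v) v - fd f (x + a *\<^sub>R v) v) (at a)"
      unfolding has_real_derivative_iff_has_vector_derivative
      by (intro has_vector_derivative_diff smooth_on_line_derivative[OF f])
  qed
  then obtain a where a: "0 < a" "a < t"
    "?\<phi> t - ?\<phi> 0 = t * (fd f ((x + t *\<^sub>R w) + a *\<^sub>R v) v - fd f (x + a *\<^sub>R v) v)"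
    by auto
  let ?\<psi> = "\<lambda>b. fd f ((x + a *\<^sub>R v) + b *\<^sub>R w) v"
  have "\<exists>b>0. b < t \<and> ?\<psi> t - ?\<psi> 0 = (t - 0) * fd (\<lambda>y. fd f y v) ((x + a *\<^sub>R v) + b *\<^sub>R w) w"
  proof (rule MVT2[OF \<open>t > 0\<close>])
    fix b assume "0 \<le> b" "b \<le> t"
    then have "x + a *\<^sub>R v + b *\<^sub>R w \<in> S"
      using S[of a b] a by simp
    then show "(?\<psi> has_real_derivative fd (\<lambda>y. fd f y v) ((x + a *\<^sub>R v) + b *\<^sub>R w) w) (at b)"
      unfolding has_real_derivative_iff_has_vector_derivative
      by (rule smooth_on_line_derivative[OF smooth_on_fd[OF f]])
  qed
  then obtain b where b: "0 < b" "b < t"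
    "?\<psi> t - ?\<psi> 0 = t * fd (\<lambda>y. fd f y v) ((x + a *\<^sub>R v) + b *\<^sub>R w) w"
    by auto
  have "f (x + t *\<^sub>R v + t *\<^sub>R w) - f (x + t *\<^sub>R v) - f (x + t *\<^sub>R w) + f x = ?\<phi> t - ?\<phi> 0"
    by (simp add: algebra_simps)
  also have "\<dots> = t * (?\<psi> t - ?\<psi> 0)"
    using a(3) by (simp add: algebra_simps)
  finally show ?thesis
    using a b by (intro bexI[of _ a] bexI[of _ b]) auto
qed

lemma fd_symmetric_real:
  fixes f :: "'a::euclidean_space \<Rightarrow> real"
  assumes f: "smooth_on f S" and "open S" "x \<in> S"
  shows "fd (\<lambda>y. fd f y v) x w = fd (\<lambda>y. fd f y w) x v"
proof (rule ccontr)
  let ?F = "\<lambda>y. fd (\<lambda>y. fd f y v) y w" and ?G = "\<lambda>y. fd (\<lambda>y. fd f y w) y v"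
  assume ne: "?F x \<noteq> ?G x"
  \<comment> \<open>Half of the gap: a common value of the two mixed derivatives within
    \<open>e\<close> of both values at \<open>x\<close> is impossible.\<close>
  define e where "e = \<bar>?F x - ?G x\<bar> / 2"
  have "e > 0" using ne by (simp add: e_def)
  have cont: "isCont ?F x" "isCont ?G x"
    using smooth_on_continuous[OF smooth_on_fd[OF smooth_on_fd[OF f]]] \<open>open S\<close> \<open>x \<in> S\<close>
    by (auto simp: continuous_on_eq_continuous_at)
  obtain d1 where d1: "d1 > 0" "\<And>y. dist y x < d1 \<Longrightarrow> dist (?F y) (?F x) < e"
    using cont(1) \<open>e > 0\<close> unfolding continuous_at_eps_delta by meson
  obtain d2 where d2: "d2 > 0" "\<And>y. dist y x < d2 \<Longrightarrow> dist (?G y) (?G x) < e"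
    using cont(2) \<open>e > 0\<close> unfolding continuous_at_eps_delta by meson
  obtain d3 where d3: "d3 > 0" "\<And>y. dist y x < d3 \<Longrightarrow> y \<in> S"
    using \<open>open S\<close> \<open>x \<in> S\<close> unfolding open_dist by meson
  define d where "d = min d1 (min d2 d3)"
  have "d > 0" using d1 d2 d3 by (simp add: d_def)
  \<comment> \<open>The parallelogram spanned by \<open>t v\<close> and \<open>t w\<close> then
    stays within distance d/2 of \<open>x\<close>; the summand 1 keeps the denominator
    positive.\<close>
  define t where "t = d / (2 * (norm v + norm w + 1))"
  have n: "norm v + norm w + 1 > 0" by (smt (verit) norm_ge_zero)
  have tn: "t * (norm v + norm w + 1) = d / 2"
    unfolding t_def using n by (simp only: times_divide_eq_left) (simp add: divide_simps)
  have "t > 0" using \<open>d > 0\<close> n by (simp add: t_def)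
  have near: "dist (x + a *\<^sub>R v + b *\<^sub>R w) x < d" if "a \<in> {0..t}" "b \<in> {0..t}" for a b
  proof -
    have "dist (x + a *\<^sub>R v + b *\<^sub>R w) x = norm (a *\<^sub>R v + b *\<^sub>R w)"
      by (simp add: dist_norm algebra_simps)
    also have "\<dots> \<le> norm (a *\<^sub>R v) + norm (b *\<^sub>R w)"
      by (rule norm_triangle_ineq)
    also have "\<dots> = a * norm v + b * norm w"
      using that by simp
    also have "\<dots> \<le> t * norm v + t * norm w"
      using that by (intro add_mono mult_right_mono) auto
    also have "\<dots> \<le> t * (norm v + norm w + 1)"
      using \<open>t > 0\<close> by (simp add: algebra_simps)
    also have "\<dots> = d / 2"
      by (rule tn)
    finally show ?thesis using \<open>d > 0\<close> by simp
  qed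
  have "\<exists>a\<in>{0..t}. \<exists>b\<in>{0..t}. f (x + t *\<^sub>R v + t *\<^sub>R w) - f (x + t *\<^sub>R v) - f (x + t *\<^sub>R w) + f x
    = t * (t * ?F (x + a *\<^sub>R v + b *\<^sub>R w))"
    using near d3 by (intro second_difference[OF f \<open>t > 0\<close>]) (simp add: d_def)
  then obtain p where p: "dist p x < d"
    "f (x + t *\<^sub>R v + t *\<^sub>R w) - f (x + t *\<^sub>R v) - f (x + t *\<^sub>R w) + f x = t * (t * ?F p)"
    using near by blast
  have "\<exists>a\<in>{0..t}. \<exists>b\<in>{0..t}. f (x + t *\<^sub>R w + t *\<^sub>R v) - f (x + t *\<^sub>R w) - f (x + t *\<^sub>R v) + f x
    = t * (t * ?G (x + a *\<^sub>R w + b *\<^sub>R v))"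
  proof (rule second_difference[OF f \<open>t > 0\<close>])
    fix a b assume "a \<in> {0..t}" "b \<in> {0..t}"
    then show "x + a *\<^sub>R w + b *\<^sub>R v \<in> S"
      using near[of b a] d3 by (simp add: d_def algebra_simps)
  qed
  then obtain a b where ab: "a \<in> {0..t}" "b \<in> {0..t}"
    "f (x + t *\<^sub>R w + t *\<^sub>R v) - f (x + t *\<^sub>R w) - f (x + t *\<^sub>R v) + f x = t * (t * ?G (x + a *\<^sub>R w + b *\<^sub>R v))"
    by blast
  define q where "q = x + a *\<^sub>R w + b *\<^sub>R v"
  have "q = x + b *\<^sub>R v + a *\<^sub>R w" by (simp add: q_def)
  then have q: "dist q x < d" using near[OF ab(2,1)] by simp
  have vw: "x + t *\<^sub>R w + t *\<^sub>R v = x + t *\<^sub>R v + t *\<^sub>R w"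
    by simp
  have "t * (t * ?F p) = t * (t * ?G q)"
    using p(2) ab(3) unfolding q_def[symmetric] vw by linarith
  then have "?F p = ?G q" using \<open>t > 0\<close> by simp
  moreover have "dist (?F p) (?F x) < e" "dist (?G q) (?G x) < e"
    using p(1) q d1(2) d2(2) by (simp_all add: d_def)
  ultimately show False
    using dist_triangle[of "?F x" "?G x" "?F p"] dist_commute[of "?F x" "?F p"]
    by (simp add: e_def flip: dist_real_def)
qed

lemma fd_symmetric:
  fixes f :: "'a::euclidean_space \<Rightarrow> 'b::euclidean_space"
  assumes f: "smooth_on f S" and "open S" "x \<in> S"
  shows "fd (\<lambda>y. fd f y v) x w = fd (\<lambda>y. fd f y w) x v"
proof (rule euclidean_eqI)
  fix b :: 'b assume "b \<in> Basis"
  have fb: "smooth_on (\<lambda>y. f y \<bullet> b) S"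
    using assms by (intro smooth_on_inner) auto
  have 1: "fd (\<lambda>y. f y \<bullet> b) y v = fd f y v \<bullet> b" if "y \<in> S" for y v
    using fd_eqI[OF has_derivative_inner_left[OF smooth_on_has_derivative[OF f that]]] by simp
  have "fd (\<lambda>y. fd (\<lambda>y. f y \<bullet> b) y v) x w = fd (\<lambda>y. fd f y v) x w \<bullet> b" for v w
  proof -
    have "fd (\<lambda>y. fd (\<lambda>y. f y \<bullet> b) y v) x = fd (\<lambda>y. fd f y v \<bullet> b) x"
      using assms 1 by (intro fd_cong[of S]) auto
    then show ?thesis
      using fd_eqI[OF has_derivative_inner_left[OF smooth_on_has_derivative[OF smooth_on_fd[OF f] \<open>x \<in> S\<close>]]]
      by simp
  qed
  then show "fd (\<lambda>y. fd f y v) x w \<bullet> b = fd (\<lambda>y. fd f y w) x v \<bullet> b"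
    using fd_symmetric_real[OF fb assms(2,3), of v w] by simp
qed

section \<open>Smooth dependence of solutions of linear systems\<close>

lemma tendsto_scaleR_null_bounded:
  fixes a :: "'a \<Rightarrow> 'b::real_normed_vector"
  assumes "(a \<longlongrightarrow> 0) F" "eventually (\<lambda>x. \<bar>u x\<bar> \<le> B) F"
  shows "((\<lambda>x. u x *\<^sub>R a x) \<longlongrightarrow> 0) F"
proof (rule Lim_null_comparison)
  show "eventually (\<lambda>x. norm (u x *\<^sub>R a x) \<le> B * norm (a x)) F"
    using assms(2) by eventually_elim (simp add: mult_right_mono)
  show "((\<lambda>x. B * norm (a x)) \<longlongrightarrow> 0) F"
    using assms(1) by (intro tendsto_mult_right_zero tendsto_norm_zero)
qed

text \<open>Where \<open>a\<close> vanishes, the increment of \<open>u\<close> is multiplied by a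
  term that is already of first order, so continuity of \<open>u\<close> suffices. In
  \<open>linear_solve_differentiable\<close> the factor \<open>u\<close> is a component of the
  solution, of which no more is known at that stage.\<close>

lemma has_derivative_scaleR_vanishing:
  fixes a :: "'a::real_normed_vector \<Rightarrow> 'b::real_normed_vector"
  assumes u: "isCont u x" and a: "(a has_derivative a') (at x)" and "a x = 0"
  shows "((\<lambda>y. u y *\<^sub>R a y) has_derivative (\<lambda>v. u x *\<^sub>R a' v)) (at x)"
  unfolding has_derivative_iff_norm
proof
  show "bounded_linear (\<lambda>v. u x *\<^sub>R a' v)"
    by (rule bounded_linear_compose[OF bounded_linear_scaleR_right has_derivative_bounded_linear[OF a]])
  obtain K where K: "\<And>v. norm (a' v) \<le> norm v * K" "K > 0"
    using bounded_linear.pos_bounded[OF has_derivative_bounded_linear[OF a]] by metis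
  have ux: "(u \<longlongrightarrow> u x) (at x)" using u by (simp add: isCont_def)
  let ?r = "\<lambda>y. norm (a y - a x - a' (y - x)) / norm (y - x)"
  have r: "(?r \<longlongrightarrow> 0) (at x)" using a by (simp add: has_derivative_iff_norm)
  show "((\<lambda>y. norm (u y *\<^sub>R a y - u x *\<^sub>R a x - u x *\<^sub>R a' (y - x)) / norm (y - x)) \<longlongrightarrow> 0) (at x)"
  proof (rule Lim_null_comparison)
    show "\<forall>\<^sub>F y in at x. norm (norm (u y *\<^sub>R a y - u x *\<^sub>R a x - u x *\<^sub>R a' (y - x)) / norm (y - x))
       \<le> \<bar>u y\<bar> * ?r y + \<bar>u y - u x\<bar> * K"
    proof (rule eventually_at_filter[THEN iffD2, OF always_eventually], intro allI impI)
      fix y assume "y \<noteq> x"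
      then have n: "norm (y - x) > 0" by simp
      have "u y *\<^sub>R a y - u x *\<^sub>R a x - u x *\<^sub>R a' (y - x)
          = u y *\<^sub>R (a y - a x - a' (y - x)) + (u y - u x) *\<^sub>R a' (y - x)"
        using \<open>a x = 0\<close> by (simp add: algebra_simps)
      then have "norm (u y *\<^sub>R a y - u x *\<^sub>R a x - u x *\<^sub>R a' (y - x))
          \<le> \<bar>u y\<bar> * norm (a y - a x - a' (y - x)) + \<bar>u y - u x\<bar> * norm (a' (y - x))"
        by (simp only: norm_scaleR[symmetric] norm_triangle_ineq)
      also have "\<dots> \<le> \<bar>u y\<bar> * norm (a y - a x - a' (y - x)) + \<bar>u y - u x\<bar> * (norm (y - x) * K)"
        using K by (intro add_left_mono mult_left_mono) auto
      finally have "norm (u y *\<^sub>R a y - u x *\<^sub>R a x - u x *\<^sub>R a' (y - x)) / norm (y - x)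
          \<le> (\<bar>u y\<bar> * norm (a y - a x - a' (y - x)) + \<bar>u y - u x\<bar> * (norm (y - x) * K)) / norm (y - x)"
        by (rule divide_right_mono) simp
      also have "\<dots> = \<bar>u y\<bar> * ?r y + \<bar>u y - u x\<bar> * K"
        using n by (simp only: add_divide_distrib) (simp add: field_simps)
      finally show "norm (norm (u y *\<^sub>R a y - u x *\<^sub>R a x - u x *\<^sub>R a' (y - x)) / norm (y - x))
          \<le> \<bar>u y\<bar> * ?r y + \<bar>u y - u x\<bar> * K"
        by simp
    qed
    have "((\<lambda>y. \<bar>u y\<bar> * ?r y + \<bar>u y - u x\<bar> * K) \<longlongrightarrow> \<bar>u x\<bar> * 0 + \<bar>u x - u x\<bar> * K) (at x)"
      by (rule tendsto_add[OF tendsto_mult[OF tendsto_rabs[OF ux] r]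
          tendsto_mult[OF tendsto_rabs[OF tendsto_diff[OF ux tendsto_const[of "u x"]]] tendsto_const[of K]]])
    then show "((\<lambda>y. \<bar>u y\<bar> * ?r y + \<bar>u y - u x\<bar> * K) \<longlongrightarrow> 0) (at x)"
      by simp
  qed
qed


text \<open>With a left inverse \<open>N\<close> of \<open>M x\<close> the equation takes the form z
  = N w - \<Sum> z_b a_b with coefficients a_b tending to 0 at \<open>x\<close>. Absorbing the sum
  bounds \<open>z\<close> near \<open>x\<close>, and boundedness then makes the sum tend to
  0.\<close>

lemma linear_solve_isCont:
  fixes M :: "'a::euclidean_space \<Rightarrow> 'b::euclidean_space \<Rightarrow> 'b"
  assumes "open S" "x \<in> S"
    and lin: "\<And>y. y \<in> S \<Longrightarrow> linear (M y)" and inj: "inj (M x)"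
    and M: "\<And>b. isCont (\<lambda>y. M y b) x" and w: "isCont w x"
    and sol: "\<And>y. y \<in> S \<Longrightarrow> M y (z y) = w y"
  shows "isCont z x"
proof -
  obtain N where N: "linear N" "\<And>v. N (M x v) = v"
    using linear_injective_left_inverse[OF lin[OF \<open>x \<in> S\<close>] inj] by (metis comp_apply id_apply)
  have contN: "isCont (\<lambda>y. N (u y)) x" if "isCont u x" for u
    using that N(1) by (intro isCont_o2[of x u N]) (auto intro: linear_continuous_at simp: linear_conv_bounded_linear)
  define a where "a b y = N (M y b) - b" for b y
  have a0: "a b x = 0" for b by (simp add: a_def N)
  have z: "z y = N (w y) - (\<Sum>b\<in>Basis. (z y \<bullet> b) *\<^sub>R a b y)" if "y \<in> S" for y
  proof -
    have "N (w y) = N (\<Sum>b\<in>Basis. (z y \<bullet> b) *\<^sub>R M y b)"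
      using sol[OF that] linear_sum_Basis[OF lin[OF that], of "z y"] by simp
    also have "\<dots> = (\<Sum>b\<in>Basis. (z y \<bullet> b) *\<^sub>R N (M y b))"
      by (simp add: linear_sum[OF N(1)] linear_cmul[OF N(1)])
    also have "\<dots> = (\<Sum>b\<in>Basis. (z y \<bullet> b) *\<^sub>R a b y) + (\<Sum>b\<in>Basis. (z y \<bullet> b) *\<^sub>R b)"
      by (simp add: a_def sum.distrib[symmetric] algebra_simps)
    finally show ?thesis by (simp add: euclidean_representation)
  qed
  have atS: "\<forall>\<^sub>F y in at x. y \<in> S"
    using \<open>open S\<close> \<open>x \<in> S\<close> by (simp add: eventually_at_in_open')
  have "isCont (a b) x" for b
    unfolding a_def by (intro continuous_diff contN M continuous_const)
  then have a_lim: "(a b \<longlongrightarrow> 0) (at x)" for b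
    by (metis a0 isCont_def)
  have Nw: "((\<lambda>y. N (w y)) \<longlongrightarrow> N (w x)) (at x)"
    using contN[OF w] by (simp add: isCont_def)
  have "((\<lambda>y. \<Sum>b\<in>Basis. norm (a b y)) \<longlongrightarrow> (\<Sum>b\<in>(Basis :: 'b set). 0)) (at x)"
    by (intro tendsto_sum tendsto_norm_zero a_lim)
  then have "\<forall>\<^sub>F y in at x. (\<Sum>b\<in>Basis. norm (a b y)) < 1 / 2"
    by (rule order_tendstoD(2)) simp
  moreover have "\<forall>\<^sub>F y in at x. norm (N (w y)) < norm (N (w x)) + 1"
    using tendsto_norm[OF Nw] by (rule order_tendstoD) simp
  ultimately have bd: "\<forall>\<^sub>F y in at x. norm (z y) \<le> 2 * (norm (N (w x)) + 1)"
    using atS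
  proof eventually_elim
    fix y assume y: "(\<Sum>b\<in>Basis. norm (a b y)) < 1 / 2" "norm (N (w y)) < norm (N (w x)) + 1" "y \<in> S"
    \<comment> \<open>The coefficients sum to less than 1/2, so the correction is at most half of
      \<open>norm (z y)\<close>; hence the factor 2 in the bound.\<close>
    have "norm (\<Sum>b\<in>Basis. (z y \<bullet> b) *\<^sub>R a b y) \<le> (\<Sum>b\<in>Basis. norm (z y) * norm (a b y))"
      by (rule sum_norm_le) (simp add: Basis_le_norm mult_right_mono)
    also have "\<dots> = norm (z y) * (\<Sum>b\<in>Basis. norm (a b y))"
      by (simp add: sum_distrib_left)
    also have "\<dots> \<le> norm (z y) * (1 / 2)"
      using y(1) by (intro mult_left_mono) auto
    finally have "norm (z y) \<le> norm (N (w y)) + norm (z y) / 2"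
      using z[OF y(3)] norm_triangle_ineq4[of "N (w y)" "\<Sum>b\<in>Basis. (z y \<bullet> b) *\<^sub>R a b y"] by simp
    then show "norm (z y) \<le> 2 * (norm (N (w x)) + 1)"
      using y(2) by simp
  qed
  have "((\<lambda>y. N (w y) - (\<Sum>b\<in>Basis. (z y \<bullet> b) *\<^sub>R a b y)) \<longlongrightarrow> N (w x) - (\<Sum>b\<in>(Basis::'b set). 0)) (at x)"
  proof (intro tendsto_diff tendsto_sum Nw tendsto_scaleR_null_bounded a_lim)
    fix b :: 'b assume "b \<in> Basis"
    then show "\<forall>\<^sub>F y in at x. \<bar>z y \<bullet> b\<bar> \<le> 2 * (norm (N (w x)) + 1)"
      by (intro eventually_mono[OF bd]) (use Basis_le_norm[of b] order_trans in blast)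
  qed
  moreover have "N (w x) = z x"
    using z[OF \<open>x \<in> S\<close>] a0 by simp
  ultimately have lim: "((\<lambda>y. N (w y) - (\<Sum>b\<in>Basis. (z y \<bullet> b) *\<^sub>R a b y)) \<longlongrightarrow> z x) (at x)"
    by simp
  have "\<forall>\<^sub>F y in at x. N (w y) - (\<Sum>b\<in>Basis. (z y \<bullet> b) *\<^sub>R a b y) = z y"
    using atS by eventually_elim (use z in simp)
  from Lim_transform_eventually[OF lim this] show ?thesis
    by (simp add: isCont_def)
qed

text \<open>The solution is rewritten so that its components occur on the right only as factors of
  \<open>M y b - M x b\<close>, which vanishes at \<open>x\<close>; their continuity is then
  enough.\<close>

lemma linear_solve_differentiable:
  fixes M :: "'a::euclidean_space \<Rightarrow> 'b::euclidean_space \<Rightarrow> 'b"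
  assumes "open S" "x \<in> S"
    and lin: "\<And>y. y \<in> S \<Longrightarrow> linear (M y)" and inj: "inj (M x)"
    and M: "\<And>b. (\<lambda>y. M y b) differentiable (at x)" and w: "w differentiable (at x)"
    and sol: "\<And>y. y \<in> S \<Longrightarrow> M y (z y) = w y"
  shows "z differentiable (at x)"
proof -
  have lx: "linear (M x)" using lin \<open>x \<in> S\<close> by blast
  obtain N where N: "linear N" "\<And>v. N (M x v) = v"
    using linear_injective_left_inverse[OF lx inj] by (metis comp_apply id_apply)
  have z: "N (w y - (\<Sum>b\<in>Basis. (z y \<bullet> b) *\<^sub>R (M y b - M x b))) = z y" if "y \<in> S" for y
  proof -
    have "w y - (\<Sum>b\<in>Basis. (z y \<bullet> b) *\<^sub>R (M y b - M x b)) = M x (z y)"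
      by (simp only: sol[OF that, symmetric] linear_sum_Basis[OF lin[OF that], of "z y"]
          linear_sum_Basis[OF lx, of "z y"] scaleR_right_diff_distrib sum_subtractf) simp
    then show ?thesis by (simp add: N)
  qed
  have "isCont z x"
    by (rule linear_solve_isCont[where M = M and w = w and z = z, OF assms(1-4)
          differentiable_imp_continuous_within[OF M] differentiable_imp_continuous_within[OF w] sol])
  then have zc: "isCont (\<lambda>y. z y \<bullet> b) x" for b
    by (rule bounded_linear.isCont[OF bounded_linear_inner_left])
  have d: "((\<lambda>y. M y b - M x b) has_derivative fd (\<lambda>y. M y b) x) (at x)" for b
    using has_derivative_diff[OF fd_works[OF M] has_derivative_const, of b "M x b"] by simp
  have "((\<lambda>y. (z y \<bullet> b) *\<^sub>R (M y b - M x b)) has_derivative (\<lambda>v. (z x \<bullet> b) *\<^sub>R fd (\<lambda>y. M y b) x v)) (at x)" for b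
    by (rule has_derivative_scaleR_vanishing[OF zc d]) simp
  from has_derivative_diff[OF fd_works[OF w] has_derivative_sum[of Basis, OF this]]
  have "((\<lambda>y. N (w y - (\<Sum>b\<in>Basis. (z y \<bullet> b) *\<^sub>R (M y b - M x b)))) has_derivative
      (\<lambda>v. N (fd w x v - (\<Sum>b\<in>Basis. (z x \<bullet> b) *\<^sub>R fd (\<lambda>y. M y b) x v)))) (at x)"
    using N(1) by (rule bounded_linear.has_derivative[OF linear_conv_bounded_linear[THEN iffD1], rotated])
  from has_derivative_transform_within_open[OF this \<open>open S\<close> \<open>x \<in> S\<close> z] show ?thesis
    by (rule differentiableI)
qed

text \<open>The derivatives of the solution of a linear system solve a linear system with the same
  coefficients, so smoothness follows by induction.\<close>
lemma smooth_on_linear_solve: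
  fixes M :: "'a::euclidean_space \<Rightarrow> 'b::euclidean_space \<Rightarrow> 'b"
  assumes "open S"
    and lin: "\<And>x. x \<in> S \<Longrightarrow> linear (M x)" and inj: "\<And>x. x \<in> S \<Longrightarrow> inj (M x)"
    and M: "\<And>b. smooth_on (\<lambda>x. M x b) S" and w: "smooth_on w S"
    and sol: "\<And>x. x \<in> S \<Longrightarrow> M x (z x) = w x"
  shows "smooth_on z S"
proof -
  have MC: "Ck_on k (\<lambda>x. M x b) S" for k b
    using M by (simp add: smooth_on_def)
  have "Ck_on k z S" if "Ck_on k w S" "\<And>x. x \<in> S \<Longrightarrow> M x (z x) = w x" for k w z
    using that
  proof (induction k arbitrary: w z)
    case (0 w z)
    have "isCont z x" if "x \<in> S" for x
    proof (rule linear_solve_isCont[where M = M and w = w and z = z, OF \<open>open S\<close> that lin inj[OF that] _ _ 0(2)])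
      show "isCont (\<lambda>y. M y b) x" for b
        using MC[of 0 b] that \<open>open S\<close> by (simp add: continuous_on_eq_continuous_at)
      show "isCont w x"
        using 0(1) that \<open>open S\<close> by (simp add: continuous_on_eq_continuous_at)
    qed
    then show ?case by (simp add: continuous_at_imp_continuous_on)
  next
    case (Suc k w z)
    have wd: "w differentiable (at x)" if "x \<in> S" for x
      using Suc.prems(1) that by simp
    have Md: "(\<lambda>y. M y b) differentiable (at x)" if "x \<in> S" for x b
      using smooth_on_differentiable[OF M that] .
    have zd: "z differentiable (at x)" if "x \<in> S" for x
      by (rule linear_solve_differentiable[where M = M and w = w and z = z, OF \<open>open S\<close> that lin inj[OF that] Md[OF that] wd[OF that] Suc.prems(2)])
    \<comment> \<open>The right-hand side of the differentiated system contains \<open>z\<close>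
      itself, so its order \<open>k\<close> has to be known first.\<close>
    have zC: "Ck_on k z S"
      using Suc.IH[OF Ck_on_SucD[OF Suc.prems(1)] Suc.prems(2)] .
    have "Ck_on k (\<lambda>x. fd z x v) S" for v
    proof (rule Suc.IH)
      let ?w = "\<lambda>x. fd w x v - (\<Sum>b\<in>Basis. (z x \<bullet> b) *\<^sub>R fd (\<lambda>y. M y b) x v)"
      have "Ck_on k (\<lambda>x. fd w x v) S" using Suc.prems(1) by simp
      moreover have "Ck_on k (\<lambda>x. (z x \<bullet> b) *\<^sub>R fd (\<lambda>y. M y b) x v) S" for b
        by (rule Ck_on_bilinear[OF bounded_bilinear_scaleR \<open>open S\<close>
              Ck_on_bounded_linear[OF bounded_linear_inner_left \<open>open S\<close> zC]])
          (use MC[of "Suc k" b] in simp)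
      then have "Ck_on k (\<lambda>x. \<Sum>b\<in>Basis. (z x \<bullet> b) *\<^sub>R fd (\<lambda>y. M y b) x v) S"
        by (intro Ck_on_sum \<open>open S\<close>)
      then have "Ck_on k (\<lambda>x. - (\<Sum>b\<in>Basis. (z x \<bullet> b) *\<^sub>R fd (\<lambda>y. M y b) x v)) S"
        using Ck_on_bounded_linear[OF bounded_linear_minus[OF bounded_linear_ident] \<open>open S\<close>] by blast
      ultimately have "Ck_on k (\<lambda>x. fd w x v + - (\<Sum>b\<in>Basis. (z x \<bullet> b) *\<^sub>R fd (\<lambda>y. M y b) x v)) S"
        by (intro Ck_on_add \<open>open S\<close>)
      then show "Ck_on k ?w S" by simp
      fix x assume "x \<in> S"
      have "((\<lambda>y. \<Sum>b\<in>Basis. (z y \<bullet> b) *\<^sub>R M y b) has_derivative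
          (\<lambda>v. \<Sum>b\<in>Basis. (z x \<bullet> b) *\<^sub>R fd (\<lambda>y. M y b) x v + (fd z x v \<bullet> b) *\<^sub>R M x b)) (at x)"
        using \<open>x \<in> S\<close>
        by (intro has_derivative_sum has_derivative_scaleR has_derivative_inner_left fd_works zd Md)
      then have "(w has_derivative
          (\<lambda>v. \<Sum>b\<in>Basis. (z x \<bullet> b) *\<^sub>R fd (\<lambda>y. M y b) x v + (fd z x v \<bullet> b) *\<^sub>R M x b)) (at x)"
        by (rule has_derivative_transform_within_open[OF _ \<open>open S\<close> \<open>x \<in> S\<close>])
          (use Suc.prems(2) linear_sum_Basis[OF lin] in metis)
      from fd_eqI[OF this] show "M x (fd z x v) = ?w x"
        using linear_sum_Basis[OF lin[OF \<open>x \<in> S\<close>], of "fd z x v"] by (simp add: sum.distrib)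
    qed
    with zd show ?case by simp
  qed
  then show ?thesis
    using w sol unfolding smooth_on_def by blast
qed

section \<open>Bump functions\<close>

definition flat :: "nat \<Rightarrow> real \<Rightarrow> real" where
  "flat n t = (if t \<le> 0 then 0 else exp (- inverse t) * inverse t ^ n)"

lemma power_over_fact_le_exp:
  fixes s :: real
  assumes "s \<ge> 0"
  shows "s ^ n / fact n \<le> exp s"
proof -
  have "(\<Sum>i\<in>{n}. s ^ i /\<^sub>R fact i) \<le> (\<Sum>i. s ^ i /\<^sub>R fact i)"
    using exp_converges[of s] assms by (intro sum_le_suminf) (auto simp: sums_iff)
  then show ?thesis
    using exp_converges[of s] by (simp add: sums_iff divide_inverse mult.commute)
qed

text \<open>With s = 1/t, the term of degree n + 2 of the exponential series bounds exp(-s) s^(n +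
  2). The two extra powers of s leave the factor t^2, which makes the difference quotient at 0 tend
  to 0.\<close>

lemma flat_bound: "\<bar>flat n t\<bar> \<le> fact (n + 2) * t\<^sup>2"
proof (cases "t > 0")
  case True
  define s where "s = inverse t"
  have "s > 0" using True by (simp add: s_def)
  have "s ^ (n + 2) / fact (n + 2) \<le> exp s"
    by (rule power_over_fact_le_exp) (use \<open>s > 0\<close> in simp)
  then have "s ^ (n + 2) \<le> exp s * fact (n + 2)"
    by (simp only: pos_divide_le_eq[OF fact_gt_zero])
  then have "exp (- s) * s ^ (n + 2) \<le> exp (- s) * (exp s * fact (n + 2))"
    by (intro mult_left_mono) simp_all
  then have "exp (- s) * s ^ (n + 2) \<le> fact (n + 2)"
    by (simp only: mult.assoc[symmetric] exp_minus_inverse mult.commute[of "exp (- s)" "exp s"] mult_1)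
  moreover have "flat n t = exp (- s) * s ^ (n + 2) * t\<^sup>2"
    using True by (simp add: flat_def s_def power2_eq_square field_simps)
  ultimately have "flat n t \<le> fact (n + 2) * t\<^sup>2"
    by (simp add: mult_right_mono)
  moreover have "flat n t \<ge> 0" using True by (simp add: flat_def)
  ultimately show ?thesis by simp
qed (simp add: flat_def)

text \<open>This is why powers of 1/t are part of \<open>flat\<close>: the span of the family is
  closed under differentiation, so smoothness follows by induction for all \<open>n\<close> at
  once.\<close>

lemma flat_has_derivative: "(flat n has_real_derivative flat (n + 2) t - real n * flat (n + 1) t) (at t)"
proof -
  consider "t < 0" | "t = 0" | "t > 0" by linarith
  then show ?thesis
  proof cases
    case 1
    have "((\<lambda>t. 0) has_real_derivative flat (n + 2) t - real n * flat (n + 1) t) (at t)"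
      using 1 by (simp add: flat_def)
    then show ?thesis
      by (rule has_field_derivative_transform_within_open[of _ _ _ "{..<0}"]) (use 1 in \<open>auto simp: flat_def\<close>)
  next
    case 2
    have "((\<lambda>h. flat n h / h) \<longlongrightarrow> 0) (at 0)"
    proof (rule Lim_null_comparison)
      show "\<forall>\<^sub>F h in at 0. norm (flat n h / h) \<le> fact (n + 2) * \<bar>h\<bar>"
        using flat_bound[of n]
        by (auto simp: eventually_at_filter abs_mult divide_simps power2_eq_square abs_mult_self_eq mult.assoc)
      show "((\<lambda>h. fact (n + 2) * \<bar>h\<bar>) \<longlongrightarrow> (0::real)) (at 0)"
        by (intro tendsto_mult_right_zero tendsto_rabs_zero tendsto_ident_at)
    qed
    then show ?thesis
      using 2 by (simp add: DERIV_def) (simp add: flat_def)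
  next
    case 3
    have "((\<lambda>t. exp (- inverse t) * inverse t ^ n) has_real_derivative flat (n + 2) t - real n * flat (n + 1) t) (at t)"
      using 3 by (auto intro!: derivative_eq_intros simp: flat_def power2_eq_square field_simps)
        (cases n; simp add: field_simps)
    then show ?thesis
      by (rule has_field_derivative_transform_within_open[of _ _ _ "{0<..}"]) (use 3 in \<open>auto simp: flat_def\<close>)
  qed
qed

lemma smooth_on_flat: "smooth_on (flat n) UNIV"
proof -
  have d: "(flat n has_derivative (\<lambda>v. v * (flat (n + 2) t - real n * flat (n + 1) t))) (at t)" for n t
    using flat_has_derivative[of n t] by (rule has_derivative_eq_rhs[OF has_field_derivative_imp_has_derivative]) auto
  have "Ck_on k (flat n) UNIV" for k n
  proof (induction k arbitrary: n)
    case 0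
    show ?case
      using has_derivative_continuous[OF d] by (simp add: continuous_at_imp_continuous_on)
  next
    case (Suc k)
    have "Ck_on k (\<lambda>t. v * flat (n + 2) t + (- v * real n) * flat (n + 1) t) UNIV" for v
      by (intro Ck_on_add Ck_on_bounded_linear[OF bounded_linear_mult_right] open_UNIV Suc.IH)
    then show ?case
      using fd_eqI[OF d] differentiableI[OF d] by (simp add: algebra_simps)
  qed
  then show ?thesis by (simp add: smooth_on_def)
qed

text \<open>The bump is nonzero on the whole ball rather than 1 on a smaller one, since it will be
  divided out again in \<open>smooth_on_Kloc\<close>.\<close>

lemma bump_exists:
  fixes x :: "'a::euclidean_space"
  assumes "open U" "x \<in> U"
  obtains \<phi> :: "'a \<Rightarrow> real" and r where "r > 0" "smooth_on \<phi> UNIV" "cball x r \<subseteq> U"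
    "\<And>y. y \<notin> ball x r \<Longrightarrow> \<phi> y = 0" "\<And>y. y \<in> ball x r \<Longrightarrow> \<phi> y \<noteq> 0"
proof -
  obtain r where r: "r > 0" "cball x r \<subseteq> U"
    using assms open_contains_cball by blast
  let ?\<phi> = "\<lambda>y. flat 0 (r\<^sup>2 - (y - x) \<bullet> (y - x))"
  have l: "smooth_on (\<lambda>y. y - x) UNIV"
    by (intro smooth_on_diff) auto
  have "smooth_on (\<lambda>y. r\<^sup>2 - (y - x) \<bullet> (y - x)) UNIV"
    by (rule smooth_on_diff[OF smooth_on_const smooth_on_inner[OF l l open_UNIV] open_UNIV])
  from smooth_on_compose[OF smooth_on_flat this] have "smooth_on ?\<phi> UNIV" by simp
  moreover have "y \<in> ball x r \<longleftrightarrow> (y - x) \<bullet> (y - x) < r\<^sup>2" for y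
    using r(1) norm_lt_square[of "y - x" r] by (simp add: dist_commute dist_norm norm_minus_commute)
  ultimately show ?thesis
    using r by (intro that[of r ?\<phi>]) (auto simp: flat_def)
qed

section \<open>Vector fields on an atlas\<close>

text \<open>Calculus in charts uses open chart images and overlaps, but no topology on the manifold
  itself. Thus the slit tangent bundle, of which only charts are given, is an instance.\<close>

locale atlas =
  fixes \<A> :: "('m, 'e::euclidean_space) chart set"
  assumes open_chart_image: "c \<in> \<A> \<Longrightarrow> open (chart_image c)"
    and inj_on_chart: "c \<in> \<A> \<Longrightarrow> inj_on (snd c) (fst c)"
    and open_overlap: "\<lbrakk>c \<in> \<A>; c' \<in> \<A>\<rbrakk> \<Longrightarrow> open (snd c ` (fst c \<inter> fst c'))"
    and smooth_transition: "\<lbrakk>c \<in> \<A>; c' \<in> \<A>\<rbrakk> \<Longrightarrow>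
      smooth_on (snd c' \<circ> chart_inv c) (snd c ` (fst c \<inter> fst c'))"
begin

lemma chart_inv_chart [simp]: "\<lbrakk>c \<in> \<A>; p \<in> fst c\<rbrakk> \<Longrightarrow> chart_inv c (snd c p) = p"
  unfolding chart_inv_def by (rule the_inv_into_f_f[OF inj_on_chart])

lemma chart_in_image [simp]: "p \<in> fst c \<Longrightarrow> snd c p \<in> chart_image c"
  by (simp add: chart_image_def)

lemma chart_chart_inv [simp]: "\<lbrakk>c \<in> \<A>; x \<in> chart_image c\<rbrakk> \<Longrightarrow> snd c (chart_inv c x) = x"
  by (auto simp: chart_image_def)

lemma chart_inv_in [simp]: "\<lbrakk>c \<in> \<A>; x \<in> chart_image c\<rbrakk> \<Longrightarrow> chart_inv c x \<in> fst c"
  by (auto simp: chart_image_def)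

lemma in_overlap_iff:
  "\<lbrakk>c \<in> \<A>\<rbrakk> \<Longrightarrow> x \<in> snd c ` (fst c \<inter> fst c') \<longleftrightarrow> x \<in> chart_image c \<and> chart_inv c x \<in> fst c'"
  by (auto simp: chart_image_def)

lemma chart_at: assumes "p \<in> carrier_of \<A>" shows "chart_at \<A> p \<in> \<A>" "p \<in> fst (chart_at \<A> p)"
proof -
  have "\<exists>c. c \<in> \<A> \<and> p \<in> fst c" using assms by (auto simp: carrier_of_def)
  from someI_ex[OF this] show "chart_at \<A> p \<in> \<A>" "p \<in> fst (chart_at \<A> p)"
    unfolding chart_at_def by auto
qed

lemma in_carrierI: "\<lbrakk>c \<in> \<A>; p \<in> fst c\<rbrakk> \<Longrightarrow> p \<in> carrier_of \<A>"
  by (auto simp: carrier_of_def)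

abbreviation transition_deriv :: "('m, 'e) chart \<Rightarrow> ('m, 'e) chart \<Rightarrow> 'm \<Rightarrow> 'e \<Rightarrow> 'e" where
  "transition_deriv c c' p \<equiv> fd (snd c' \<circ> chart_inv c) (snd c p)"

lemma transition_has_derivative:
  assumes "c \<in> \<A>" "c' \<in> \<A>" "p \<in> fst c" "p \<in> fst c'"
  shows "((snd c' \<circ> chart_inv c) has_derivative transition_deriv c c' p) (at (snd c p))"
  using smooth_on_has_derivative[OF smooth_transition[OF assms(1,2)], of "snd c p"] assms by simp

lemma linear_transition_deriv:
  assumes "c \<in> \<A>" "c' \<in> \<A>" "p \<in> fst c" "p \<in> fst c'"
  shows "linear (transition_deriv c c' p)"
  using transition_has_derivative[OF assms] by (rule has_derivative_linear)

lemma transition_deriv_compose: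
  assumes "c \<in> \<A>" "c' \<in> \<A>" "c'' \<in> \<A>" "p \<in> fst c" "p \<in> fst c'" "p \<in> fst c''"
  shows "transition_deriv c c'' p v = transition_deriv c' c'' p (transition_deriv c c' p v)"
proof -
  have "((\<lambda>x. (snd c'' \<circ> chart_inv c') ((snd c' \<circ> chart_inv c) x)) has_derivative
      (\<lambda>v. transition_deriv c' c'' p (transition_deriv c c' p v))) (at (snd c p))"
  proof (rule has_derivative_compose[OF transition_has_derivative[OF assms(1,2,4,5)]])
    show "(snd c'' \<circ> chart_inv c' has_derivative transition_deriv c' c'' p)
        (at ((snd c' \<circ> chart_inv c) (snd c p)))"
      using transition_has_derivative[OF assms(2,3,5,6)] assms by simp
  qed
  then have "((snd c'' \<circ> chart_inv c) has_derivative
      (\<lambda>v. transition_deriv c' c'' p (transition_deriv c c' p v))) (at (snd c p))"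
    by (rule has_derivative_transform_within_open[OF _ open_overlap[OF assms(1,2)]])
      (use assms in \<open>auto simp: in_overlap_iff\<close>)
  from fd_eqI[OF this] show ?thesis by simp
qed

lemma transition_deriv_same [simp]:
  assumes "c \<in> \<A>" "p \<in> fst c"
  shows "transition_deriv c c p v = v"
proof -
  have "fd (snd c \<circ> chart_inv c) (snd c p) = fd (\<lambda>x. x) (snd c p)"
    by (rule fd_cong[OF open_chart_image[OF assms(1)]]) (use assms in auto)
  then show ?thesis by simp
qed

lemma tangent_spaceI:
  assumes "\<And>c c'. \<lbrakk>c \<in> \<A>; c' \<in> \<A>; p \<in> fst c; p \<in> fst c'\<rbrakk> \<Longrightarrow> v c' = transition_deriv c c' p (v c)"
    and "\<And>c. \<not> (c \<in> \<A> \<and> p \<in> fst c) \<Longrightarrow> v c = 0"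
  shows "v \<in> tangent_space \<A> p"
  unfolding tangent_space_def mem_Collect_eq using assms by blast

lemma tangent_spaceD:
  "\<lbrakk>v \<in> tangent_space \<A> p; c \<in> \<A>; c' \<in> \<A>; p \<in> fst c; p \<in> fst c'\<rbrakk> \<Longrightarrow> v c' = transition_deriv c c' p (v c)"
  unfolding tangent_space_def mem_Collect_eq by blast

lemma tangent_space_outside:
  "\<lbrakk>v \<in> tangent_space \<A> p; \<not> (c \<in> \<A> \<and> p \<in> fst c)\<rbrakk> \<Longrightarrow> v c = 0"
  unfolding tangent_space_def mem_Collect_eq by blast

lemma tangent_eqI:
  assumes "v \<in> tangent_space \<A> p" "w \<in> tangent_space \<A> p" "c \<in> \<A>" "p \<in> fst c" "v c = w c"
  shows "v = w"
proof
  fix c'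
  show "v c' = w c'"
  proof (cases "c' \<in> \<A> \<and> p \<in> fst c'")
    case True
    then show ?thesis
      using tangent_spaceD[OF assms(1,3) _ assms(4), of c'] tangent_spaceD[OF assms(2,3) _ assms(4), of c'] assms(5)
      by simp
  next
    case False
    then show ?thesis using assms(1,2)[THEN tangent_space_outside] by metis
  qed
qed

definition tvec_of :: "('m, 'e) chart \<Rightarrow> 'm \<Rightarrow> 'e \<Rightarrow> ('m, 'e) tvec" where
  "tvec_of c p e = (\<lambda>c'. if c' \<in> \<A> \<and> p \<in> fst c' then transition_deriv c c' p e else 0)"

lemma tvec_of_in: "\<lbrakk>c \<in> \<A>; p \<in> fst c\<rbrakk> \<Longrightarrow> tvec_of c p e \<in> tangent_space \<A> p"
  by (rule tangent_spaceI) (simp_all only: tvec_of_def if_True simp_thms if_False transition_deriv_compose[of c, symmetric])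

lemma tvec_of_apply [simp]: "\<lbrakk>c \<in> \<A>; p \<in> fst c\<rbrakk> \<Longrightarrow> tvec_of c p e c = e"
  by (simp add: tvec_of_def)

lemma tvec_of_eq: "\<lbrakk>v \<in> tangent_space \<A> p; c \<in> \<A>; p \<in> fst c\<rbrakk> \<Longrightarrow> tvec_of c p (v c) = v"
  by (rule tangent_eqI[of _ p _ c]) (simp_all add: tvec_of_in)

lemma tangent_space_0 [simp]: "0 \<in> tangent_space \<A> p"
  by (rule tangent_spaceI) (auto simp: linear_0[OF linear_transition_deriv])

lemma tangent_space_add [simp]:
  "\<lbrakk>v \<in> tangent_space \<A> p; w \<in> tangent_space \<A> p\<rbrakk> \<Longrightarrow> v + w \<in> tangent_space \<A> p"
proof (rule tangent_spaceI)
  assume vw: "v \<in> tangent_space \<A> p" "w \<in> tangent_space \<A> p"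
  fix c
  show "(v + w) c' = transition_deriv c c' p ((v + w) c)"
    if "c \<in> \<A>" "c' \<in> \<A>" "p \<in> fst c" "p \<in> fst c'" for c'
    using vw[THEN tangent_spaceD, OF that] linear_add[OF linear_transition_deriv[OF that]] by simp
  show "(v + w) c = 0" if "\<not> (c \<in> \<A> \<and> p \<in> fst c)"
    using vw[THEN tangent_space_outside, OF that] by simp
qed

lemma tangent_space_tscale [simp]: "v \<in> tangent_space \<A> p \<Longrightarrow> tscale r v \<in> tangent_space \<A> p"
proof (rule tangent_spaceI)
  assume v: "v \<in> tangent_space \<A> p"
  fix c
  show "tscale r v c' = transition_deriv c c' p (tscale r v c)"
    if "c \<in> \<A>" "c' \<in> \<A>" "p \<in> fst c" "p \<in> fst c'" for c'
    using tangent_spaceD[OF v that] linear_cmul[OF linear_transition_deriv[OF that]] by (simp add: tscale_def)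
  show "tscale r v c = 0" if "\<not> (c \<in> \<A> \<and> p \<in> fst c)"
    using tangent_space_outside[OF v that] by (simp add: tscale_def)
qed

lemma uminus_eq_tscale: "- v = tscale (-1) v"
  by (auto simp: tscale_def)

lemma tangent_space_minus [simp]: "v \<in> tangent_space \<A> p \<Longrightarrow> - v \<in> tangent_space \<A> p"
  unfolding uminus_eq_tscale by (rule tangent_space_tscale)

lemma tangent_space_diff [simp]:
  "\<lbrakk>v \<in> tangent_space \<A> p; w \<in> tangent_space \<A> p\<rbrakk> \<Longrightarrow> v - w \<in> tangent_space \<A> p"
  using tangent_space_add[of v p "- w"] by simp

abbreviation loc :: "('m, 'e) chart \<Rightarrow> ('m \<Rightarrow> ('m, 'e) tvec) \<Rightarrow> 'e \<Rightarrow> 'e" where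
  "loc c A \<equiv> \<lambda>x. A (chart_inv c x) c"

section \<open>Vector fields and their Lie bracket\<close>

lemma vf_tangent: "\<lbrakk>A \<in> vector_fields \<A>; p \<in> carrier_of \<A>\<rbrakk> \<Longrightarrow> A p \<in> tangent_space \<A> p"
  by (simp add: vector_fields_def)

lemma vf_zero: "\<lbrakk>A \<in> vector_fields \<A>; p \<notin> carrier_of \<A>\<rbrakk> \<Longrightarrow> A p = 0"
  by (simp add: vector_fields_def)

lemma vf_smooth: "\<lbrakk>A \<in> vector_fields \<A>; c \<in> \<A>\<rbrakk> \<Longrightarrow> smooth_on (loc c A) (chart_image c)"
  by (simp add: vector_fields_def)

lemma vf_eqI:
  assumes "A \<in> vector_fields \<A>" "B \<in> vector_fields \<A>"
    and "\<And>c p. \<lbrakk>c \<in> \<A>; p \<in> fst c\<rbrakk> \<Longrightarrow> A p c = B p c"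
  shows "A = B"
proof
  fix p
  show "A p = B p"
  proof (cases "p \<in> carrier_of \<A>")
    case True
    then show ?thesis
      using tangent_eqI[of "A p" p "B p" "chart_at \<A> p"] chart_at vf_tangent assms by blast
  next
    case False
    then show ?thesis using vf_zero assms by metis
  qed
qed

lemma vf_0 [simp]: "0 \<in> vector_fields \<A>"
  by (simp add: vector_fields_def)

lemma vf_add [simp]:
  assumes "A \<in> vector_fields \<A>" "B \<in> vector_fields \<A>"
  shows "A + B \<in> vector_fields \<A>"
  using assms smooth_on_add[OF vf_smooth[OF assms(1)] vf_smooth[OF assms(2)] open_chart_image]
  by (simp add: vector_fields_def)

lemma vf_minus [simp]:
  assumes "A \<in> vector_fields \<A>"
  shows "- A \<in> vector_fields \<A>"
  using assms smooth_on_minus[OF vf_smooth[OF assms(1)] open_chart_image]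
  by (simp add: vector_fields_def)

lemma loc_transition:
  assumes "A \<in> vector_fields \<A>" "c \<in> \<A>" "c' \<in> \<A>" "x \<in> snd c ` (fst c \<inter> fst c')"
  shows "loc c' A ((snd c' \<circ> chart_inv c) x) = fd (snd c' \<circ> chart_inv c) x (loc c A x)"
proof -
  obtain p where p: "p \<in> fst c" "p \<in> fst c'" "x = snd c p"
    using assms(4) by auto
  then show ?thesis
    using tangent_spaceD[OF vf_tangent[OF assms(1)] assms(2,3), of p] in_carrierI assms by simp
qed

text \<open>The first summand is the failure of the derivative to transform as a tensor. It is a
  second derivative of the transition map, symmetric in \<open>A p c\<close> and \<open>v\<close>,
  so it cancels in the Lie bracket.\<close>

lemma fd_loc_transition:
  assumes A: "A \<in> vector_fields \<A>" and c: "c \<in> \<A>" "c' \<in> \<A>" "p \<in> fst c" "p \<in> fst c'"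
  shows "fd (loc c' A) (snd c' p) (transition_deriv c c' p v)
    = fd (\<lambda>y. fd (snd c' \<circ> chart_inv c) y (A p c)) (snd c p) v
      + transition_deriv c c' p (fd (loc c A) (snd c p) v)"
proof -
  let ?\<tau> = "snd c' \<circ> chart_inv c" and ?S = "snd c ` (fst c \<inter> fst c')" and ?x = "snd c p"
  have x: "?x \<in> ?S" using c by auto
  have t: "?\<tau> ?x = snd c' p" using c by simp
  have a: "(loc c A has_derivative fd (loc c A) ?x) (at ?x)"
    by (rule smooth_on_has_derivative[OF vf_smooth[OF A c(1)]]) (use c in simp)
  have l: "((\<lambda>y. loc c' A (?\<tau> y)) has_derivative
      (\<lambda>v. fd (loc c' A) (?\<tau> ?x) (transition_deriv c c' p v))) (at ?x)"
    by (rule smooth_on_compose_has_derivative[OF vf_smooth[OF A c(2)] transition_has_derivative[OF c]])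
      (use c in simp)
  have "((\<lambda>y. fd ?\<tau> y (loc c A y)) has_derivative
     (\<lambda>v. fd (\<lambda>y. fd ?\<tau> y (loc c A ?x)) ?x v + fd ?\<tau> ?x (fd (loc c A) ?x v))) (at ?x)"
    by (rule has_derivative_fd_apply[OF smooth_transition[OF c(1,2)] has_derivative_ident a x open_overlap[OF c(1,2)]])
  then have "((\<lambda>y. loc c' A (?\<tau> y)) has_derivative
     (\<lambda>v. fd (\<lambda>y. fd ?\<tau> y (loc c A ?x)) ?x v + fd ?\<tau> ?x (fd (loc c A) ?x v))) (at ?x)"
    by (rule has_derivative_transform_within_open[OF _ open_overlap[OF c(1,2)] x])
      (rule loc_transition[OF A c(1,2), symmetric])
  from has_derivative_unique[OF l this]
  have "fd (loc c' A) (?\<tau> ?x) (transition_deriv c c' p v)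
      = fd (\<lambda>y. fd ?\<tau> y (loc c A ?x)) ?x v + fd ?\<tau> ?x (fd (loc c A) ?x v)"
    by (rule fun_cong)
  then show ?thesis
    using c by (simp only: t chart_inv_chart)
qed

lemma lie_bracket_chart:
  "\<lbrakk>c \<in> \<A>; p \<in> fst c\<rbrakk> \<Longrightarrow> lie_bracket \<A> A B p c =
    fd (loc c B) (snd c p) (A p c) - fd (loc c A) (snd c p) (B p c)"
  by (simp add: lie_bracket_def)

lemma lie_bracket_closed [simp]:
  assumes A: "A \<in> vector_fields \<A>" and B: "B \<in> vector_fields \<A>"
  shows "lie_bracket \<A> A B \<in> vector_fields \<A>"
  unfolding vector_fields_def mem_Collect_eq
proof (intro conjI ballI allI impI)
  fix p assume "p \<in> carrier_of \<A>"
  show "lie_bracket \<A> A B p \<in> tangent_space \<A> p"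
  proof (rule tangent_spaceI)
    fix c c' assume c: "c \<in> \<A>" "c' \<in> \<A>" and p: "p \<in> fst c" "p \<in> fst c'"
    have t: "A p c' = transition_deriv c c' p (A p c)" "B p c' = transition_deriv c c' p (B p c)"
      using tangent_spaceD[OF vf_tangent[OF _ \<open>p \<in> carrier_of \<A>\<close>] c p] A B by simp_all
    have "fd (\<lambda>y. fd (snd c' \<circ> chart_inv c) y (A p c)) (snd c p) (B p c)
        = fd (\<lambda>y. fd (snd c' \<circ> chart_inv c) y (B p c)) (snd c p) (A p c)"
      by (rule fd_symmetric[OF smooth_transition[OF c] open_overlap[OF c]]) (use p in simp)
    then show "lie_bracket \<A> A B p c' = transition_deriv c c' p (lie_bracket \<A> A B p c)"
      using fd_loc_transition[OF A c p, of "B p c"] fd_loc_transition[OF B c p, of "A p c"]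
      by (simp add: lie_bracket_chart c p t(1) t(2) linear_diff[OF linear_transition_deriv[OF c p]])
  qed (auto simp: lie_bracket_def)
next
  show "lie_bracket \<A> A B p = 0" if "p \<notin> carrier_of \<A>" for p
    using that in_carrierI by (intro ext) (auto simp: lie_bracket_def)
next
  fix c assume c: "c \<in> \<A>"
  have "smooth_on (\<lambda>x. fd (loc c B) x (loc c A x) - fd (loc c A) x (loc c B x)) (chart_image c)"
    by (rule smooth_on_diff[OF smooth_on_fd_apply[OF vf_smooth[OF B c] smooth_on_ident vf_smooth[OF A c]]
        smooth_on_fd_apply[OF vf_smooth[OF A c] smooth_on_ident vf_smooth[OF B c]]])
      (auto intro: open_chart_image c)
  then show "smooth_on (loc c (lie_bracket \<A> A B)) (chart_image c)"
    by (rule smooth_on_cong[OF open_chart_image[OF c], rotated]) (simp add: lie_bracket_chart c)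
qed

lemma loc_has_derivative:
  "\<lbrakk>A \<in> vector_fields \<A>; c \<in> \<A>; x \<in> chart_image c\<rbrakk> \<Longrightarrow> (loc c A has_derivative fd (loc c A) x) (at x)"
  by (rule smooth_on_has_derivative[OF vf_smooth])

lemma lie_bracket_anti: "lie_bracket \<A> A B = - lie_bracket \<A> B A"
  by (auto simp: lie_bracket_def fun_eq_iff)

lemma lie_bracket_add:
  assumes "A \<in> vector_fields \<A>" "B \<in> vector_fields \<A>" "C \<in> vector_fields \<A>"
  shows "lie_bracket \<A> (A + B) C = lie_bracket \<A> A C + lie_bracket \<A> B C"
proof (rule vf_eqI)
  fix c p assume c: "c \<in> \<A>" "p \<in> fst c"
  have "fd (\<lambda>x. loc c A x + loc c B x) (snd c p) = (\<lambda>v. fd (loc c A) (snd c p) v + fd (loc c B) (snd c p) v)"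
    by (intro fd_eqI has_derivative_add loc_has_derivative assms c chart_in_image)
  moreover have "linear (fd (loc c C) (snd c p))"
    by (rule smooth_on_linear_fd[OF vf_smooth[OF assms(3) c(1)]]) (simp add: c)
  ultimately show "lie_bracket \<A> (A + B) C p c = (lie_bracket \<A> A C + lie_bracket \<A> B C) p c"
    by (simp add: lie_bracket_chart c linear_add)
qed (simp_all add: assms)

lemma fd_loc_bracket:
  assumes A: "A \<in> vector_fields \<A>" and B: "B \<in> vector_fields \<A>" and c: "c \<in> \<A>" "p \<in> fst c"
  shows "fd (loc c (lie_bracket \<A> A B)) (snd c p) v =
    (fd (\<lambda>y. fd (loc c B) y (A p c)) (snd c p) v + fd (loc c B) (snd c p) (fd (loc c A) (snd c p) v))
    - (fd (\<lambda>y. fd (loc c A) y (B p c)) (snd c p) v + fd (loc c A) (snd c p) (fd (loc c B) (snd c p) v))"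
proof -
  have x: "snd c p \<in> chart_image c" using c by simp
  have *: "((\<lambda>x. fd (loc c B) x (loc c A x)) has_derivative
      (\<lambda>v. fd (\<lambda>y. fd (loc c B) y (loc c A (snd c p))) (snd c p) v + fd (loc c B) (snd c p) (fd (loc c A) (snd c p) v)))
      (at (snd c p))" if A: "A \<in> vector_fields \<A>" and B: "B \<in> vector_fields \<A>" for A B
    by (rule has_derivative_fd_apply[OF vf_smooth[OF B c(1)] has_derivative_ident loc_has_derivative[OF A c(1) x]
          x open_chart_image[OF c(1)]])
  have "fd (loc c (lie_bracket \<A> A B)) (snd c p) =
      fd (\<lambda>x. fd (loc c B) x (loc c A x) - fd (loc c A) x (loc c B x)) (snd c p)"
    by (rule fd_cong[OF open_chart_image[OF c(1)] x]) (simp add: lie_bracket_chart c)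
  also have "\<dots> = (\<lambda>v. (fd (\<lambda>y. fd (loc c B) y (loc c A (snd c p))) (snd c p) v
        + fd (loc c B) (snd c p) (fd (loc c A) (snd c p) v))
      - (fd (\<lambda>y. fd (loc c A) y (loc c B (snd c p))) (snd c p) v
        + fd (loc c A) (snd c p) (fd (loc c B) (snd c p) v)))"
    by (rule fd_eqI[OF has_derivative_diff[OF *[OF A B] *[OF B A]]])
  finally show ?thesis using c by simp
qed

lemma lie_bracket_jacobi:
  assumes A: "A \<in> vector_fields \<A>" and B: "B \<in> vector_fields \<A>" and C: "C \<in> vector_fields \<A>"
  shows "lie_bracket \<A> A (lie_bracket \<A> B C) + lie_bracket \<A> B (lie_bracket \<A> C A)
    + lie_bracket \<A> C (lie_bracket \<A> A B) = 0"
proof (rule vf_eqI)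
  fix c p assume c: "c \<in> \<A>" "p \<in> fst c"
  have lin: "linear (fd (loc c A) (snd c p))" if "A \<in> vector_fields \<A>" for A
    by (rule smooth_on_linear_fd[OF vf_smooth[OF that c(1)]]) (simp add: c)
  have sym: "fd (\<lambda>y. fd (loc c A) y v) (snd c p) w = fd (\<lambda>y. fd (loc c A) y w) (snd c p) v"
    if "A \<in> vector_fields \<A>" for A v w
    by (rule fd_symmetric[OF vf_smooth[OF that c(1)] open_chart_image[OF c(1)]]) (simp add: c)
  show "(lie_bracket \<A> A (lie_bracket \<A> B C) + lie_bracket \<A> B (lie_bracket \<A> C A)
    + lie_bracket \<A> C (lie_bracket \<A> A B)) p c = (0 :: 'm \<Rightarrow> ('m, 'e) tvec) p c"
    \<comment> \<open>These are the three pairs of mixed second derivatives; the compositions of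
      first derivatives cancel by themselves.\<close>
    using sym[OF A, of "B p c" "C p c"] sym[OF B, of "C p c" "A p c"] sym[OF C, of "A p c" "B p c"]
    by (simp add: lie_bracket_chart c fd_loc_bracket A B C linear_diff[OF lin] algebra_simps)
qed (simp_all add: assms)

section \<open>Derivatives of smooth functions along vector fields\<close>

lemma sf_smooth: "\<lbrakk>f \<in> smooth_functions \<A>; c \<in> \<A>\<rbrakk> \<Longrightarrow> smooth_on (f \<circ> chart_inv c) (chart_image c)"
  by (simp add: smooth_functions_def)

lemma differential_chart:
  assumes f: "f \<in> smooth_functions \<A>" and c: "c \<in> \<A>" "p \<in> fst c" and v: "v \<in> tangent_space \<A> p"
  shows "differential \<A> f p v = fd (f \<circ> chart_inv c) (snd c p) (v c)"
proof -
  let ?c = "chart_at \<A> p"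
  have p: "p \<in> carrier_of \<A>" using c by (rule in_carrierI)
  note c0 = chart_at[OF p]
  have d: "((\<lambda>x. (f \<circ> chart_inv ?c) ((snd ?c \<circ> chart_inv c) x)) has_derivative
      (\<lambda>v. fd (f \<circ> chart_inv ?c) ((snd ?c \<circ> chart_inv c) (snd c p)) (transition_deriv c ?c p v))) (at (snd c p))"
    by (rule smooth_on_compose_has_derivative[OF sf_smooth[OF f c0(1)] transition_has_derivative[OF c(1) c0(1) c(2) c0(2)]])
      (use c c0 in simp)
  have "((f \<circ> chart_inv c) has_derivative
      (\<lambda>v. fd (f \<circ> chart_inv ?c) ((snd ?c \<circ> chart_inv c) (snd c p)) (transition_deriv c ?c p v))) (at (snd c p))"
    by (rule has_derivative_transform_within_open[OF d open_overlap[OF c(1) c0(1)]])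
      (use c c0 in \<open>auto simp: in_overlap_iff\<close>)
  from fd_eqI[OF this] show ?thesis
    using tangent_spaceD[OF v c(1) c0(1) c(2) c0(2)] c by (simp add: differential_def Let_def)
qed

text \<open>The value 0 off the manifold turns identities between derivatives into equalities of
  functions, the form used in \<open>cartan_algebra\<close>.\<close>

definition dvf :: "('m \<Rightarrow> ('m, 'e) tvec) \<Rightarrow> ('m \<Rightarrow> real) \<Rightarrow> 'm \<Rightarrow> real" where
  "dvf A f p = (if p \<in> carrier_of \<A> then differential \<A> f p (A p) else 0)"

lemma dvf_chart:
  assumes "A \<in> vector_fields \<A>" "f \<in> smooth_functions \<A>" "c \<in> \<A>" "p \<in> fst c"
  shows "dvf A f p = fd (f \<circ> chart_inv c) (snd c p) (A p c)"
  using differential_chart[OF assms(2-4) vf_tangent[OF assms(1) in_carrierI[OF assms(3,4)]]]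
    in_carrierI[OF assms(3,4)] by (simp add: dvf_def)

lemma dvf_smooth:
  assumes "A \<in> vector_fields \<A>" "f \<in> smooth_functions \<A>"
  shows "dvf A f \<in> smooth_functions \<A>"
  unfolding smooth_functions_def mem_Collect_eq
proof
  fix c assume c: "c \<in> \<A>"
  have "smooth_on (\<lambda>x. fd (f \<circ> chart_inv c) x (loc c A x)) (chart_image c)"
    by (rule smooth_on_fd_apply[OF sf_smooth[OF assms(2) c] smooth_on_ident vf_smooth[OF assms(1) c]])
      (auto intro: open_chart_image c)
  then show "smooth_on (dvf A f \<circ> chart_inv c) (chart_image c)"
    by (rule smooth_on_cong[OF open_chart_image[OF c], rotated]) (simp add: dvf_chart[OF assms c] c)
qed

lemma sf_add:
  assumes "f \<in> smooth_functions \<A>" "g \<in> smooth_functions \<A>"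
  shows "f + g \<in> smooth_functions \<A>"
  unfolding smooth_functions_def mem_Collect_eq
proof
  fix c assume c: "c \<in> \<A>"
  show "smooth_on (f + g \<circ> chart_inv c) (chart_image c)"
    using smooth_on_add[OF sf_smooth[OF assms(1) c] sf_smooth[OF assms(2) c] open_chart_image[OF c]]
    by (simp add: comp_def)
qed

lemma dvf_add:
  assumes A: "A \<in> vector_fields \<A>" and fg: "f \<in> smooth_functions \<A>" "g \<in> smooth_functions \<A>"
  shows "dvf A (f + g) = dvf A f + dvf A g"
proof
  fix p
  show "dvf A (f + g) p = (dvf A f + dvf A g) p"
  proof (cases "p \<in> carrier_of \<A>")
    case True
    note c = chart_at[OF True]
    let ?c = "chart_at \<A> p"
    have x: "snd ?c p \<in> chart_image ?c" using c by simp
    have e: "(\<lambda>x. (f \<circ> chart_inv ?c) x + (g \<circ> chart_inv ?c) x) = (f + g) \<circ> chart_inv ?c"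
      by (rule ext) simp
    from fd_eqI[OF has_derivative_add[OF smooth_on_has_derivative[OF sf_smooth[OF fg(1) c(1)] x]
          smooth_on_has_derivative[OF sf_smooth[OF fg(2) c(1)] x]], unfolded e]
    have "fd ((f + g) \<circ> chart_inv ?c) (snd ?c p) (A p ?c) =
      fd (f \<circ> chart_inv ?c) (snd ?c p) (A p ?c) + fd (g \<circ> chart_inv ?c) (snd ?c p) (A p ?c)"
      by (rule fun_cong)
    then show ?thesis
      using dvf_chart[OF A fg(1) c] dvf_chart[OF A fg(2) c] dvf_chart[OF A sf_add[OF fg] c] by simp
  next
    case False
    then show ?thesis by (simp add: dvf_def)
  qed
qed

lemma fd_dvf:
  assumes A: "A \<in> vector_fields \<A>" and f: "f \<in> smooth_functions \<A>" and c: "c \<in> \<A>" "p \<in> fst c"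
  shows "fd (dvf A f \<circ> chart_inv c) (snd c p) v = fd (\<lambda>y. fd (f \<circ> chart_inv c) y (A p c)) (snd c p) v
      + fd (f \<circ> chart_inv c) (snd c p) (fd (loc c A) (snd c p) v)"
proof -
  have x: "snd c p \<in> chart_image c" using c by simp
  have "((\<lambda>x. fd (f \<circ> chart_inv c) x (loc c A x)) has_derivative
    (\<lambda>v. fd (\<lambda>y. fd (f \<circ> chart_inv c) y (loc c A (snd c p))) (snd c p) v
      + fd (f \<circ> chart_inv c) (snd c p) (fd (loc c A) (snd c p) v))) (at (snd c p))"
    by (rule has_derivative_fd_apply[OF sf_smooth[OF f c(1)] has_derivative_ident loc_has_derivative[OF A c(1) x]
          x open_chart_image[OF c(1)]])
  from fd_eqI[OF this]
  have "fd (\<lambda>x. fd (f \<circ> chart_inv c) x (loc c A x)) (snd c p) v =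
      fd (\<lambda>y. fd (f \<circ> chart_inv c) y (A p c)) (snd c p) v
      + fd (f \<circ> chart_inv c) (snd c p) (fd (loc c A) (snd c p) v)"
    using c by simp
  moreover have "fd (dvf A f \<circ> chart_inv c) (snd c p) = fd (\<lambda>x. fd (f \<circ> chart_inv c) x (loc c A x)) (snd c p)"
    by (rule fd_cong[OF open_chart_image[OF c(1)] x]) (simp add: dvf_chart[OF A f c(1)] c)
  ultimately show ?thesis by simp
qed

lemma dvf_lie_bracket:
  assumes A: "A \<in> vector_fields \<A>" and B: "B \<in> vector_fields \<A>" and f: "f \<in> smooth_functions \<A>"
  shows "dvf (lie_bracket \<A> A B) f = dvf A (dvf B f) - dvf B (dvf A f)"
proof
  fix p
  show "dvf (lie_bracket \<A> A B) f p = (dvf A (dvf B f) - dvf B (dvf A f)) p"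
  proof (cases "p \<in> carrier_of \<A>")
    case True
    note c = chart_at[OF True]
    let ?c = "chart_at \<A> p"
    have x: "snd ?c p \<in> chart_image ?c" using c by simp
    have "fd (\<lambda>y. fd (f \<circ> chart_inv ?c) y (A p ?c)) (snd ?c p) (B p ?c)
        = fd (\<lambda>y. fd (f \<circ> chart_inv ?c) y (B p ?c)) (snd ?c p) (A p ?c)"
      by (rule fd_symmetric[OF sf_smooth[OF f c(1)] open_chart_image[OF c(1)] x])
    then show ?thesis
      by (simp add: dvf_chart[OF _ _ c] A B f dvf_smooth fd_dvf[OF _ f c] lie_bracket_chart[OF c]
          linear_diff[OF smooth_on_linear_fd[OF sf_smooth[OF f c(1)] x]])
  next
    case False
    then show ?thesis by (simp add: dvf_def)
  qed
qed

end

section \<open>The slit tangent bundle\<close>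

lemma smooth_atlas_imp_atlas:
  assumes "smooth_atlas X \<A>"
  shows "atlas \<A>"
proof
  fix c assume c: "c \<in> \<A>"
  show "open (chart_image c)" using assms c by (simp add: smooth_atlas_def)
  have hc: "openin X (fst c)" "homeomorphic_map (subtopology X (fst c)) (top_of_set (chart_image c)) (snd c)"
    using assms c by (simp_all add: smooth_atlas_def)
  have "topspace (subtopology X (fst c)) = fst c"
    using openin_subset[OF hc(1)] by auto
  then show "inj_on (snd c) (fst c)"
    using hc(2) by (simp add: homeomorphic_eq_everything_map)
  fix c' assume c': "c' \<in> \<A>"
  show "smooth_on (snd c' \<circ> chart_inv c) (snd c ` (fst c \<inter> fst c'))"
    using assms c c' by (simp add: smooth_atlas_def)
  have "openin X (fst c')" using assms c' by (simp add: smooth_atlas_def)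
  then have "openin (subtopology X (fst c)) (fst c \<inter> fst c')"
    using hc(1) by (simp add: openin_subtopology_Int2)
  then have "openin (top_of_set (chart_image c)) (snd c ` (fst c \<inter> fst c'))"
    using homeomorphic_imp_open_map[OF hc(2)] by (simp add: open_map_def)
  then show "open (snd c ` (fst c \<inter> fst c'))"
    using \<open>open (chart_image c)\<close> openin_open_trans by blast
qed

context atlas
begin

abbreviation sl :: "('m, 'e) chart \<Rightarrow> (('m, 'e) tpoint, 'e \<times> 'e) chart" where
  "sl \<equiv> slit_chart \<A>"

lemma in_slit_chart_iff: "u \<in> fst (sl c) \<longleftrightarrow> u \<in> slit_bundle \<A> \<and> fst u \<in> fst c"
  by (simp add: slit_chart_def)

lemma snd_slit_chart [simp]: "snd (sl c) u = (snd c (fst u), snd u c)"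
  by (simp add: slit_chart_def case_prod_beta)

lemma slit_bundle_tangent: "u \<in> slit_bundle \<A> \<Longrightarrow> snd u \<in> tangent_space \<A> (fst u)"
  by (auto simp: slit_bundle_def tangent_bundle_def)

lemma slit_bundle_carrier: "u \<in> slit_bundle \<A> \<Longrightarrow> fst u \<in> carrier_of \<A>"
  by (auto simp: slit_bundle_def tangent_bundle_def)

lemma slit_bundle_nonzero: "u \<in> slit_bundle \<A> \<Longrightarrow> snd u \<noteq> 0"
  by (auto simp: slit_bundle_def)

lemma slit_bundleI: "\<lbrakk>p \<in> carrier_of \<A>; v \<in> tangent_space \<A> p; v \<noteq> 0\<rbrakk> \<Longrightarrow> (p, v) \<in> slit_bundle \<A>"
  by (simp add: slit_bundle_def tangent_bundle_def)

lemma slit_chart_exists: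
  assumes "u \<in> slit_bundle \<A>"
  obtains c where "c \<in> \<A>" "fst u \<in> fst c"
  using chart_at[OF slit_bundle_carrier[OF assms]] by blast

lemma slit_nonzero:
  assumes "u \<in> slit_bundle \<A>" "c \<in> \<A>" "fst u \<in> fst c"
  shows "snd u c \<noteq> 0"
  using tangent_eqI[OF slit_bundle_tangent[OF assms(1)] tangent_space_0 assms(2,3)]
    slit_bundle_nonzero[OF assms(1)] by auto

lemma slit_point_of:
  assumes "c \<in> \<A>" "x \<in> chart_image c" "y \<noteq> 0"
  shows "(chart_inv c x, tvec_of c (chart_inv c x) y) \<in> fst (sl c)"
    and "snd (sl c) (chart_inv c x, tvec_of c (chart_inv c x) y) = (x, y)"
proof -
  have p: "chart_inv c x \<in> fst c" using assms by simp
  have "tvec_of c (chart_inv c x) y c \<noteq> 0"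
    using assms p by simp
  then have "tvec_of c (chart_inv c x) y \<noteq> 0" by auto
  then show "(chart_inv c x, tvec_of c (chart_inv c x) y) \<in> fst (sl c)"
    using p assms tvec_of_in in_carrierI by (simp add: in_slit_chart_iff slit_bundleI)
  show "snd (sl c) (chart_inv c x, tvec_of c (chart_inv c x) y) = (x, y)"
    using p assms by simp
qed

lemma slit_chart_image:
  assumes "c \<in> \<A>"
  shows "chart_image (sl c) = chart_image c \<times> (- {0})"
proof (intro equalityI subsetI)
  fix z assume "z \<in> chart_image (sl c)"
  then obtain u where u: "u \<in> fst (sl c)" "z = snd (sl c) u"
    by (auto simp: chart_image_def)
  then show "z \<in> chart_image c \<times> (- {0})"
    using slit_nonzero assms by (simp add: in_slit_chart_iff)
next
  fix z assume "z \<in> chart_image c \<times> (- {0 :: 'e})"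
  then obtain x y where "z = (x, y)" "x \<in> chart_image c" "y \<noteq> 0" by auto
  then show "z \<in> chart_image (sl c)"
    using slit_point_of[OF assms, of x y] unfolding chart_image_def[of "sl c"] by (metis imageI)
qed

lemma inj_on_slit_chart:
  assumes "c \<in> \<A>"
  shows "inj_on (snd (sl c)) (fst (sl c))"
proof (rule inj_onI)
  fix u w assume u: "u \<in> fst (sl c)" and w: "w \<in> fst (sl c)" and eq: "snd (sl c) u = snd (sl c) w"
  have p: "fst u = fst w"
    using eq inj_on_chart[OF assms] u w by (auto simp: in_slit_chart_iff inj_on_def)
  have "snd u = snd w"
    using tangent_eqI[of "snd u" "fst u" "snd w" c] u w eq p assms slit_bundle_tangent
    by (simp add: in_slit_chart_iff) metis
  with p show "u = w" by (simp add: prod_eq_iff)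
qed

lemma chart_inv_slit:
  assumes "c \<in> \<A>" "x \<in> chart_image c" "y \<noteq> 0"
  shows "chart_inv (sl c) (x, y) = (chart_inv c x, tvec_of c (chart_inv c x) y)"
  unfolding chart_inv_def[of "sl c"]
  by (rule the_inv_into_f_eq[OF inj_on_slit_chart[OF assms(1)] slit_point_of(2)[OF assms] slit_point_of(1)[OF assms]])

lemma slit_overlap:
  assumes "c \<in> \<A>" "c' \<in> \<A>"
  shows "snd (sl c) ` (fst (sl c) \<inter> fst (sl c')) = (snd c ` (fst c \<inter> fst c')) \<times> (- {0})"
proof (intro equalityI subsetI)
  fix z assume "z \<in> snd (sl c) ` (fst (sl c) \<inter> fst (sl c'))"
  then obtain u where u: "u \<in> fst (sl c)" "u \<in> fst (sl c')" "z = snd (sl c) u"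
    by auto
  then show "z \<in> (snd c ` (fst c \<inter> fst c')) \<times> (- {0})"
    using slit_nonzero assms by (auto simp: in_slit_chart_iff)
next
  fix z assume "z \<in> (snd c ` (fst c \<inter> fst c')) \<times> (- {0 :: 'e})"
  then obtain p y where z: "z = (snd c p, y)" "p \<in> fst c" "p \<in> fst c'" "y \<noteq> 0" by auto
  have "(p, tvec_of c p y) \<in> fst (sl c)" "snd (sl c) (p, tvec_of c p y) = z"
    using slit_point_of[OF assms(1), of "snd c p" y] z assms by simp_all
  moreover from this have "(p, tvec_of c p y) \<in> fst (sl c')"
    using z by (simp add: in_slit_chart_iff)
  ultimately show "z \<in> snd (sl c) ` (fst (sl c) \<inter> fst (sl c'))" by blast
qed

lemma slit_transition:
  assumes "c \<in> \<A>" "c' \<in> \<A>" "z \<in> (snd c ` (fst c \<inter> fst c')) \<times> (- {0})"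
  shows "(snd (sl c') \<circ> chart_inv (sl c)) z
    = ((snd c' \<circ> chart_inv c) (fst z), fd (snd c' \<circ> chart_inv c) (fst z) (snd z))"
proof -
  obtain p y where z: "z = (snd c p, y)" "p \<in> fst c" "p \<in> fst c'" "y \<noteq> 0" using assms(3) by auto
  then show ?thesis
    using assms by (simp add: chart_inv_slit) (simp add: tvec_of_def)
qed

lemma open_slit_overlap:
  assumes "c \<in> \<A>" "c' \<in> \<A>"
  shows "open ((snd c ` (fst c \<inter> fst c')) \<times> (- {0 :: 'e}))"
  by (intro open_Times open_overlap assms) auto

lemma smooth_on_transition_pair:
  assumes "c \<in> \<A>" "c' \<in> \<A>"
  shows "smooth_on (\<lambda>z. ((snd c' \<circ> chart_inv c) (fst z), fd (snd c' \<circ> chart_inv c) (fst z) (snd z)))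
    ((snd c ` (fst c \<inter> fst c')) \<times> (- {0}))" (is "smooth_on _ ?S")
proof -
  have fs: "smooth_on fst ?S" "smooth_on snd ?S"
    by (rule smooth_on_subset[OF smooth_on_id_linear[OF linear_fst] subset_UNIV],
        rule smooth_on_subset[OF smooth_on_id_linear[OF linear_snd] subset_UNIV])
  have im: "fst ` ?S \<subseteq> snd c ` (fst c \<inter> fst c')" by auto
  show ?thesis
    by (rule smooth_on_Pair[OF
          smooth_on_compose[OF smooth_transition[OF assms] fs(1) im open_slit_overlap[OF assms] open_overlap[OF assms]]
          smooth_on_fd_apply[OF smooth_transition[OF assms] fs im open_slit_overlap[OF assms] open_overlap[OF assms]]
          open_slit_overlap[OF assms]])
qed

lemma atlas_slit: "atlas (slit_atlas \<A>)"
proof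
  fix s assume "s \<in> slit_atlas \<A>"
  then obtain c where c: "c \<in> \<A>" "s = sl c" by (auto simp: slit_atlas_def)
  show "open (chart_image s)"
    unfolding c(2) slit_chart_image[OF c(1)] by (intro open_Times open_chart_image c) auto
  show "inj_on (snd s) (fst s)"
    unfolding c(2) by (rule inj_on_slit_chart[OF c(1)])
  fix s' assume "s' \<in> slit_atlas \<A>"
  then obtain c' where c': "c' \<in> \<A>" "s' = sl c'" by (auto simp: slit_atlas_def)
  show "open (snd s ` (fst s \<inter> fst s'))"
    unfolding c(2) c'(2) slit_overlap[OF c(1) c'(1)] by (rule open_slit_overlap[OF c(1) c'(1)])
  show "smooth_on (snd s' \<circ> chart_inv s) (snd s ` (fst s \<inter> fst s'))"
    unfolding c(2) c'(2) slit_overlap[OF c(1) c'(1)]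
    by (rule smooth_on_cong[OF open_slit_overlap[OF c(1) c'(1)] _ smooth_on_transition_pair[OF c(1) c'(1)]])
      (rule slit_transition[OF c(1) c'(1), symmetric])
qed

end

text \<open>Kept apart from \<open>atlas\<close>, because there the interpretation of the slit atlas
  as an atlas would apply again to the slit atlas, and so on.\<close>

locale base_atlas = atlas \<A> for \<A> :: "('m, 'e::euclidean_space) chart set"
begin

sublocale slit: atlas "slit_atlas \<A>"
  by (rule atlas_slit)

abbreviation "slit_fields \<equiv> vector_fields (slit_atlas \<A>)"
abbreviation "slit_bracket \<equiv> lie_bracket (slit_atlas \<A>)"
abbreviation "slit_tangent \<equiv> tangent_space (slit_atlas \<A>)"

lemma sl_in [simp]: "c \<in> \<A> \<Longrightarrow> sl c \<in> slit_atlas \<A>"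
  by (simp add: slit_atlas_def)

lemma slit_atlasE:
  assumes "s \<in> slit_atlas \<A>"
  obtains c where "c \<in> \<A>" "s = sl c"
  using assms by (auto simp: slit_atlas_def)

lemma carrier_slit [simp]: "carrier_of (slit_atlas \<A>) = slit_bundle \<A>"
  using slit_bundle_carrier by (auto simp: carrier_of_def slit_atlas_def in_slit_chart_iff)

text \<open>The triangular shape makes \<rho> and \<gamma> well defined: first components transform
  among themselves, and for vectors with first component 0 the second-derivative term
  disappears.\<close>

lemma slit_transition_deriv:
  assumes c: "c \<in> \<A>" "c' \<in> \<A>" and u: "u \<in> slit_bundle \<A>" "fst u \<in> fst c" "fst u \<in> fst c'"
  shows "slit.transition_deriv (sl c) (sl c') u (a, b) =
    (transition_deriv c c' (fst u) a,
     fd (\<lambda>x. fd (snd c' \<circ> chart_inv c) x (snd u c)) (snd c (fst u)) a + transition_deriv c c' (fst u) b)"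
proof -
  let ?\<tau> = "snd c' \<circ> chart_inv c" and ?z = "snd (sl c) u"
  have z: "?z \<in> (snd c ` (fst c \<inter> fst c')) \<times> (- {0 :: 'e})"
    using u slit_nonzero[OF u(1) c(1) u(2)] by auto
  have x: "fst ?z \<in> snd c ` (fst c \<inter> fst c')" using z by auto
  have f: "(fst has_derivative fst) (at ?z)" "(snd has_derivative snd) (at ?z)"
    by (rule bounded_linear_imp_has_derivative[OF bounded_linear_fst],
        rule bounded_linear_imp_has_derivative[OF bounded_linear_snd])
  have "((\<lambda>z. (?\<tau> (fst z), fd ?\<tau> (fst z) (snd z))) has_derivative
    (\<lambda>w. (fd ?\<tau> (fst ?z) (fst w), fd (\<lambda>y. fd ?\<tau> y (snd ?z)) (fst ?z) (fst w) + fd ?\<tau> (fst ?z) (snd w)))) (at ?z)"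
    by (rule has_derivative_Pair[OF smooth_on_compose_has_derivative[OF smooth_transition[OF c] f(1) x]
          has_derivative_fd_apply[OF smooth_transition[OF c] f x open_overlap[OF c]]])
  moreover have "fd (snd (sl c') \<circ> chart_inv (sl c)) ?z = fd (\<lambda>z. (?\<tau> (fst z), fd ?\<tau> (fst z) (snd z))) ?z"
    by (rule fd_cong[OF open_slit_overlap[OF c] z]) (rule slit_transition[OF c])
  ultimately have "fd (snd (sl c') \<circ> chart_inv (sl c)) ?z =
     (\<lambda>w. (fd ?\<tau> (fst ?z) (fst w), fd (\<lambda>y. fd ?\<tau> y (snd ?z)) (fst ?z) (fst w) + fd ?\<tau> (fst ?z) (snd w)))"
    by (simp only: fd_eqI)
  then show ?thesis by simp
qed

lemma svec_transition:
  assumes "a \<in> slit_tangent u" "c \<in> \<A>" "c' \<in> \<A>" "u \<in> slit_bundle \<A>" "fst u \<in> fst c" "fst u \<in> fst c'"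
  shows "fst (a (sl c')) = transition_deriv c c' (fst u) (fst (a (sl c)))"
  using slit.tangent_spaceD[OF assms(1), of "sl c" "sl c'"]
    slit_transition_deriv[OF assms(2-6), of "fst (a (sl c))" "snd (a (sl c))"] assms
  by (simp add: in_slit_chart_iff del: snd_slit_chart)

text \<open>The slit chart in which \<open>rho\<close> is evaluated is an arbitrary choice, so
  passing from it to \<open>sl c\<close> is the content of the proof.\<close>

lemma rho_apply:
  assumes a: "a \<in> slit_tangent u" and u: "u \<in> slit_bundle \<A>" "fst u \<in> fst c" and c: "c \<in> \<A>"
  shows "rho \<A> u a c = fst (a (sl c))"
proof -
  let ?s = "chart_at (slit_atlas \<A>) u"
  have s: "?s \<in> slit_atlas \<A>" "u \<in> fst ?s"
    using slit.chart_at u by simp_all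
  obtain c0 where c0: "c0 \<in> \<A>" "?s = sl c0" using s(1) by (rule slit_atlasE)
  have u0: "fst u \<in> fst c0" using s(2) unfolding c0(2) by (simp add: in_slit_chart_iff)
  let ?\<tau> = "snd c \<circ> chart_inv c0" and ?z = "snd (sl c0) u"
  have z: "?z \<in> (snd c0 ` (fst c0 \<inter> fst c)) \<times> (- {0})"
    using u u0 slit_nonzero[OF u(1) c0(1) u0] by auto
  have x: "fst ?z \<in> snd c0 ` (fst c0 \<inter> fst c)" using z by auto
  have "((\<lambda>z. ?\<tau> (fst z)) has_derivative (\<lambda>w. fd ?\<tau> (fst ?z) (fst w))) (at ?z)"
    by (rule smooth_on_compose_has_derivative[OF smooth_transition[OF c0(1) c]
          bounded_linear_imp_has_derivative[OF bounded_linear_fst] x])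
  moreover have "fd (snd c \<circ> fst \<circ> chart_inv (sl c0)) ?z = fd (\<lambda>z. ?\<tau> (fst z)) ?z"
  proof (rule fd_cong[OF open_slit_overlap[OF c0(1) c] z])
    fix y assume "y \<in> (snd c0 ` (fst c0 \<inter> fst c)) \<times> (- {0 :: 'e})"
    then have "fst y \<in> chart_image c0" "snd y \<noteq> 0" by auto
    then show "(snd c \<circ> fst \<circ> chart_inv (sl c0)) y = ?\<tau> (fst y)"
      using chart_inv_slit[OF c0(1), of "fst y" "snd y"] by simp
  qed
  ultimately have "fd (snd c \<circ> fst \<circ> chart_inv (sl c0)) ?z = (\<lambda>w. fd ?\<tau> (fst ?z) (fst w))"
    by (simp only: fd_eqI)
  then show ?thesis
    unfolding rho_def tangent_map_def Let_def c0(2)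
    using svec_transition[OF a c0(1) c u(1) u0 u(2)] c u(2) by simp
qed

lemma rho_outside: "\<not> (c \<in> \<A> \<and> fst u \<in> fst c) \<Longrightarrow> rho \<A> u a c = 0"
  unfolding rho_def tangent_map_def by (simp only: if_False)

lemma rho_tangent:
  assumes a: "a \<in> slit_tangent u" and u: "u \<in> slit_bundle \<A>"
  shows "rho \<A> u a \<in> tangent_space \<A> (fst u)"
proof (rule tangent_spaceI)
  fix c
  show "rho \<A> u a c' = transition_deriv c c' (fst u) (rho \<A> u a c)"
    if "c \<in> \<A>" "c' \<in> \<A>" "fst u \<in> fst c" "fst u \<in> fst c'" for c'
    using rho_apply[OF a u that(3,1)] rho_apply[OF a u that(4,2)] svec_transition[OF a that(1,2) u that(3,4)]
    by simp
qed (rule rho_outside)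

lemma gam_apply:
  assumes "u \<in> slit_bundle \<A>" "c \<in> \<A>" "fst u \<in> fst c"
  shows "gam \<A> u v (sl c) = (0, v c)"
proof -
  have u0: "(fst u, snd u + tscale 0 v) = u"
    by (auto simp: prod_eq_iff tscale_def)
  have "((\<lambda>t. (snd c (fst u), snd u c + t *\<^sub>R v c)) has_vector_derivative (0, v c)) (at 0)"
    by (auto intro!: derivative_eq_intros has_vector_derivative_Pair)
  then have "vector_derivative (\<lambda>t. (snd c (fst u), snd u c + t *\<^sub>R v c)) (at 0) = (0, v c)"
    by (rule vector_derivative_at)
  then show ?thesis
    using assms by (simp add: gam_def velocity_def u0 in_slit_chart_iff) (simp add: tscale_def)
qed

lemma gam_outside:
  assumes "\<not> (s \<in> slit_atlas \<A> \<and> u \<in> fst s)"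
  shows "gam \<A> u v s = 0"
proof -
  have u0: "(fst u, snd u + tscale 0 v) = u"
    by (auto simp: prod_eq_iff tscale_def)
  show ?thesis unfolding gam_def velocity_def u0 using assms by (simp only: if_False)
qed

lemma gam_tangent:
  assumes v: "v \<in> tangent_space \<A> (fst u)" and u: "u \<in> slit_bundle \<A>"
  shows "gam \<A> u v \<in> slit_tangent u"
proof (rule slit.tangent_spaceI)
  fix s s' assume s: "s \<in> slit_atlas \<A>" "s' \<in> slit_atlas \<A>" "u \<in> fst s" "u \<in> fst s'"
  obtain c where c: "c \<in> \<A>" "s = sl c" using s(1) by (rule slit_atlasE)
  obtain c' where c': "c' \<in> \<A>" "s' = sl c'" using s(2) by (rule slit_atlasE)
  have uc: "fst u \<in> fst c" "fst u \<in> fst c'" using s(3,4) unfolding c(2) c'(2) by (simp_all add: in_slit_chart_iff)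
  have l0: "fd (\<lambda>x. fd (snd c' \<circ> chart_inv c) x (snd u c)) (snd c (fst u)) 0 = 0"
    by (rule linear_0, rule smooth_on_linear_fd[OF smooth_on_fd[OF smooth_transition[OF c(1) c'(1)]]]) (use uc in simp)
  show "gam \<A> u v s' = slit.transition_deriv s s' u (gam \<A> u v s)"
    unfolding c(2) c'(2) gam_apply[OF u c(1) uc(1)] gam_apply[OF u c'(1) uc(2)]
      slit_transition_deriv[OF c(1) c'(1) u uc] l0
    using tangent_spaceD[OF v c(1) c'(1) uc] linear_0[OF linear_transition_deriv[OF c(1) c'(1) uc]] by simp
qed (rule gam_outside)

lemma rho_gam:
  assumes v: "v \<in> tangent_space \<A> (fst u)" and u: "u \<in> slit_bundle \<A>"
  shows "rho \<A> u (gam \<A> u v) = 0"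
proof -
  obtain c where c: "c \<in> \<A>" "fst u \<in> fst c" using u by (rule slit_chart_exists)
  show ?thesis
    by (rule tangent_eqI[OF rho_tangent[OF gam_tangent[OF v u] u] tangent_space_0 c])
      (simp add: rho_apply[OF gam_tangent[OF v u] u c(2,1)] gam_apply[OF u c])
qed

section \<open>Smooth \<pi>-vector fields and the lifts of fields\<close>

abbreviation ploc :: "('m, 'e) chart \<Rightarrow> ('m, 'e) pifield \<Rightarrow> 'e \<times> 'e \<Rightarrow> 'e" where
  "ploc c X \<equiv> \<lambda>z. X (chart_inv (sl c) z) c"

lemma pi_tangent: "\<lbrakk>X \<in> pi_fields \<A>; u \<in> slit_bundle \<A>\<rbrakk> \<Longrightarrow> X u \<in> tangent_space \<A> (fst u)"
  by (simp add: pi_fields_def)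

lemma pi_zero: "\<lbrakk>X \<in> pi_fields \<A>; u \<notin> slit_bundle \<A>\<rbrakk> \<Longrightarrow> X u = 0"
  by (simp add: pi_fields_def del: split_paired_All)

lemma pi_smooth: "\<lbrakk>X \<in> pi_fields \<A>; c \<in> \<A>\<rbrakk> \<Longrightarrow> smooth_on (ploc c X) (chart_image (sl c))"
  by (simp add: pi_fields_def del: split_paired_All)

lemma open_slit_image: "c \<in> \<A> \<Longrightarrow> open (chart_image (sl c))"
  by (rule slit.open_chart_image) simp

lemma pi_fieldsI:
  assumes "\<And>u. u \<in> slit_bundle \<A> \<Longrightarrow> X u \<in> tangent_space \<A> (fst u)"
    and "\<And>u. u \<notin> slit_bundle \<A> \<Longrightarrow> X u = 0"
    and "\<And>c. c \<in> \<A> \<Longrightarrow> smooth_on (ploc c X) (chart_image (sl c))"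
  shows "X \<in> pi_fields \<A>"
  unfolding pi_fields_def mem_Collect_eq using assms by blast

lemma slit_vfI:
  assumes "\<And>u. u \<in> slit_bundle \<A> \<Longrightarrow> A u \<in> slit_tangent u"
    and "\<And>u. u \<notin> slit_bundle \<A> \<Longrightarrow> A u = 0"
    and "\<And>c. c \<in> \<A> \<Longrightarrow> smooth_on (slit.loc (sl c) A) (chart_image (sl c))"
  shows "A \<in> slit_fields"
  unfolding vector_fields_def mem_Collect_eq carrier_slit
  using assms slit_atlasE by metis

lemma pi_eqI:
  assumes "X \<in> pi_fields \<A>" "Y \<in> pi_fields \<A>" "\<And>u. u \<in> slit_bundle \<A> \<Longrightarrow> X u = Y u"
  shows "X = Y"
proof
  fix u show "X u = Y u"
    using assms(3) pi_zero[OF assms(1)] pi_zero[OF assms(2)] by (cases "u \<in> slit_bundle \<A>") auto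
qed

lemma pi_0 [simp]: "0 \<in> pi_fields \<A>"
  by (rule pi_fieldsI) simp_all

lemma pi_add [simp]:
  assumes "X \<in> pi_fields \<A>" "Y \<in> pi_fields \<A>"
  shows "X + Y \<in> pi_fields \<A>"
proof (rule pi_fieldsI)
  show "smooth_on (ploc c (X + Y)) (chart_image (sl c))" if "c \<in> \<A>" for c
    using smooth_on_add[OF pi_smooth[OF assms(1) that] pi_smooth[OF assms(2) that] open_slit_image[OF that]] by simp
  show "(X + Y) u = 0" if "u \<notin> slit_bundle \<A>" for u
    using assms[THEN pi_zero, OF that] by simp
qed (simp add: pi_tangent assms)

lemma pi_minus [simp]:
  assumes "X \<in> pi_fields \<A>"
  shows "- X \<in> pi_fields \<A>"
proof (rule pi_fieldsI)
  show "smooth_on (ploc c (- X)) (chart_image (sl c))" if "c \<in> \<A>" for c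
    using smooth_on_minus[OF pi_smooth[OF assms(1) that] open_slit_image[OF that]] by simp
  show "(- X) u = 0" if "u \<notin> slit_bundle \<A>" for u
    using assms[THEN pi_zero, OF that] by simp
qed (simp add: pi_tangent assms)

lemma chart_inv_slit_in:
  assumes "c \<in> \<A>" "z \<in> chart_image (sl c)"
  shows "chart_inv (sl c) z \<in> slit_bundle \<A>" "fst (chart_inv (sl c) z) \<in> fst c"
    "snd c (fst (chart_inv (sl c) z)) = fst z" "snd (chart_inv (sl c) z) c = snd z"
proof -
  have 1: "chart_inv (sl c) z \<in> fst (sl c)"
    using assms slit.chart_inv_in[of "sl c" z] by simp
  then show "chart_inv (sl c) z \<in> slit_bundle \<A>" "fst (chart_inv (sl c) z) \<in> fst c"
    by (simp_all add: in_slit_chart_iff)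
  have "snd (sl c) (chart_inv (sl c) z) = z"
    using assms slit.chart_chart_inv[of "sl c" z] by (simp del: snd_slit_chart)
  then show "snd c (fst (chart_inv (sl c) z)) = fst z" "snd (chart_inv (sl c) z) c = snd z"
    unfolding snd_slit_chart by (metis fst_conv, metis snd_conv)
qed

lemma eta_pi [simp]: "eta \<A> \<in> pi_fields \<A>"
proof (rule pi_fieldsI)
  fix c assume c: "c \<in> \<A>"
  have "smooth_on snd (chart_image (sl c))"
    by (rule smooth_on_subset[OF smooth_on_id_linear[OF linear_snd] subset_UNIV])
  then show "smooth_on (ploc c (eta \<A>)) (chart_image (sl c))"
    by (rule smooth_on_cong[OF open_slit_image[OF c], rotated]) (simp add: eta_def chart_inv_slit_in[OF c])
qed (simp_all add: eta_def slit_bundle_tangent)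

lemma rho_field_apply:
  assumes "A \<in> slit_fields" "c \<in> \<A>" "u \<in> slit_bundle \<A>" "fst u \<in> fst c"
  shows "rho_field \<A> A u c = fst (A u (sl c))"
  using assms by (simp add: rho_field_def on_fields_def rho_apply slit.vf_tangent)

lemma rho_field_pi [simp]:
  assumes A: "A \<in> slit_fields"
  shows "rho_field \<A> A \<in> pi_fields \<A>"
proof (rule pi_fieldsI)
  fix c assume c: "c \<in> \<A>"
  have "smooth_on (\<lambda>z. fst (slit.loc (sl c) A z)) (chart_image (sl c))"
    by (rule smooth_on_fst[OF slit.vf_smooth[OF A sl_in[OF c]] open_slit_image[OF c]])
  then show "smooth_on (ploc c (rho_field \<A> A)) (chart_image (sl c))"
    by (rule smooth_on_cong[OF open_slit_image[OF c], rotated])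
      (simp add: rho_field_apply A c chart_inv_slit_in[OF c])
qed (simp_all add: rho_field_def on_fields_def rho_tangent slit.vf_tangent A)

lemma gam_field_apply:
  assumes "c \<in> \<A>" "u \<in> slit_bundle \<A>" "fst u \<in> fst c"
  shows "gam_field \<A> X u (sl c) = (0, X u c)"
  using assms by (simp add: gam_field_def on_fields_def gam_apply)

lemma gam_field_vf [simp]:
  assumes X: "X \<in> pi_fields \<A>"
  shows "gam_field \<A> X \<in> slit_fields"
proof (rule slit_vfI)
  fix c assume c: "c \<in> \<A>"
  have "smooth_on (\<lambda>z. (0, ploc c X z)) (chart_image (sl c))"
    by (rule smooth_on_Pair[OF smooth_on_const pi_smooth[OF X c] open_slit_image[OF c]])
  then show "smooth_on (slit.loc (sl c) (gam_field \<A> X)) (chart_image (sl c))"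
    by (rule smooth_on_cong[OF open_slit_image[OF c], rotated])
      (simp add: gam_field_apply c chart_inv_slit_in[OF c])
qed (simp_all add: gam_field_def on_fields_def gam_tangent pi_tangent X)

lemma rho_field_add:
  assumes "A \<in> slit_fields" "B \<in> slit_fields"
  shows "rho_field \<A> (A + B) = rho_field \<A> A + rho_field \<A> B"
proof (rule pi_eqI)
  fix u assume u: "u \<in> slit_bundle \<A>"
  then obtain c where c: "c \<in> \<A>" "fst u \<in> fst c" by (rule slit_chart_exists)
  show "rho_field \<A> (A + B) u = (rho_field \<A> A + rho_field \<A> B) u"
    by (rule tangent_eqI[OF _ _ c]) (simp_all add: pi_tangent u assms rho_field_apply c)
qed (simp_all add: assms)

lemma gam_field_add:
  assumes "X \<in> pi_fields \<A>" "Y \<in> pi_fields \<A>"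
  shows "gam_field \<A> (X + Y) = gam_field \<A> X + gam_field \<A> Y"
proof (rule slit.vf_eqI)
  fix s u assume su: "s \<in> slit_atlas \<A>" "u \<in> fst s"
  obtain c where c: "c \<in> \<A>" "s = sl c" using su(1) by (rule slit_atlasE)
  show "gam_field \<A> (X + Y) u s = (gam_field \<A> X + gam_field \<A> Y) u s"
    using su c by (simp add: in_slit_chart_iff gam_field_apply)
qed (simp_all add: assms)

lemma rho_gam_field:
  assumes "X \<in> pi_fields \<A>"
  shows "rho_field \<A> (gam_field \<A> X) = 0"
proof
  show "rho_field \<A> (gam_field \<A> X) u = 0 u" for u
    using assms by (simp add: rho_field_def gam_field_def on_fields_def rho_gam pi_tangent)
qed

text \<open>A vertical field has first component 0 in every slit chart, so only the fibre derivative
  of the first component of \<open>B\<close> survives in the bracket. It depends on \<open>B\<close>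
  through \<rho> B alone; for B = \<beta> Y it is therefore independent of the connection.\<close>

lemma rho_bracket_gam:
  assumes X: "X \<in> pi_fields \<A>" and B: "B \<in> slit_fields"
    and u: "u \<in> slit_bundle \<A>" and c: "c \<in> \<A>" "fst u \<in> fst c"
  shows "rho_field \<A> (slit_bracket (gam_field \<A> X) B) u c
    = fd (ploc c (rho_field \<A> B)) (snd (sl c) u) (0, X u c)"
proof -
  have us: "u \<in> fst (sl c)" using u c by (simp add: in_slit_chart_iff)
  have z: "snd (sl c) u \<in> chart_image (sl c)" using us by (rule slit.chart_in_image)
  have 1: "fst (fd (slit.loc (sl c) A) (snd (sl c) u) v) = fd (ploc c (rho_field \<A> A)) (snd (sl c) u) v"
    if A: "A \<in> slit_fields" for A v
  proof -
    have "((\<lambda>z. fst (slit.loc (sl c) A z)) has_derivative (\<lambda>v. fst (fd (slit.loc (sl c) A) (snd (sl c) u) v)))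
        (at (snd (sl c) u))"
      by (rule bounded_linear.has_derivative[OF bounded_linear_fst slit.loc_has_derivative[OF A sl_in[OF c(1)] z]])
    moreover have "fd (ploc c (rho_field \<A> A)) (snd (sl c) u) = fd (\<lambda>z. fst (slit.loc (sl c) A z)) (snd (sl c) u)"
      by (rule fd_cong[OF open_slit_image[OF c(1)] z]) (simp add: rho_field_apply A c chart_inv_slit_in[OF c(1)])
    ultimately show ?thesis by (simp only: fd_eqI)
  qed
  have "fd (ploc c (rho_field \<A> (gam_field \<A> X))) (snd (sl c) u) = (\<lambda>v. 0)"
    by (simp add: rho_gam_field X)
  then show ?thesis
    using c u X B
    by (simp add: rho_field_apply slit.lie_bracket_chart[OF sl_in[OF c(1)] us] 1 gam_field_apply del: snd_slit_chart)
qed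

lemma rho_bracket_gam_gam:
  assumes X: "X \<in> pi_fields \<A>" and Y: "Y \<in> pi_fields \<A>"
  shows "rho_field \<A> (slit_bracket (gam_field \<A> X) (gam_field \<A> Y)) = 0"
proof (rule pi_eqI)
  fix u assume u: "u \<in> slit_bundle \<A>"
  then obtain c where c: "c \<in> \<A>" "fst u \<in> fst c" by (rule slit_chart_exists)
  show "rho_field \<A> (slit_bracket (gam_field \<A> X) (gam_field \<A> Y)) u = 0 u"
    by (rule tangent_eqI[OF _ _ c])
      (simp_all add: pi_tangent u X Y rho_bracket_gam[OF X _ u c] rho_gam_field)
qed (simp_all add: X Y)

end

section \<open>Smoothness of the horizontal map\<close>

locale hausdorff_atlas = base_atlas \<A> for \<A> :: "('m, 'e::euclidean_space) chart set" +
  fixes X\<^sub>M :: "'m topology"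
  assumes hausdorff: "Hausdorff_space X\<^sub>M" and smooth_atlas: "smooth_atlas X\<^sub>M \<A>"
begin

lemma chart_homeomorphic:
  "c \<in> \<A> \<Longrightarrow> homeomorphic_map (subtopology X\<^sub>M (fst c)) (top_of_set (chart_image c)) (snd c)"
  using smooth_atlas by (simp add: smooth_atlas_def)

lemma openin_chart_domain: "c \<in> \<A> \<Longrightarrow> openin X\<^sub>M (fst c)"
  using smooth_atlas by (simp add: smooth_atlas_def)

lemma open_chart_part:
  assumes "c \<in> \<A>" "openin X\<^sub>M U"
  shows "open (snd c ` (fst c \<inter> U))"
proof -
  have "openin (subtopology X\<^sub>M (fst c)) (fst c \<inter> U)"
    using assms by (simp add: openin_subtopology_Int2)
  then have "openin (top_of_set (chart_image c)) (snd c ` (fst c \<inter> U))"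
    using homeomorphic_imp_open_map[OF chart_homeomorphic[OF assms(1)]] by (simp add: open_map_def)
  then show ?thesis
    using open_chart_image[OF assms(1)] openin_open_trans by blast
qed

text \<open>A field cut off inside a chart vanishes outside such a set. Since the set is closed in
  the whole manifold, the extension by 0 is smooth at points outside the chart.\<close>

lemma closedin_chart_inv_compact:
  assumes c: "c \<in> \<A>" and K: "compact K" "K \<subseteq> chart_image c"
  shows "closedin X\<^sub>M (chart_inv c ` K)"
proof -
  obtain g where g: "homeomorphic_maps (subtopology X\<^sub>M (fst c)) (top_of_set (chart_image c)) (snd c) g"
    using chart_homeomorphic[OF c] by (auto simp: homeomorphic_map_maps)
  then have gc: "continuous_map (top_of_set (chart_image c)) (subtopology X\<^sub>M (fst c)) g"
    and gi: "\<And>x. x \<in> chart_image c \<Longrightarrow> snd c (g x) = x"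
    by (auto simp: homeomorphic_maps_def)
  have "g x = chart_inv c x" if "x \<in> chart_image c" for x
  proof -
    have "g x \<in> fst c"
      using continuous_map_image_subset_topspace[OF gc] that by auto
    then show ?thesis
      using chart_inv_chart[OF c] gi[OF that] by metis
  qed
  then have eq: "chart_inv c ` K = g ` K"
    using K(2) by (intro image_cong) auto
  have "compactin (top_of_set (chart_image c)) K"
    using K by (simp add: compactin_subtopology)
  from image_compactin[OF this gc] have "compactin X\<^sub>M (g ` K)"
    by (simp add: compactin_subtopology)
  then show ?thesis
    unfolding eq by (rule compactin_imp_closedin[OF hausdorff])
qed

text \<open>A bump function on the base suffices to extend a coordinate field of a slit chart.\<close>
lemma extend_coordinate_field:
  fixes w :: "'e \<times> 'e"
  assumes c: "c \<in> \<A>" and x0: "x0 \<in> chart_image c"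
  obtains \<phi> :: "'e \<Rightarrow> real" and r A where "r > 0" "smooth_on \<phi> UNIV" "ball x0 r \<subseteq> chart_image c"
    "\<And>y. y \<in> ball x0 r \<Longrightarrow> \<phi> y \<noteq> 0" "A \<in> slit_fields"
    "\<And>u. u \<in> slit_bundle \<A> \<Longrightarrow> fst u \<in> fst c \<Longrightarrow>
       A u = slit.tvec_of (sl c) u (\<phi> (snd c (fst u)) *\<^sub>R w)"
proof -
  obtain \<phi> :: "'e \<Rightarrow> real" and r where r: "r > 0" and \<phi>: "smooth_on \<phi> UNIV" and cb: "cball x0 r \<subseteq> chart_image c"
    and \<phi>0: "\<And>y. y \<notin> ball x0 r \<Longrightarrow> \<phi> y = 0" and \<phi>1: "\<And>y. y \<in> ball x0 r \<Longrightarrow> \<phi> y \<noteq> 0"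
    by (rule bump_exists[OF open_chart_image[OF c] x0]) (rule that)
  define K where "K = chart_inv c ` cball x0 r"
  have K: "openin X\<^sub>M (topspace X\<^sub>M - K)"
    unfolding K_def using closedin_chart_inv_compact[OF c compact_cball cb] by blast
  have KD: "p \<in> K" if "p \<in> fst c" "\<phi> (snd c p) \<noteq> 0" for p
  proof -
    have "snd c p \<in> cball x0 r"
      using \<phi>0 that(2) ball_subset_cball by blast
    then show ?thesis
      unfolding K_def using chart_inv_chart[OF c that(1)] by (metis imageI)
  qed
  have K_dom: "K \<subseteq> fst c"
    unfolding K_def using cb chart_inv_in[OF c] by blast
  define A where "A u = (if u \<in> fst (sl c) then slit.tvec_of (sl c) u (\<phi> (snd c (fst u)) *\<^sub>R w) else 0)" for u
  have tvec0: "slit.tvec_of (sl c) u 0 = 0" if "u \<in> fst (sl c)" for u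
    by (rule slit.tangent_eqI[OF slit.tvec_of_in[OF sl_in[OF c] that] slit.tangent_space_0 sl_in[OF c] that])
      (simp add: that c del: snd_slit_chart)
  have "A \<in> slit_fields"
  proof (rule slit_vfI)
    fix u
    show "A u \<in> slit_tangent u"
      using slit.tvec_of_in[OF sl_in[OF c]] by (simp add: A_def)
    show "A u = 0" if "u \<notin> slit_bundle \<A>"
    proof -
      have "u \<notin> fst (sl c)" using that by (simp add: in_slit_chart_iff)
      then show ?thesis by (simp only: A_def if_False)
    qed
  next
    fix c' assume c': "c' \<in> \<A>"
    let ?S = "snd (sl c') ` (fst (sl c') \<inter> fst (sl c))" and ?\<sigma> = "snd (sl c) \<circ> chart_inv (sl c')"
    let ?T = "snd (sl c) ` (fst (sl c) \<inter> fst (sl c'))" and ?\<tau> = "snd (sl c') \<circ> chart_inv (sl c)"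
    show "smooth_on (slit.loc (sl c') A) (chart_image (sl c'))"
    proof (rule smooth_on_local)
      fix z assume z: "z \<in> chart_image (sl c')"
      let ?u = "chart_inv (sl c') z"
      have u: "?u \<in> slit_bundle \<A>" "fst ?u \<in> fst c'" using chart_inv_slit_in[OF c' z] by auto
      \<comment> \<open>Over the chart \<open>c\<close> the field is a transition derivative applied
        to smooth coordinates. Elsewhere the base point lies outside the closed set
        \<open>K\<close>, and over the complement of \<open>K\<close> the field is 0.\<close>
      show "\<exists>U. open U \<and> z \<in> U \<and> smooth_on (slit.loc (sl c') A) U"
      proof (cases "fst ?u \<in> fst c")
        case True
        have oS: "open ?S" and oT: "open ?T" by (rule slit.open_overlap[OF sl_in[OF c'] sl_in[OF c]],
           rule slit.open_overlap[OF sl_in[OF c] sl_in[OF c']])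
        have sm\<sigma>: "smooth_on ?\<sigma> ?S" and sm\<tau>: "smooth_on ?\<tau> ?T"
          by (rule slit.smooth_transition[OF sl_in[OF c'] sl_in[OF c]],
              rule slit.smooth_transition[OF sl_in[OF c] sl_in[OF c']])
        have im: "?\<sigma> ` ?S \<subseteq> ?T"
        proof
          fix t assume "t \<in> ?\<sigma> ` ?S"
          then obtain v where v: "v \<in> fst (sl c')" "v \<in> fst (sl c)" "t = ?\<sigma> (snd (sl c') v)" by blast
          then have "t = snd (sl c) v"
            using slit.chart_inv_chart[OF sl_in[OF c'] v(1)] by (simp only: comp_apply)
          with v(1,2) show "t \<in> ?T" by blast
        qed
        have "smooth_on (\<lambda>y. \<phi> (fst (?\<sigma> y)) *\<^sub>R w) ?S"
          by (rule smooth_on_scaleR[OF smooth_on_compose[OF \<phi> smooth_on_fst[OF sm\<sigma> oS] subset_UNIV oS open_UNIV]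
                smooth_on_const oS])
        from smooth_on_fd_apply[OF sm\<tau> sm\<sigma> this im oS oT]
        have "smooth_on (slit.loc (sl c') A) ?S"
        proof (rule smooth_on_cong[OF oS, rotated])
          fix y assume "y \<in> ?S"
          then obtain v where v: "v \<in> fst (sl c')" "v \<in> fst (sl c)" "y = snd (sl c') v" by blast
          have inv: "chart_inv (sl c') y = v"
            unfolding v(3) by (rule slit.chart_inv_chart[OF sl_in[OF c'] v(1)])
          show "fd ?\<tau> (?\<sigma> y) (\<phi> (fst (?\<sigma> y)) *\<^sub>R w) = A (chart_inv (sl c') y) (sl c')"
            unfolding comp_apply[of "snd (sl c)"] inv using v(1,2) c' by (simp add: A_def slit.tvec_of_def)
        qed
        moreover have "z \<in> ?S"
          using slit.in_overlap_iff[OF sl_in[OF c'], of z "sl c"] z u True by (simp add: in_slit_chart_iff)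
        ultimately show ?thesis using oS by blast
      next
        case False
        then have nK: "fst ?u \<notin> K" using K_dom by blast
        let ?U = "(snd c' ` (fst c' \<inter> (topspace X\<^sub>M - K))) \<times> (- {0 :: 'e})"
        have oU: "open ?U"
          by (intro open_Times open_chart_part[OF c' K]) auto
        have "fst ?u \<in> topspace X\<^sub>M"
          using u(2) openin_subset[OF openin_chart_domain[OF c']] by blast
        then have "snd c' (fst ?u) \<in> snd c' ` (fst c' \<inter> (topspace X\<^sub>M - K))"
          using u(2) nK by blast
        moreover have "snd ?u c' \<noteq> 0" by (rule slit_nonzero[OF u(1) c' u(2)])
        ultimately have "z \<in> ?U"
          unfolding mem_Times_iff chart_inv_slit_in(3,4)[OF c' z] by simp
        moreover have "smooth_on (slit.loc (sl c') A) ?U"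
        proof (rule smooth_on_cong[OF oU, of "\<lambda>_. 0"])
          fix y assume "y \<in> ?U"
          then have "fst y \<in> snd c' ` (fst c' \<inter> (topspace X\<^sub>M - K))" and y0: "snd y \<noteq> 0"
            by (simp_all only: mem_Times_iff Compl_iff singleton_iff simp_thms)
          then obtain p where p: "p \<in> fst c'" "p \<notin> K" "fst y = snd c' p" by blast
          have y: "y \<in> chart_image (sl c')"
            using p y0 c' by (simp add: slit_chart_image mem_Times_iff)
          let ?v = "chart_inv (sl c') y"
          have "fst ?v = p"
            using chart_inv_slit_in[OF c' y] p inj_on_chart[OF c'] by (auto simp: inj_on_def)
          then have "\<phi> (snd c (fst ?v)) = 0" if "?v \<in> fst (sl c)"
            using KD[of p] p that by (auto simp: in_slit_chart_iff)
          then show "0 = A ?v (sl c')"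
            using tvec0 by (simp add: A_def)
        qed simp
        ultimately show ?thesis using oU by blast
      qed
    qed
  qed
  moreover have "ball x0 r \<subseteq> chart_image c" using cb ball_subset_cball by blast
  moreover have "A u = slit.tvec_of (sl c) u (\<phi> (snd c (fst u)) *\<^sub>R w)" if "u \<in> slit_bundle \<A>" "fst u \<in> fst c" for u
    using that by (simp only: A_def in_slit_chart_iff simp_thms if_True)
  ultimately show ?thesis
    using that[OF r \<phi> _ \<phi>1] by blast
qed

end

section \<open>Local coefficients of the connection map of a regular connection\<close>

locale regular_pullback = hausdorff_atlas \<A> X\<^sub>M
  for \<A> :: "('m, 'e::euclidean_space) chart set" and X\<^sub>M +
  fixes D :: "('m, 'e) connection"
  assumes regular: "regular_connection \<A> D"
begin

lemma D_tangent:
  "\<lbrakk>u \<in> slit_bundle \<A>; a \<in> slit_tangent u; X \<in> pi_fields \<A>\<rbrakk> \<Longrightarrow> D u a X \<in> tangent_space \<A> (fst u)"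
  using regular unfolding regular_connection_def linear_connection_def by blast

lemma D_add:
  "\<lbrakk>u \<in> slit_bundle \<A>; a \<in> slit_tangent u; b \<in> slit_tangent u; X \<in> pi_fields \<A>\<rbrakk>
    \<Longrightarrow> D u (a + b) X = D u a X + D u b X"
  using regular unfolding regular_connection_def linear_connection_def by blast

lemma D_tscale:
  "\<lbrakk>u \<in> slit_bundle \<A>; a \<in> slit_tangent u; X \<in> pi_fields \<A>\<rbrakk>
    \<Longrightarrow> D u (tscale r a) X = tscale r (D u a X)"
  using regular unfolding regular_connection_def linear_connection_def by blast

lemma D_add_right:
  "\<lbrakk>u \<in> slit_bundle \<A>; a \<in> slit_tangent u; X \<in> pi_fields \<A>; Y \<in> pi_fields \<A>\<rbrakk>
    \<Longrightarrow> D u a (X + Y) = D u a X + D u a Y"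
  using regular unfolding regular_connection_def linear_connection_def by blast

lemma cov_pi [simp]:
  "\<lbrakk>A \<in> slit_fields; X \<in> pi_fields \<A>\<rbrakk> \<Longrightarrow> cov \<A> D A X \<in> pi_fields \<A>"
  using regular unfolding regular_connection_def linear_connection_def by blast

lemma cov_add_left:
  assumes "A \<in> slit_fields" "B \<in> slit_fields" "X \<in> pi_fields \<A>"
  shows "cov \<A> D (A + B) X = cov \<A> D A X + cov \<A> D B X"
  by (rule ext) (simp add: assms cov_def on_fields_def D_add slit.vf_tangent)

lemma cov_add_right:
  assumes "A \<in> slit_fields" "X \<in> pi_fields \<A>" "Y \<in> pi_fields \<A>"
  shows "cov \<A> D A (X + Y) = cov \<A> D A X + cov \<A> D A Y"
  by (rule ext) (simp add: assms cov_def on_fields_def D_add_right slit.vf_tangent)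

text \<open>K in slit coordinates. Its values on constant vectors are the coefficients of the linear
  system that defines \<beta>.\<close>

definition Kloc :: "('m, 'e) chart \<Rightarrow> 'e \<times> 'e \<Rightarrow> 'e \<times> 'e \<Rightarrow> 'e" where
  "Kloc c z w = D (chart_inv (sl c) z) (slit.tvec_of (sl c) (chart_inv (sl c) z) w) (eta \<A>) c"

lemma slit_tvec_of_linear:
  assumes "c \<in> \<A>" "u \<in> fst (sl c)"
  shows "slit.tvec_of (sl c) u (v + w) = slit.tvec_of (sl c) u v + slit.tvec_of (sl c) u w"
    and "slit.tvec_of (sl c) u (r *\<^sub>R w) = tscale r (slit.tvec_of (sl c) u w)"
proof -
  note t = slit.tvec_of_in[OF sl_in[OF assms(1)] assms(2)]
  note [simp] = slit.tvec_of_apply[OF sl_in[OF assms(1)] assms(2)]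
  show "slit.tvec_of (sl c) u (v + w) = slit.tvec_of (sl c) u v + slit.tvec_of (sl c) u w"
    by (rule slit.tangent_eqI[OF t slit.tangent_space_add[OF t t] sl_in[OF assms(1)] assms(2)]) simp
  show "slit.tvec_of (sl c) u (r *\<^sub>R w) = tscale r (slit.tvec_of (sl c) u w)"
    by (rule slit.tangent_eqI[OF t slit.tangent_space_tscale[OF t] sl_in[OF assms(1)] assms(2)])
      (simp add: tscale_def)
qed

lemma linear_Kloc:
  assumes c: "c \<in> \<A>" and z: "z \<in> chart_image (sl c)"
  shows "linear (Kloc c z)"
proof -
  let ?u = "chart_inv (sl c) z"
  have u: "?u \<in> fst (sl c)" using slit.chart_inv_in[OF sl_in[OF c] z] .
  have us: "?u \<in> slit_bundle \<A>" using chart_inv_slit_in[OF c z] by simp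
  note t = slit.tvec_of_in[OF sl_in[OF c] u]
  show ?thesis
    by (rule linearI)
      (simp_all add: Kloc_def slit_tvec_of_linear[OF c u] D_add[OF us t t eta_pi] D_tscale[OF us t eta_pi],
       simp add: tscale_def)
qed

text \<open>The constant coordinate field \<open>w\<close> becomes the restriction of a global field
  only after multiplication by a bump function, which is divided out again where it is
  nonzero.\<close>

lemma smooth_on_Kloc:
  assumes c: "c \<in> \<A>"
  shows "smooth_on (\<lambda>z. Kloc c z w) (chart_image (sl c))"
proof (rule smooth_on_local)
  fix z0 assume z0: "z0 \<in> chart_image (sl c)"
  then have x0: "fst z0 \<in> chart_image c" by (auto simp: slit_chart_image[OF c])
  obtain \<phi> :: "'e \<Rightarrow> real" and r A where r: "r > 0" "smooth_on \<phi> UNIV" "ball (fst z0) r \<subseteq> chart_image c"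
    "\<And>y. y \<in> ball (fst z0) r \<Longrightarrow> \<phi> y \<noteq> 0" and A: "A \<in> slit_fields"
    and Au: "\<And>u. u \<in> slit_bundle \<A> \<Longrightarrow> fst u \<in> fst c \<Longrightarrow> A u = slit.tvec_of (sl c) u (\<phi> (snd c (fst u)) *\<^sub>R w)"
    using extend_coordinate_field[OF c x0] by metis
  let ?U = "ball (fst z0) r \<times> (- {0 :: 'e})"
  have oU: "open ?U" by (intro open_Times) auto
  have U: "?U \<subseteq> chart_image (sl c)"
    using r(3) by (auto simp: slit_chart_image[OF c])
  have zU: "z0 \<in> ?U" using z0 r(1) by (auto simp: slit_chart_image[OF c] mem_Times_iff)
  have "smooth_on (\<lambda>z. Kloc c z w) ?U"
  \<comment> \<open>Division by the bump function, viewed as a linear system with \<phi> times the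
    identity as matrix.\<close>
  proof (rule smooth_on_linear_solve[where M = "\<lambda>z v. \<phi> (fst z) *\<^sub>R v" and w = "ploc c (cov \<A> D A (eta \<A>))", OF oU])
    show "linear (\<lambda>v. \<phi> (fst z) *\<^sub>R v)" for z :: "'e \<times> 'e"
      by (intro linearI) (simp_all add: algebra_simps)
    show "inj (\<lambda>v::'e. \<phi> (fst z) *\<^sub>R v)" if "z \<in> ?U" for z
      using r(4) that by (auto simp: inj_def mem_Times_iff)
    have "smooth_on (\<lambda>z. \<phi> (fst z)) ?U"
      by (rule smooth_on_compose[OF r(2) smooth_on_fst[OF smooth_on_ident oU] subset_UNIV oU open_UNIV])
    from smooth_on_scaleR[OF this smooth_on_const oU]
    show "smooth_on (\<lambda>z. \<phi> (fst z) *\<^sub>R b) ?U" for b :: 'e .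
    show "smooth_on (ploc c (cov \<A> D A (eta \<A>))) ?U"
      by (rule smooth_on_subset[OF pi_smooth[OF cov_pi[OF A eta_pi] c] U])
    fix z assume "z \<in> ?U"
    then have z: "z \<in> chart_image (sl c)" using U by blast
    note ci = chart_inv_slit_in[OF c z]
    have u: "chart_inv (sl c) z \<in> fst (sl c)" using ci by (simp add: in_slit_chart_iff)
    show "\<phi> (fst z) *\<^sub>R Kloc c z w = ploc c (cov \<A> D A (eta \<A>)) z"
      using ci by (simp add: cov_def on_fields_def Au slit_tvec_of_linear[OF c u]
          D_tscale[OF ci(1) slit.tvec_of_in[OF sl_in[OF c] u] eta_pi]) (simp add: tscale_def Kloc_def)
  qed
  then show "\<exists>U. open U \<and> z0 \<in> U \<and> smooth_on (\<lambda>z. Kloc c z w) U"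
    using oU zU by blast
qed

lemma rho_add:
  assumes a: "a \<in> slit_tangent u" and b: "b \<in> slit_tangent u" and u: "u \<in> slit_bundle \<A>"
  shows "rho \<A> u (a + b) = rho \<A> u a + rho \<A> u b"
proof -
  obtain c where c: "c \<in> \<A>" "fst u \<in> fst c" using u by (rule slit_chart_exists)
  show ?thesis
    by (rule tangent_eqI[OF rho_tangent[OF slit.tangent_space_add[OF a b] u]
          tangent_space_add[OF rho_tangent[OF a u] rho_tangent[OF b u]] c])
      (simp add: rho_apply[OF slit.tangent_space_add[OF a b] u c(2,1)] rho_apply[OF a u c(2,1)] rho_apply[OF b u c(2,1)])
qed

lemma vertical_horizontal_zero:
  assumes "u \<in> slit_bundle \<A>" "a \<in> slit_tangent u" "rho \<A> u a = 0" "D u a (eta \<A>) = 0"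
  shows "a = 0"
proof -
  have "a \<in> vertical_space \<A> u \<inter> horizontal_space \<A> D u"
    using assms by (simp add: vertical_space_def horizontal_space_def connection_map_def)
  then show ?thesis
    using regular assms(1) unfolding regular_connection_def by blast
qed

text \<open>On H the map \<rho> is injective because V and H meet only in 0, and onto because
  removing the vertical part of a lift does not change its image under \<rho>.\<close>

lemma horizontal_map:
  assumes u: "u \<in> slit_bundle \<A>" and v: "v \<in> tangent_space \<A> (fst u)"
  shows "horizontal_map \<A> D u v \<in> slit_tangent u"
    and "D u (horizontal_map \<A> D u v) (eta \<A>) = 0"
    and "rho \<A> u (horizontal_map \<A> D u v) = v"
proof -
  let ?H = "horizontal_space \<A> D u"
  have HD: "a \<in> slit_tangent u" "D u a (eta \<A>) = 0" if "a \<in> ?H" for a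
    using that by (simp_all add: horizontal_space_def connection_map_def)
  have inj: "inj_on (rho \<A> u) ?H"
  proof (rule inj_onI)
    fix a b assume a: "a \<in> ?H" and b: "b \<in> ?H" and eq: "rho \<A> u a = rho \<A> u b"
    note ta = HD(1)[OF a] and tb = HD(1)[OF b]
    note td = slit.tangent_space_diff[OF ta tb]
    have "D u ((a - b) + b) (eta \<A>) = D u (a - b) (eta \<A>) + D u b (eta \<A>)"
      by (rule D_add[OF u td tb eta_pi])
    moreover have "rho \<A> u ((a - b) + b) = rho \<A> u (a - b) + rho \<A> u b"
      by (rule rho_add[OF td tb u])
    ultimately have "a - b = 0"
      using vertical_horizontal_zero[OF u td] HD(2)[OF a] HD(2)[OF b] eq by simp
    then show "a = b" by simp
  qed
  obtain c where c: "c \<in> \<A>" "fst u \<in> fst c" using u by (rule slit_chart_exists)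
  have us: "u \<in> fst (sl c)" using u c by (simp add: in_slit_chart_iff)
  \<comment> \<open>Some lift of \<open>v\<close>; the second component 0 is an arbitrary
    choice.\<close>
  define a where "a = slit.tvec_of (sl c) u (v c, 0)"
  have a: "a \<in> slit_tangent u"
    unfolding a_def by (rule slit.tvec_of_in[OF sl_in[OF c(1)] us])
  have "rho \<A> u a = v"
    by (rule tangent_eqI[OF rho_tangent[OF a u] v c])
      (simp add: rho_apply[OF a u c(2,1)], simp add: a_def slit.tvec_of_apply[OF sl_in[OF c(1)] us])
  moreover obtain a1 a2 where a12: "a = a1 + a2" "a1 \<in> vertical_space \<A> u" "a2 \<in> ?H"
    using a regular u unfolding regular_connection_def by blast
  ultimately have "rho \<A> u a2 = v"
    using rho_add[of a1 u a2] HD(1)[OF a12(3)] u by (simp add: vertical_space_def)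
  then have v_in: "v \<in> rho \<A> u ` ?H" using a12(3) by blast
  have hm: "horizontal_map \<A> D u v \<in> ?H"
    unfolding horizontal_map_def by (rule the_inv_into_into[OF inj v_in]) simp
  show "horizontal_map \<A> D u v \<in> slit_tangent u" "D u (horizontal_map \<A> D u v) (eta \<A>) = 0"
    using HD[OF hm] by simp_all
  show "rho \<A> u (horizontal_map \<A> D u v) = v"
    unfolding horizontal_map_def by (rule f_the_inv_into_f[OF inj v_in])
qed

text \<open>A vertical vector on which K vanishes lies in V \<inter> H.\<close>

lemma inj_Kloc_vertical:
  assumes c: "c \<in> \<A>" and z: "z \<in> chart_image (sl c)"
  shows "inj (\<lambda>y. Kloc c z (0, y))"
proof -
  let ?u = "chart_inv (sl c) z"
  have u: "?u \<in> fst (sl c)" using slit.chart_inv_in[OF sl_in[OF c] z] .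
  have us: "?u \<in> slit_bundle \<A>" "fst ?u \<in> fst c" using chart_inv_slit_in[OF c z] by simp_all
  have lin: "linear (\<lambda>y. Kloc c z (0, y))"
    using linear_compose[OF _ linear_Kloc[OF c z], of "\<lambda>y. (0, y)"]
    by (simp add: comp_def) (auto intro!: linearI simp: linear_iff)
  have "y = 0" if "Kloc c z (0, y) = 0" for y
  proof -
    let ?a = "slit.tvec_of (sl c) ?u (0, y)"
    have a: "?a \<in> slit_tangent ?u"
      by (rule slit.tvec_of_in[OF sl_in[OF c] u])
    have ac: "?a (sl c) = (0, y)" by (rule slit.tvec_of_apply[OF sl_in[OF c] u])
    have "rho \<A> ?u ?a = 0"
      by (rule tangent_eqI[OF rho_tangent[OF a us(1)] tangent_space_0 c us(2)])
        (simp add: rho_apply[OF a us c] ac)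
    moreover have "D ?u ?a (eta \<A>) = 0"
      by (rule tangent_eqI[OF D_tangent[OF us(1) a eta_pi] tangent_space_0 c us(2)])
        (use that in \<open>simp add: Kloc_def\<close>)
    ultimately have "?a = 0" by (rule vertical_horizontal_zero[OF us(1) a])
    then show ?thesis using ac by (simp add: zero_prod_def)
  qed
  then show ?thesis
    using linear_injective_0[OF lin] by blast
qed

text \<open>The first component of \<beta> X in a slit chart is X. The condition K = 0 is then a
  linear system for the second component whose matrix is the restriction of K to vertical vectors,
  injective by regularity.\<close>

lemma beta_field_vf [simp]:
  assumes X: "X \<in> pi_fields \<A>"
  shows "beta_field \<A> D X \<in> slit_fields"
proof (rule slit_vfI)
  fix u assume "u \<in> slit_bundle \<A>"
  then show "beta_field \<A> D X u \<in> slit_tangent u"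
    by (simp add: beta_field_def on_fields_def horizontal_map pi_tangent X)
next
  fix c assume c: "c \<in> \<A>"
  let ?S = "chart_image (sl c)" and ?B = "slit.loc (sl c) (beta_field \<A> D X)"
  have S: "open ?S" by (rule open_slit_image[OF c])
  have B: "fst (?B z) = ploc c X z" "Kloc c z (?B z) = 0" if z: "z \<in> ?S" for z
  proof -
    let ?u = "chart_inv (sl c) z"
    note u = chart_inv_slit_in[OF c z]
    have us: "?u \<in> fst (sl c)" using u by (simp add: in_slit_chart_iff)
    note hm = horizontal_map[OF u(1) pi_tangent[OF X u(1)]]
    have b: "beta_field \<A> D X ?u = horizontal_map \<A> D ?u (X ?u)"
      using u by (simp add: beta_field_def on_fields_def)
    show "fst (?B z) = ploc c X z"
      using rho_apply[OF hm(1) u(1,2) c] hm(3) by (simp add: b)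
    show "Kloc c z (?B z) = 0"
      using hm(2) slit.tvec_of_eq[OF hm(1) sl_in[OF c] us] by (simp add: Kloc_def b)
  qed
  have lin0: "linear (\<lambda>y. (0::'e, y::'e))" "linear (\<lambda>x. (x::'e, 0::'e))"
    by (auto intro!: linearI)
  have "smooth_on (\<lambda>z. snd (?B z)) ?S"
  proof (rule smooth_on_linear_solve[where M = "\<lambda>z y. Kloc c z (0, y)" and w = "\<lambda>z. - Kloc c z (ploc c X z, 0)", OF S])
    show "linear (\<lambda>y. Kloc c z (0, y))" if "z \<in> ?S" for z
      using linear_compose[OF lin0(1) linear_Kloc[OF c that]] by (simp add: comp_def)
    show "inj (\<lambda>y. Kloc c z (0, y))" if "z \<in> ?S" for z
      by (rule inj_Kloc_vertical[OF c that])
    show "smooth_on (\<lambda>z. Kloc c z (0, b)) ?S" for b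
      by (rule smooth_on_Kloc[OF c])
    have "smooth_on (\<lambda>z. \<Sum>b\<in>Basis. (ploc c X z \<bullet> b) *\<^sub>R Kloc c z (b, 0)) ?S"
      by (rule smooth_on_sum[OF smooth_on_scaleR[OF smooth_on_bounded_linear[OF pi_smooth[OF X c] bounded_linear_inner_left S]
              smooth_on_Kloc[OF c] S] S])
    then have "smooth_on (\<lambda>z. Kloc c z (ploc c X z, 0)) ?S"
    proof (rule smooth_on_cong[OF S, rotated])
      fix z assume z: "z \<in> ?S"
      show "(\<Sum>b\<in>Basis. (ploc c X z \<bullet> b) *\<^sub>R Kloc c z (b, 0)) = Kloc c z (ploc c X z, 0)"
        using linear_sum_Basis[OF linear_compose[OF lin0(2) linear_Kloc[OF c z]], of "ploc c X z"] by (simp add: comp_def)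
    qed
    then show "smooth_on (\<lambda>z. - Kloc c z (ploc c X z, 0)) ?S"
      by (rule smooth_on_minus[OF _ S])
    fix z assume z: "z \<in> ?S"
    have "?B z = (ploc c X z, 0) + (0, snd (?B z))"
      using B(1)[OF z] by (simp add: prod_eq_iff)
    then have "Kloc c z (?B z) = Kloc c z (ploc c X z, 0) + Kloc c z (0, snd (?B z))"
      using linear_add[OF linear_Kloc[OF c z]] by metis
    then show "Kloc c z (0, snd (?B z)) = - Kloc c z (ploc c X z, 0)"
      using B(2)[OF z] by (simp add: eq_neg_iff_add_eq_0 add.commute)
  qed
  from smooth_on_Pair[OF pi_smooth[OF X c] this S]
  show "smooth_on ?B ?S"
    by (rule smooth_on_cong[OF S, rotated]) (use B(1) in \<open>simp add: prod_eq_iff\<close>)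
qed (simp add: beta_field_def on_fields_def)

end

section \<open>Homogeneity of the energy and the fibre derivatives of the metric\<close>

text \<open>Agreement of \<open>h\<close> and \<open>f\<close> is asked only while the line stays in
  \<open>S\<close>: a line in a fibre may run into the zero vector, which no slit chart
  covers.\<close>

lemma deriv_along_line:
  fixes f :: "'a::euclidean_space \<Rightarrow> real"
  assumes f: "smooth_on f S" and S: "open S" "x \<in> S"
    and h: "\<And>t. x + t *\<^sub>R v \<in> S \<Longrightarrow> h t = f (x + t *\<^sub>R v)"
  shows "deriv h 0 = fd f x v"
proof -
  have op: "open ((\<lambda>t. x + t *\<^sub>R v) -` S)"
    by (rule continuous_open_vimage[OF S(1)]) (intro continuous_intros)
  have "((\<lambda>t. f (x + t *\<^sub>R v)) has_real_derivative fd f (x + 0 *\<^sub>R v) v) (at 0)"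
    unfolding has_real_derivative_iff_has_vector_derivative
    by (rule smooth_on_line_derivative[OF f]) (simp add: S)
  then have "((\<lambda>t. f (x + t *\<^sub>R v)) has_real_derivative fd f x v) (at 0)" by simp
  then have "(h has_real_derivative fd f x v) (at 0)"
    by (rule has_field_derivative_transform_within_open[OF _ op]) (simp_all add: S h)
  then show ?thesis by (rule DERIV_imp_deriv)
qed

lemma smooth_on_second_derivative:
  assumes f: "smooth_on f S" and p: "smooth_on p S" and q: "smooth_on q S" and S: "open S"
  shows "smooth_on (\<lambda>z. fd (\<lambda>z'. fd f z' (q z)) z (p z)) S"
proof -
  have eq: "fd (\<lambda>z'. fd f z' w) z v = (\<Sum>b\<in>Basis. (w \<bullet> b) *\<^sub>R fd (\<lambda>z'. fd f z' b) z v)" if "z \<in> S" for z w v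
  proof -
    have "((\<lambda>z'. \<Sum>b\<in>Basis. (w \<bullet> b) *\<^sub>R fd f z' b) has_derivative
        (\<lambda>v. \<Sum>b\<in>Basis. (w \<bullet> b) *\<^sub>R fd (\<lambda>z'. fd f z' b) z v)) (at z)"
      by (intro has_derivative_sum has_derivative_scaleR_right smooth_on_has_derivative[OF smooth_on_fd[OF f] that])
    from has_derivative_transform_within_open[OF this S that linear_sum_Basis[OF smooth_on_linear_fd[OF f], symmetric]]
    have "((\<lambda>z'. fd f z' w) has_derivative (\<lambda>v. \<Sum>b\<in>Basis. (w \<bullet> b) *\<^sub>R fd (\<lambda>z'. fd f z' b) z v)) (at z)" .
    from fd_eqI[OF this] show ?thesis by simp
  qed
  have "smooth_on (\<lambda>z. \<Sum>b\<in>Basis. (q z \<bullet> b) *\<^sub>R fd (\<lambda>z'. fd f z' b) z (p z)) S"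
    by (rule smooth_on_sum[OF smooth_on_scaleR[OF smooth_on_bounded_linear[OF q bounded_linear_inner_left S]
          smooth_on_fd_apply[OF smooth_on_fd[OF f] smooth_on_ident p] S] S]) (use S in simp_all)
  then show ?thesis
    by (rule smooth_on_cong[OF S, rotated]) (rule eq[symmetric])
qed

locale finsler = hausdorff_atlas \<A> X\<^sub>M
  for \<A> :: "('m, 'e::euclidean_space) chart set" and X\<^sub>M +
  fixes L :: "('m, 'e) tpoint \<Rightarrow> real"
  assumes finsler: "finsler_manifold X\<^sub>M \<A> L"
begin

lemma L_homogeneous: "\<lbrakk>u \<in> slit_bundle \<A>; r > 0\<rbrakk> \<Longrightarrow> L (fst u, tscale r (snd u)) = r * L u"
  using finsler unfolding finsler_manifold_def slit_bundle_def by fastforce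

lemma finsler_metric_pos:
  "\<lbrakk>u \<in> slit_bundle \<A>; v \<in> tangent_space \<A> (fst u); v \<noteq> 0\<rbrakk> \<Longrightarrow> finsler_metric L u v v > 0"
  using finsler unfolding finsler_manifold_def by blast

abbreviation Eloc :: "('m, 'e) chart \<Rightarrow> 'e \<times> 'e \<Rightarrow> real" where
  "Eloc c \<equiv> energy L \<circ> chart_inv (sl c)"

lemma energy_smooth: "energy L \<in> smooth_functions (slit_atlas \<A>)"
  unfolding smooth_functions_def mem_Collect_eq
proof
  fix s assume s: "s \<in> slit_atlas \<A>"
  have "L \<in> smooth_functions (slit_atlas \<A>)"
    using finsler by (simp add: finsler_manifold_def)
  note l = slit.sf_smooth[OF this s]
  have "smooth_on (\<lambda>z. (L \<circ> chart_inv s) z * (L \<circ> chart_inv s) z * (1 / 2)) (chart_image s)"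
    by (rule smooth_on_bilinear[OF bounded_bilinear_mult smooth_on_bilinear[OF bounded_bilinear_mult l l]
          smooth_on_const]) (rule slit.open_chart_image[OF s])+
  then show "smooth_on (energy L \<circ> chart_inv s) (chart_image s)"
    by (rule smooth_on_cong[OF slit.open_chart_image[OF s], rotated])
      (simp add: energy_def power2_eq_square)
qed

lemma Eloc_smooth: "c \<in> \<A> \<Longrightarrow> smooth_on (Eloc c) (chart_image (sl c))"
  by (rule slit.sf_smooth[OF energy_smooth sl_in])

lemma slit_image_scale:
  "\<lbrakk>c \<in> \<A>; (x, y) \<in> chart_image (sl c); r > 0\<rbrakk> \<Longrightarrow> (x, r *\<^sub>R y) \<in> chart_image (sl c)"
  by (simp add: slit_chart_image)

lemma Eloc_homogeneous:
  assumes c: "c \<in> \<A>" and z: "(x, y) \<in> chart_image (sl c)" and r: "r > 0"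
  shows "Eloc c (x, r *\<^sub>R y) = r\<^sup>2 * Eloc c (x, y)"
proof -
  have xy: "x \<in> chart_image c" "y \<noteq> 0" using z by (simp_all add: slit_chart_image[OF c])
  let ?p = "chart_inv c x"
  have p: "?p \<in> fst c" using xy c by simp
  have u: "(?p, tvec_of c ?p y) \<in> slit_bundle \<A>"
    using slit_point_of(1)[OF c xy] by (simp add: in_slit_chart_iff)
  have "tvec_of c ?p (r *\<^sub>R y) = tscale r (tvec_of c ?p y)"
    by (rule tangent_eqI[OF tvec_of_in[OF c p] tangent_space_tscale[OF tvec_of_in[OF c p]] c p])
      (simp add: c p tscale_def)
  then show ?thesis
    using L_homogeneous[OF u r] r xy
    by (simp add: chart_inv_slit[OF c] energy_def power_mult_distrib)
qed

lemma Eloc_fd_homogeneous: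
  assumes c: "c \<in> \<A>" and z: "(x, y) \<in> chart_image (sl c)" and r: "r > 0"
  shows "fd (Eloc c) (x, r *\<^sub>R y) (0, w) = r * fd (Eloc c) (x, y) (0, w)"
proof -
  note zr = slit_image_scale[OF c z r]
  \<comment> \<open>The line through \<open>r y\<close> in direction \<open>r w\<close> is
    \<open>r\<close> times the line through \<open>y\<close> in direction \<open>w\<close>. Its
    derivative is taken once directly and once by homogeneity of degree 2.\<close>
  have 1: "deriv (\<lambda>t. Eloc c ((x, r *\<^sub>R y) + t *\<^sub>R (0, r *\<^sub>R w))) 0 = fd (Eloc c) (x, r *\<^sub>R y) (0, r *\<^sub>R w)"
    by (rule deriv_along_line[OF Eloc_smooth[OF c] open_slit_image[OF c] zr]) simp
  have S: "open (chart_image (sl c))" by (rule open_slit_image[OF c])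
  have sm: "smooth_on (\<lambda>z. r\<^sup>2 * Eloc c z) (chart_image (sl c))"
    by (rule smooth_on_bilinear[OF bounded_bilinear_mult smooth_on_const Eloc_smooth[OF c] S])
  have 2: "deriv (\<lambda>t. Eloc c ((x, r *\<^sub>R y) + t *\<^sub>R (0, r *\<^sub>R w))) 0 = fd (\<lambda>z. r\<^sup>2 * Eloc c z) (x, y) (0, w)"
  proof (rule deriv_along_line[OF sm S z])
    fix t assume "(x, y) + t *\<^sub>R (0, w) \<in> chart_image (sl c)"
    then have "(x, y + t *\<^sub>R w) \<in> chart_image (sl c)" by simp
    from Eloc_homogeneous[OF c this r]
    show "Eloc c ((x, r *\<^sub>R y) + t *\<^sub>R (0, r *\<^sub>R w)) = r\<^sup>2 * Eloc c ((x, y) + t *\<^sub>R (0, w))"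
      by (simp add: algebra_simps)
  qed
  have "fd (\<lambda>z. r\<^sup>2 * Eloc c z) (x, y) (0, w) = r\<^sup>2 * fd (Eloc c) (x, y) (0, w)"
    using fd_eqI[OF has_derivative_mult_right[OF smooth_on_has_derivative[OF Eloc_smooth[OF c] z], of "r\<^sup>2"]]
    by simp
  moreover have "fd (Eloc c) (x, r *\<^sub>R y) (0, r *\<^sub>R w) = r * fd (Eloc c) (x, r *\<^sub>R y) (0, w)"
    using linear_cmul[OF smooth_on_linear_fd[OF Eloc_smooth[OF c] zr], of r "(0, w)"] by simp
  ultimately have "r * fd (Eloc c) (x, r *\<^sub>R y) (0, w) = r * (r * fd (Eloc c) (x, y) (0, w))"
    using 1 2 by (simp add: power2_eq_square)
  then show ?thesis using r by simp
qed

text \<open>The metric coefficients g_ij in the chart \<open>c\<close>. The base coordinates are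
  held fixed, hence the first components 0.\<close>

definition Hloc :: "('m, 'e) chart \<Rightarrow> 'e \<times> 'e \<Rightarrow> 'e \<Rightarrow> 'e \<Rightarrow> real" where
  "Hloc c z v w = fd (\<lambda>z'. fd (Eloc c) z' (0, w)) z (0, v)"

text \<open>Each fibre derivative lowers the degree of the energy, which is 2, by one. Degree 0 of
  the metric is the source of T(\<eta>, X) = 0.\<close>

lemma Hloc_homogeneous:
  assumes c: "c \<in> \<A>" and z: "(x, y) \<in> chart_image (sl c)" and r: "r > 0"
  shows "Hloc c (x, r *\<^sub>R y) v w = Hloc c (x, y) v w"
proof -
  note zr = slit_image_scale[OF c z r]
  let ?F = "\<lambda>z'. fd (Eloc c) z' (0, w)"
  have S: "open (chart_image (sl c))" by (rule open_slit_image[OF c])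
  have F: "smooth_on ?F (chart_image (sl c))" by (rule smooth_on_fd[OF Eloc_smooth[OF c]])
  have 1: "deriv (\<lambda>t. ?F ((x, r *\<^sub>R y) + t *\<^sub>R (0, r *\<^sub>R v))) 0 = fd ?F (x, r *\<^sub>R y) (0, r *\<^sub>R v)"
    by (rule deriv_along_line[OF F S zr]) simp
  have sm: "smooth_on (\<lambda>z. r * ?F z) (chart_image (sl c))"
    by (rule smooth_on_bilinear[OF bounded_bilinear_mult smooth_on_const F S])
  have 2: "deriv (\<lambda>t. ?F ((x, r *\<^sub>R y) + t *\<^sub>R (0, r *\<^sub>R v))) 0 = fd (\<lambda>z. r * ?F z) (x, y) (0, v)"
  proof (rule deriv_along_line[OF sm S z])
    fix t assume "(x, y) + t *\<^sub>R (0, v) \<in> chart_image (sl c)"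
    then have "(x, y + t *\<^sub>R v) \<in> chart_image (sl c)" by simp
    from Eloc_fd_homogeneous[OF c this r]
    show "?F ((x, r *\<^sub>R y) + t *\<^sub>R (0, r *\<^sub>R v)) = r * ?F ((x, y) + t *\<^sub>R (0, v))"
      by (simp add: algebra_simps)
  qed
  have "fd (\<lambda>z. r * ?F z) (x, y) (0, v) = r * fd ?F (x, y) (0, v)"
    using fd_eqI[OF has_derivative_mult_right[OF smooth_on_has_derivative[OF F z], of r]] by simp
  moreover have "fd ?F (x, r *\<^sub>R y) (0, r *\<^sub>R v) = r * fd ?F (x, r *\<^sub>R y) (0, v)"
    using linear_cmul[OF smooth_on_linear_fd[OF F zr], of r "(0, v)"] by simp
  ultimately show ?thesis
    using 1 2 r by (simp add: Hloc_def)
qed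

text \<open>On the ray (x, (1 + t) y) homogeneity gives explicit functions of t, whose derivatives
  at 0 are compared with the chain rule. The second identity is Euler's theorem for the fibre
  derivative of the energy and says g(\<eta>, Y) = dE(\<gamma> Y).\<close>

lemma Eloc_euler:
  assumes c: "c \<in> \<A>" and z: "(x, y) \<in> chart_image (sl c)"
  shows "fd (Eloc c) (x, y) (0, y) = 2 * Eloc c (x, y)"
    and "Hloc c (x, y) y w = fd (Eloc c) (x, y) (0, w)"
proof -
  have line: "(x, y) + t *\<^sub>R (0, y) = (x, (1 + t) *\<^sub>R y)" for t
    by (simp add: algebra_simps)
  have S: "open (chart_image (sl c))" by (rule open_slit_image[OF c])
  have z0: "(x, y) + 0 *\<^sub>R (0, y) \<in> chart_image (sl c)" using z by simp
  have vd: "((\<lambda>t. f ((x, y) + t *\<^sub>R (0, y))) has_vector_derivative fd f (x, y) (0, y)) (at 0)"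
    if "smooth_on f (chart_image (sl c))" for f :: "'e \<times> 'e \<Rightarrow> real"
    using smooth_on_line_derivative[OF that z0] by simp
  have "((\<lambda>t. (1 + t)\<^sup>2 * Eloc c (x, y)) has_vector_derivative 2 * Eloc c (x, y)) (at 0)"
    by (auto intro!: derivative_eq_intros simp flip: has_real_derivative_iff_has_vector_derivative)
  \<comment> \<open>Homogeneity holds for positive factors, hence the restriction to t > -1.\<close>
  then have "((\<lambda>t. Eloc c ((x, y) + t *\<^sub>R (0, y))) has_vector_derivative 2 * Eloc c (x, y)) (at 0)"
    by (rule has_vector_derivative_transform_within_open[of _ _ _ "{-1<..}"])
      (auto simp only: line Eloc_homogeneous[OF c z] open_greaterThan greaterThan_iff)
  then show "fd (Eloc c) (x, y) (0, y) = 2 * Eloc c (x, y)"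
    by (rule vector_derivative_unique_at[OF vd[OF Eloc_smooth[OF c]]])
  let ?F = "\<lambda>z'. fd (Eloc c) z' (0, w)"
  have "((\<lambda>t. (1 + t) * ?F (x, y)) has_vector_derivative ?F (x, y)) (at 0)"
    by (auto intro!: derivative_eq_intros simp flip: has_real_derivative_iff_has_vector_derivative)
  then have "((\<lambda>t. ?F ((x, y) + t *\<^sub>R (0, y))) has_vector_derivative ?F (x, y)) (at 0)"
    by (rule has_vector_derivative_transform_within_open[of _ _ _ "{-1<..}"])
      (auto simp only: line Eloc_fd_homogeneous[OF c z] open_greaterThan greaterThan_iff)
  then show "Hloc c (x, y) y w = ?F (x, y)"
    unfolding Hloc_def by (rule vector_derivative_unique_at[OF vd[OF smooth_on_fd[OF Eloc_smooth[OF c]]]])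
qed

lemma Hloc_sym:
  assumes "c \<in> \<A>" "z \<in> chart_image (sl c)"
  shows "Hloc c z v w = Hloc c z w v"
  unfolding Hloc_def by (rule fd_symmetric[OF Eloc_smooth[OF assms(1)] open_slit_image[OF assms(1)] assms(2)])

lemma Hloc_linear_left:
  assumes c: "c \<in> \<A>" and z: "z \<in> chart_image (sl c)"
  shows "linear (\<lambda>v. Hloc c z v w)"
proof -
  have "linear (\<lambda>v. (0::'e, v::'e))" by (auto intro!: linearI)
  from linear_compose[OF this smooth_on_linear_fd[OF smooth_on_fd[OF Eloc_smooth[OF c]] z]]
  show ?thesis by (simp add: Hloc_def comp_def)
qed

lemma bounded_bilinear_Hloc:
  assumes c: "c \<in> \<A>" and z: "z \<in> chart_image (sl c)"
  shows "bounded_bilinear (Hloc c z)"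
proof -
  have "linear (Hloc c z v)" for v
    using Hloc_linear_left[OF c z, of v] by (simp add: Hloc_sym[OF c z, of _ v])
  then have "bilinear (Hloc c z)"
    using Hloc_linear_left[OF c z] by (simp add: bilinear_def)
  then show ?thesis by (simp add: bilinear_conv_bounded_bilinear)
qed

lemma energy_shift:
  assumes c: "c \<in> \<A>" and u: "u \<in> slit_bundle \<A>" "fst u \<in> fst c" and v: "v \<in> tangent_space \<A> (fst u)"
    and z: "snd (sl c) u + (0, v c) \<in> chart_image (sl c)"
  shows "energy L (fst u, snd u + v) = Eloc c (snd (sl c) u + (0, v c))"
proof -
  have "(snd u + v) c \<noteq> 0" using z by (simp add: slit_chart_image[OF c])
  then have "snd u + v \<noteq> 0" by (metis zero_fun_apply)
  then have "(fst u, snd u + v) \<in> fst (sl c)"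
    using u v slit_bundle_tangent[OF u(1)] slit_bundle_carrier[OF u(1)]
    by (simp add: in_slit_chart_iff slit_bundleI)
  from slit.chart_inv_chart[OF sl_in[OF c] this] show ?thesis by simp
qed

lemma finsler_metric_chart:
  assumes c: "c \<in> \<A>" and u: "u \<in> slit_bundle \<A>" "fst u \<in> fst c"
    and v: "v \<in> tangent_space \<A> (fst u)" and w: "w \<in> tangent_space \<A> (fst u)"
  shows "finsler_metric L u v w = Hloc c (snd (sl c) u) (v c) (w c)"
  unfolding finsler_metric_def Hloc_def
proof (rule deriv_along_line[OF smooth_on_fd[OF Eloc_smooth[OF c]] open_slit_image[OF c]])
  show "snd (sl c) u \<in> chart_image (sl c)"
    by (rule slit.chart_in_image) (simp add: in_slit_chart_iff u)
  fix s assume zs: "snd (sl c) u + s *\<^sub>R (0, v c) \<in> chart_image (sl c)"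
  show "deriv (\<lambda>t. energy L (fst u, snd u + tscale s v + tscale t w)) 0
      = fd (Eloc c) (snd (sl c) u + s *\<^sub>R (0, v c)) (0, w c)"
  proof (rule deriv_along_line[OF Eloc_smooth[OF c] open_slit_image[OF c] zs])
    fix t assume "snd (sl c) u + s *\<^sub>R (0, v c) + t *\<^sub>R (0, w c) \<in> chart_image (sl c)"
    then show "energy L (fst u, snd u + tscale s v + tscale t w)
        = Eloc c (snd (sl c) u + s *\<^sub>R (0, v c) + t *\<^sub>R (0, w c))"
      using energy_shift[OF c u tangent_space_add[OF tangent_space_tscale[OF v] tangent_space_tscale[OF w]], of s t]
      by (simp add: tscale_def add.assoc)
  qed
qed

text \<open>Unlike \<open>metric_field\<close> it is 0 off the slit bundle, so identities that hold
  at its points become equalities of functions.\<close>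

definition gf :: "('m, 'e) pifield \<Rightarrow> ('m, 'e) pifield \<Rightarrow> ('m, 'e) tpoint \<Rightarrow> real" where
  "gf X Y u = (if u \<in> slit_bundle \<A> then metric_field L X Y u else 0)"

lemma gf_chart:
  assumes "X \<in> pi_fields \<A>" "Y \<in> pi_fields \<A>" "c \<in> \<A>" "u \<in> slit_bundle \<A>" "fst u \<in> fst c"
  shows "gf X Y u = Hloc c (snd (sl c) u) (X u c) (Y u c)"
  using finsler_metric_chart[OF assms(3-5) pi_tangent[OF assms(1,4)] pi_tangent[OF assms(2,4)]] assms
  by (simp add: gf_def metric_field_def del: snd_slit_chart)

lemma slit_chart_chart_inv: "\<lbrakk>c \<in> \<A>; z \<in> chart_image (sl c)\<rbrakk> \<Longrightarrow> snd (sl c) (chart_inv (sl c) z) = z"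
  by (rule slit.chart_chart_inv[OF sl_in])

lemma gf_loc:
  assumes "X \<in> pi_fields \<A>" "Y \<in> pi_fields \<A>" "c \<in> \<A>" "z \<in> chart_image (sl c)"
  shows "gf X Y (chart_inv (sl c) z) = Hloc c z (ploc c X z) (ploc c Y z)"
  using gf_chart[OF assms(1,2,3) chart_inv_slit_in(1,2)[OF assms(3,4)]]
  by (simp only: slit_chart_chart_inv[OF assms(3,4)])

lemma gf_smooth:
  assumes X: "X \<in> pi_fields \<A>" and Y: "Y \<in> pi_fields \<A>"
  shows "gf X Y \<in> smooth_functions (slit_atlas \<A>)"
  unfolding smooth_functions_def mem_Collect_eq
proof
  fix s assume "s \<in> slit_atlas \<A>"
  then obtain c where c: "c \<in> \<A>" and s: "s = sl c" by (rule slit_atlasE)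
  have S: "open (chart_image (sl c))" by (rule open_slit_image[OF c])
  have "smooth_on (\<lambda>z. fd (\<lambda>z'. fd (Eloc c) z' (0, ploc c Y z)) z (0, ploc c X z)) (chart_image (sl c))"
    by (rule smooth_on_second_derivative[OF Eloc_smooth[OF c] smooth_on_Pair[OF smooth_on_const pi_smooth[OF X c] S]
          smooth_on_Pair[OF smooth_on_const pi_smooth[OF Y c] S] S])
  then show "smooth_on (gf X Y \<circ> chart_inv s) (chart_image s)"
    unfolding s by (rule smooth_on_cong[OF S, rotated]) (simp add: gf_loc[OF X Y c] Hloc_def)
qed

lemma gf_outside: "u \<notin> slit_bundle \<A> \<Longrightarrow> gf X Y u = 0"
  by (simp only: gf_def if_False)

lemma gf_add:
  assumes "X \<in> pi_fields \<A>" "Y \<in> pi_fields \<A>" "Z \<in> pi_fields \<A>"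
  shows "gf (X + Y) Z = gf X Z + gf Y Z"
proof
  fix u
  show "gf (X + Y) Z u = (gf X Z + gf Y Z) u"
  proof (cases "u \<in> slit_bundle \<A>")
    case True
    then obtain c where c: "c \<in> \<A>" "fst u \<in> fst c" by (rule slit_chart_exists)
    have z: "snd (sl c) u \<in> chart_image (sl c)"
      by (rule slit.chart_in_image) (simp add: in_slit_chart_iff c True)
    show ?thesis
      using linear_add[OF Hloc_linear_left[OF c(1) z], of "X u c" "Y u c" "Z u c"]
      by (simp add: gf_chart[OF _ _ c(1) True c(2)] assms del: snd_slit_chart)
  qed (simp add: gf_outside)
qed

lemma gf_sym:
  assumes "X \<in> pi_fields \<A>" "Y \<in> pi_fields \<A>"
  shows "gf X Y = gf Y X"
proof
  fix u
  show "gf X Y u = gf Y X u"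
  proof (cases "u \<in> slit_bundle \<A>")
    case True
    then obtain c where c: "c \<in> \<A>" "fst u \<in> fst c" by (rule slit_chart_exists)
    have z: "snd (sl c) u \<in> chart_image (sl c)"
      by (rule slit.chart_in_image) (simp add: in_slit_chart_iff c True)
    show ?thesis
      using Hloc_sym[OF c(1) z, of "X u c" "Y u c"]
      by (simp add: gf_chart[OF _ _ c(1) True c(2)] assms del: snd_slit_chart)
  qed (simp add: gf_outside)
qed

lemma gf_definite:
  assumes "X \<in> pi_fields \<A>" "gf X X = 0"
  shows "X = 0"
proof (rule pi_eqI[OF assms(1) pi_0])
  fix u assume u: "u \<in> slit_bundle \<A>"
  show "X u = 0 u"
    using finsler_metric_pos[OF u pi_tangent[OF assms(1) u]] fun_cong[OF assms(2), of u] u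
    by (auto simp: gf_def metric_field_def)
qed

text \<open>A form of Euler's theorem. With Y = \<rho> A it gives d_JE(A) = g(\<rho> A,
  \<eta>).\<close>

lemma differential_energy_vertical:
  assumes u: "u \<in> slit_bundle \<A>" and Y: "Y \<in> pi_fields \<A>"
  shows "differential (slit_atlas \<A>) (energy L) u (gam \<A> u (Y u)) = gf (eta \<A>) Y u"
proof -
  obtain c where c: "c \<in> \<A>" "fst u \<in> fst c" using u by (rule slit_chart_exists)
  have us: "u \<in> fst (sl c)" by (simp add: in_slit_chart_iff c u)
  have z: "snd (sl c) u \<in> chart_image (sl c)" using us by (rule slit.chart_in_image)
  have "differential (slit_atlas \<A>) (energy L) u (gam \<A> u (Y u)) = fd (Eloc c) (snd (sl c) u) (0, Y u c)"
    using slit.differential_chart[OF energy_smooth sl_in[OF c(1)] us gam_tangent[OF pi_tangent[OF Y u] u]]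
    by (simp only: gam_apply[OF u c])
  also have "\<dots> = Hloc c (snd (sl c) u) (snd u c) (Y u c)"
    using Eloc_euler(2)[OF c(1), of "snd c (fst u)" "snd u c" "Y u c"] z by simp
  also have "\<dots> = gf (eta \<A>) Y u"
    using gf_chart[OF eta_pi Y c(1) u c(2)] u by (simp add: eta_def)
  finally show ?thesis .
qed

text \<open>Euler's theorem for the fibre derivative and then for the energy itself. The sum in
  place of the factor 2 fits the additivity of \<open>slit.dvf\<close>.\<close>

lemma energy_eq:
  assumes u: "u \<in> slit_bundle \<A>"
  shows "energy L u + energy L u = gf (eta \<A>) (eta \<A>) u"
proof -
  obtain c where c: "c \<in> \<A>" "fst u \<in> fst c" using u by (rule slit_chart_exists)
  have us: "u \<in> fst (sl c)" by (simp add: in_slit_chart_iff c u)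
  have z: "(snd c (fst u), snd u c) \<in> chart_image (sl c)"
    using slit.chart_in_image[OF us] by simp
  have "chart_inv (sl c) (snd c (fst u), snd u c) = u"
    using slit.chart_inv_chart[OF sl_in[OF c(1)] us] by simp
  then show ?thesis
    using gf_chart[OF eta_pi eta_pi c(1) u c(2)] u Eloc_euler[OF c(1) z]
    by (simp add: eta_def)
qed

text \<open>On the ray (x, (1 + t) y) the metric coefficients are constant, so the product rule for
  one fixed bilinear form applies. \<open>X'\<close> and \<open>Y'\<close> will be
  \<rho>[\<gamma> \<eta>, \<beta> X] and \<rho>[\<gamma> \<eta>, \<beta> Y].\<close>

lemma fibre_derivative_metric_eta:
  assumes X: "X \<in> pi_fields \<A>" and Y: "Y \<in> pi_fields \<A>"
    and X': "X' \<in> pi_fields \<A>" and Y': "Y' \<in> pi_fields \<A>"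
    and dX: "\<And>c u. \<lbrakk>c \<in> \<A>; u \<in> slit_bundle \<A>; fst u \<in> fst c\<rbrakk> \<Longrightarrow> X' u c = fd (ploc c X) (snd (sl c) u) (0, snd u c)"
    and dY: "\<And>c u. \<lbrakk>c \<in> \<A>; u \<in> slit_bundle \<A>; fst u \<in> fst c\<rbrakk> \<Longrightarrow> Y' u c = fd (ploc c Y) (snd (sl c) u) (0, snd u c)"
  shows "slit.dvf (gam_field \<A> (eta \<A>)) (gf X Y) = gf X' Y + gf X Y'"
proof
  fix u
  show "slit.dvf (gam_field \<A> (eta \<A>)) (gf X Y) u = (gf X' Y + gf X Y') u"
  proof (cases "u \<in> slit_bundle \<A>")
    case False
    then show ?thesis by (simp add: slit.dvf_def gf_outside)
  next
    case u: True
    obtain c where c: "c \<in> \<A>" "fst u \<in> fst c" using u by (rule slit_chart_exists)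
    have us: "u \<in> fst (sl c)" by (simp add: in_slit_chart_iff c u)
    define x y where "x = snd c (fst u)" and "y = snd u c"
    have zu: "snd (sl c) u = (x, y)" by (simp add: x_def y_def)
    have z: "(x, y) \<in> chart_image (sl c)" using slit.chart_in_image[OF us] zu by simp
    have inv: "chart_inv (sl c) (x, y) = u"
      using slit.chart_inv_chart[OF sl_in[OF c(1)] us] zu by simp
    have z0: "(x, y) + 0 *\<^sub>R (0, y) \<in> chart_image (sl c)" using z by simp
    let ?l = "\<lambda>t. (x, y) + t *\<^sub>R (0, y)"
    have vd: "((\<lambda>t. f (?l t)) has_vector_derivative fd f (x, y) (0, y)) (at 0)"
      if "smooth_on f (chart_image (sl c))" for f :: "'e \<times> 'e \<Rightarrow> 'b::euclidean_space"
      using smooth_on_line_derivative[OF that z0] by simp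
    have "((\<lambda>t. Hloc c (x, y) (ploc c X (?l t)) (ploc c Y (?l t))) has_vector_derivative
        Hloc c (x, y) (ploc c X (?l 0)) (fd (ploc c Y) (x, y) (0, y))
        + Hloc c (x, y) (fd (ploc c X) (x, y) (0, y)) (ploc c Y (?l 0))) (at 0)"
      by (rule bounded_bilinear.has_vector_derivative[OF bounded_bilinear_Hloc[OF c(1) z]
            vd[OF pi_smooth[OF X c(1)]] vd[OF pi_smooth[OF Y c(1)]]])
    then have "((\<lambda>t. (gf X Y \<circ> chart_inv (sl c)) (?l t)) has_vector_derivative
        Hloc c (x, y) (ploc c X (?l 0)) (fd (ploc c Y) (x, y) (0, y))
        + Hloc c (x, y) (fd (ploc c X) (x, y) (0, y)) (ploc c Y (?l 0))) (at 0)"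
    proof (rule has_vector_derivative_transform_within_open[of _ _ _ "{-1<..}"])
      fix t :: real assume t: "t \<in> {-1<..}"
      have l: "?l t = (x, (1 + t) *\<^sub>R y)" by (simp add: algebra_simps)
      have lz: "?l t \<in> chart_image (sl c)"
        unfolding l by (rule slit_image_scale[OF c(1) z]) (use t in simp)
      have "Hloc c (?l t) v w = Hloc c (x, y) v w" for v w
        unfolding l by (rule Hloc_homogeneous[OF c(1) z]) (use t in simp)
      then show "Hloc c (x, y) (ploc c X (?l t)) (ploc c Y (?l t)) = (gf X Y \<circ> chart_inv (sl c)) (?l t)"
        using gf_loc[OF X Y c(1) lz] by (simp only: comp_apply)
    qed simp_all
    from vector_derivative_unique_at[OF vd[OF slit.sf_smooth[OF gf_smooth[OF X Y] sl_in[OF c(1)]]] this]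
    have "fd (gf X Y \<circ> chart_inv (sl c)) (x, y) (0, y) =
        Hloc c (x, y) (X u c) (Y' u c) + Hloc c (x, y) (X' u c) (Y u c)"
      by (simp add: inv dX[OF c(1) u c(2)] dY[OF c(1) u c(2)]) (simp add: x_def y_def)
    moreover have "gam_field \<A> (eta \<A>) u (sl c) = (0, y)"
      using gam_field_apply[OF c(1) u c(2)] u by (simp add: eta_def y_def)
    ultimately show ?thesis
      using slit.dvf_chart[OF gam_field_vf[OF eta_pi] gf_smooth[OF X Y] sl_in[OF c(1)] us]
      by (simp add: gf_chart[OF _ _ c(1) u c(2)] X Y X' Y' zu del: snd_slit_chart)
  qed
qed

text \<open>In a chart g(\<eta>, Y) is dE(\<gamma> Y), so one differentiation already produces the
  Hessian, and third derivatives of the energy never appear.\<close>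

lemma fibre_derivative_eta_metric:
  assumes Z: "Z \<in> pi_fields \<A>" and Y: "Y \<in> pi_fields \<A>" and Y': "Y' \<in> pi_fields \<A>"
    and dY: "\<And>c u. \<lbrakk>c \<in> \<A>; u \<in> slit_bundle \<A>; fst u \<in> fst c\<rbrakk> \<Longrightarrow> Y' u c = fd (ploc c Y) (snd (sl c) u) (0, Z u c)"
  shows "slit.dvf (gam_field \<A> Z) (gf (eta \<A>) Y) = gf Z Y + gf (eta \<A>) Y'"
proof
  fix u
  show "slit.dvf (gam_field \<A> Z) (gf (eta \<A>) Y) u = (gf Z Y + gf (eta \<A>) Y') u"
  proof (cases "u \<in> slit_bundle \<A>")
    case False
    then show ?thesis by (simp add: slit.dvf_def gf_outside)
  next
    case u: True
    obtain c where c: "c \<in> \<A>" "fst u \<in> fst c" using u by (rule slit_chart_exists)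
    have us: "u \<in> fst (sl c)" by (simp add: in_slit_chart_iff c u)
    let ?z = "snd (sl c) u" and ?S = "chart_image (sl c)"
    have z: "?z \<in> ?S" using us by (rule slit.chart_in_image)
    have S: "open ?S" by (rule open_slit_image[OF c(1)])
    have inv: "chart_inv (sl c) ?z = u" by (rule slit.chart_inv_chart[OF sl_in[OF c(1)] us])
    have eta: "gf (eta \<A>) X (chart_inv (sl c) y) = fd (Eloc c) y (0, ploc c X y)"
      if y: "y \<in> ?S" and X: "X \<in> pi_fields \<A>" for y X
    proof -
      have "gf (eta \<A>) X (chart_inv (sl c) y) = Hloc c y (snd y) (ploc c X y)"
        using gf_loc[OF eta_pi X c(1) y] chart_inv_slit_in[OF c(1) y] by (simp add: eta_def)
      then show ?thesis
        using Eloc_euler(2)[OF c(1), of "fst y" "snd y" "ploc c X y"] y by simp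
    qed
    have dp: "((\<lambda>y. (0::'e, ploc c Y y)) has_derivative (\<lambda>v. (0, fd (ploc c Y) ?z v))) (at ?z)"
      by (rule has_derivative_Pair[OF has_derivative_const smooth_on_has_derivative[OF pi_smooth[OF Y c(1)] z]])
    have "((\<lambda>y. fd (Eloc c) y (0, ploc c Y y)) has_derivative
        (\<lambda>v. fd (\<lambda>y. fd (Eloc c) y (0, ploc c Y ?z)) ?z v + fd (Eloc c) ?z (0, fd (ploc c Y) ?z v))) (at ?z)"
      by (rule has_derivative_fd_apply[OF Eloc_smooth[OF c(1)] has_derivative_ident dp z S])
    then have "((gf (eta \<A>) Y \<circ> chart_inv (sl c)) has_derivative
        (\<lambda>v. fd (\<lambda>y. fd (Eloc c) y (0, ploc c Y ?z)) ?z v + fd (Eloc c) ?z (0, fd (ploc c Y) ?z v))) (at ?z)"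
      by (rule has_derivative_transform_within_open[OF _ S z]) (simp add: eta Y)
    from fd_eqI[OF this]
    have "fd (gf (eta \<A>) Y \<circ> chart_inv (sl c)) ?z (0, Z u c)
        = Hloc c ?z (Z u c) (Y u c) + fd (Eloc c) ?z (0, Y' u c)"
      using dY[OF c(1) u c(2)] by (simp only: inv Hloc_def)
    moreover have "fd (Eloc c) ?z (0, Y' u c) = gf (eta \<A>) Y' u"
      using eta[OF z Y'] by (simp only: inv)
    ultimately show ?thesis
      using slit.dvf_chart[OF gam_field_vf[OF Z] gf_smooth[OF eta_pi Y] sl_in[OF c(1)] us]
        gf_chart[OF Z Y c(1) u c(2)]
      by (simp only: gam_field_apply[OF c(1) u c(2)] plus_fun_apply)
  qed
qed

end

section \<open>The Bianchi identities of the Cartan connection\<close>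

locale cartan_finsler = finsler \<A> X\<^sub>M L
  for \<A> :: "('m, 'e::euclidean_space) chart set" and X\<^sub>M L +
  fixes D :: "('m, 'e) connection"
  assumes cartan: "cartan_connection \<A> L D"
begin

sublocale regular_pullback \<A> X\<^sub>M D
  by unfold_locales (use cartan in \<open>simp add: cartan_connection_def\<close>)

lemma rho_beta_field:
  assumes "X \<in> pi_fields \<A>"
  shows "rho_field \<A> (beta_field \<A> D X) = X"
proof (rule pi_eqI)
  show "rho_field \<A> (beta_field \<A> D X) u = X u" if "u \<in> slit_bundle \<A>" for u
    using that by (simp add: assms rho_field_def beta_field_def on_fields_def horizontal_map pi_tangent)
qed (simp_all add: assms)

lemma cov_beta_eta:
  assumes "X \<in> pi_fields \<A>"
  shows "cov \<A> D (beta_field \<A> D X) (eta \<A>) = 0"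
proof
  show "cov \<A> D (beta_field \<A> D X) (eta \<A>) u = 0 u" for u
    using assms by (simp add: cov_def beta_field_def on_fields_def horizontal_map pi_tangent)
qed

lemma field_vertical_horizontal_zero:
  assumes A: "A \<in> slit_fields" and r: "rho_field \<A> A = 0" and K: "cov \<A> D A (eta \<A>) = 0"
  shows "A = 0"
proof
  fix u
  show "A u = 0 u"
  proof (cases "u \<in> slit_bundle \<A>")
    case True
    then show ?thesis
      using vertical_horizontal_zero[OF True slit.vf_tangent[OF A]] fun_cong[OF r, of u] fun_cong[OF K, of u]
      by (simp add: rho_field_def cov_def on_fields_def)
  next
    case False
    then show ?thesis using slit.vf_zero[OF A, of u] by simp
  qed
qed

text \<open>The difference of the two sides is annihilated by \<rho> and by K, hence lies in V
  \<inter> H at every point.\<close>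

lemma beta_field_add:
  assumes X: "X \<in> pi_fields \<A>" and Y: "Y \<in> pi_fields \<A>"
  shows "beta_field \<A> D (X + Y) = beta_field \<A> D X + beta_field \<A> D Y"
proof -
  let ?S = "beta_field \<A> D X + beta_field \<A> D Y" and ?B = "beta_field \<A> D (X + Y)"
  have S: "?S \<in> slit_fields" and B: "?B \<in> slit_fields"
    by (simp_all add: X Y)
  have d: "?S - ?B \<in> slit_fields"
    using slit.vf_add[OF S slit.vf_minus[OF B]] by simp
  have "rho_field \<A> ?S = rho_field \<A> (?S - ?B) + rho_field \<A> ?B"
    using rho_field_add[OF d B] by (simp only: diff_add_cancel)
  then have 1: "rho_field \<A> (?S - ?B) = 0"
    by (simp add: rho_field_add rho_beta_field X Y)
  have "cov \<A> D ?S (eta \<A>) = cov \<A> D (?S - ?B) (eta \<A>) + cov \<A> D ?B (eta \<A>)"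
    using cov_add_left[OF d B eta_pi] by (simp only: diff_add_cancel)
  then have "cov \<A> D (?S - ?B) (eta \<A>) = 0"
    by (simp add: cov_add_left cov_beta_eta X Y)
  from field_vertical_horizontal_zero[OF d 1 this] show ?thesis by simp
qed

text \<open>Slit charts see only the slit bundle, so \<open>metric_field\<close> and
  \<open>gf\<close> may be exchanged under the differential.\<close>

lemma differential_cong_slit:
  assumes "\<And>q. q \<in> slit_bundle \<A> \<Longrightarrow> f q = f' q" "u \<in> slit_bundle \<A>"
  shows "differential (slit_atlas \<A>) f u a = differential (slit_atlas \<A>) f' u a"
proof -
  let ?s = "chart_at (slit_atlas \<A>) u"
  have s: "?s \<in> slit_atlas \<A>" "u \<in> fst ?s" using slit.chart_at assms(2) by simp_all
  have "fd (f \<circ> chart_inv ?s) (snd ?s u) = fd (f' \<circ> chart_inv ?s) (snd ?s u)"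
  proof (rule fd_cong[OF slit.open_chart_image[OF s(1)] slit.chart_in_image[OF s(2)]])
    fix y assume "y \<in> chart_image ?s"
    then have "chart_inv ?s y \<in> slit_bundle \<A>"
      using slit.in_carrierI[OF s(1) slit.chart_inv_in[OF s(1)]] by simp
    then show "(f \<circ> chart_inv ?s) y = (f' \<circ> chart_inv ?s) y"
      using assms(1) by simp
  qed
  then show ?thesis by (simp add: differential_def Let_def)
qed

lemma dvf_eq_differential:
  assumes "u \<in> slit_bundle \<A>" "\<And>q. q \<in> slit_bundle \<A> \<Longrightarrow> f q = f' q"
  shows "slit.dvf A f' u = differential (slit_atlas \<A>) f u (A u)"
  using differential_cong_slit[OF assms(2,1)] assms(1) by (simp add: slit.dvf_def)

lemma metric_gf:
  assumes A: "A \<in> slit_fields" and X: "X \<in> pi_fields \<A>" and Y: "Y \<in> pi_fields \<A>"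
  shows "slit.dvf A (gf X Y) = gf (cov \<A> D A X) Y + gf X (cov \<A> D A Y)"
proof
  fix u
  show "slit.dvf A (gf X Y) u = (gf (cov \<A> D A X) Y + gf X (cov \<A> D A Y)) u"
  proof (cases "u \<in> slit_bundle \<A>")
    case True
    have "slit.dvf A (gf X Y) u = differential (slit_atlas \<A>) (metric_field L X Y) u (A u)"
      by (rule dvf_eq_differential[OF True]) (simp add: gf_def)
    also have "\<dots> = metric_field L (cov \<A> D A X) Y u + metric_field L X (cov \<A> D A Y) u"
      using cartan A X Y True unfolding cartan_connection_def metric_connection_def by blast
    finally show ?thesis using True by (simp add: gf_def)
  next
    case False
    then show ?thesis by (simp add: slit.dvf_def gf_outside)
  qed
qed

lemma h_torsion_zero:
  assumes "X \<in> pi_fields \<A>" "Y \<in> pi_fields \<A>"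
  shows "h_torsion \<A> D X Y = 0"
proof (rule pi_eqI)
  show "h_torsion \<A> D X Y \<in> pi_fields \<A>"
    using pi_add[of _ "- _"] by (simp add: h_torsion_def torsion_def assms diff_conv_add_uminus del: add_uminus_conv_diff)
  show "h_torsion \<A> D X Y u = 0 u" if "u \<in> slit_bundle \<A>" for u
    using cartan assms that unfolding cartan_connection_def by simp
qed simp

lemma hv_torsion_symmetric:
  assumes "X \<in> pi_fields \<A>" "Y \<in> pi_fields \<A>" "Z \<in> pi_fields \<A>"
  shows "gf (hv_torsion \<A> D X Y) Z = gf (hv_torsion \<A> D X Z) Y"
proof
  fix u
  show "gf (hv_torsion \<A> D X Y) Z u = gf (hv_torsion \<A> D X Z) Y u"
    using cartan assms unfolding cartan_connection_def gf_def by simp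
qed

lemma fibre_derivative_apply:
  assumes "Z \<in> pi_fields \<A>" "Y \<in> pi_fields \<A>" "c \<in> \<A>" "u \<in> slit_bundle \<A>" "fst u \<in> fst c"
  shows "rho_field \<A> (slit_bracket (gam_field \<A> Z) (beta_field \<A> D Y)) u c
    = fd (ploc c Y) (snd (sl c) u) (0, Z u c)"
  using rho_bracket_gam[OF assms(1) beta_field_vf[OF assms(2)] assms(4,3,5)]
  by (simp only: rho_beta_field[OF assms(2)])

text \<open>In a slit chart \<eta> is the second coordinate, whose derivative in the fibre direction
  Z is Z.\<close>

lemma fibre_derivative_eta:
  assumes Z: "Z \<in> pi_fields \<A>"
  shows "rho_field \<A> (slit_bracket (gam_field \<A> Z) (beta_field \<A> D (eta \<A>))) = Z"
proof (rule pi_eqI)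
  fix u assume u: "u \<in> slit_bundle \<A>"
  then obtain c where c: "c \<in> \<A>" "fst u \<in> fst c" by (rule slit_chart_exists)
  have z: "snd (sl c) u \<in> chart_image (sl c)"
    by (rule slit.chart_in_image) (simp add: in_slit_chart_iff c u)
  have "fd (ploc c (eta \<A>)) (snd (sl c) u) = fd snd (snd (sl c) u)"
    by (rule fd_cong[OF open_slit_image[OF c(1)] z]) (simp add: eta_def chart_inv_slit_in[OF c(1)])
  also have "\<dots> = snd"
    by (rule fd_eqI[OF bounded_linear_imp_has_derivative[OF bounded_linear_snd]])
  finally show "rho_field \<A> (slit_bracket (gam_field \<A> Z) (beta_field \<A> D (eta \<A>))) u = Z u"
    by (intro tangent_eqI[OF pi_tangent pi_tangent c])
      (simp_all add: Z u fibre_derivative_apply[OF Z eta_pi c(1) u c(2)] del: snd_slit_chart)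
qed (simp_all add: Z)

sublocale ca: cartan_algebra "slit_fields" "pi_fields \<A>" "slit_bracket"
  "cov \<A> D" "rho_field \<A>" "beta_field \<A> D" "gam_field \<A>" "eta \<A>" gf slit.dvf
proof
  show "cov \<A> D (beta_field \<A> D X) (rho_field \<A> (beta_field \<A> D Y))
      - cov \<A> D (beta_field \<A> D Y) (rho_field \<A> (beta_field \<A> D X))
      - rho_field \<A> (slit_bracket (beta_field \<A> D X) (beta_field \<A> D Y)) = 0"
    if "X \<in> pi_fields \<A>" "Y \<in> pi_fields \<A>" for X Y
    using h_torsion_zero[OF that] by (simp only: h_torsion_def torsion_def)
  show "gf (cov \<A> D (gam_field \<A> X) (rho_field \<A> (beta_field \<A> D Y))
      - cov \<A> D (beta_field \<A> D Y) (rho_field \<A> (gam_field \<A> X))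
      - rho_field \<A> (slit_bracket (gam_field \<A> X) (beta_field \<A> D Y))) Z
    = gf (cov \<A> D (gam_field \<A> X) (rho_field \<A> (beta_field \<A> D Z))
      - cov \<A> D (beta_field \<A> D Z) (rho_field \<A> (gam_field \<A> X))
      - rho_field \<A> (slit_bracket (gam_field \<A> X) (beta_field \<A> D Z))) Y"
    if "X \<in> pi_fields \<A>" "Y \<in> pi_fields \<A>" "Z \<in> pi_fields \<A>" for X Y Z
    using hv_torsion_symmetric[OF that] by (simp only: hv_torsion_def torsion_def)
  show "slit.dvf (gam_field \<A> (eta \<A>)) (gf X Y) =
      gf (rho_field \<A> (slit_bracket (gam_field \<A> (eta \<A>)) (beta_field \<A> D X))) Y
      + gf X (rho_field \<A> (slit_bracket (gam_field \<A> (eta \<A>)) (beta_field \<A> D Y)))"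
    if "X \<in> pi_fields \<A>" "Y \<in> pi_fields \<A>" for X Y
    by (rule fibre_derivative_metric_eta)
      (simp_all add: that fibre_derivative_apply[OF eta_pi] del: snd_slit_chart, simp_all add: eta_def)
  show "slit.dvf (gam_field \<A> Z) (gf (eta \<A>) Y) = gf Z Y
      + gf (eta \<A>) (rho_field \<A> (slit_bracket (gam_field \<A> Z) (beta_field \<A> D Y)))"
    if "Z \<in> pi_fields \<A>" "Y \<in> pi_fields \<A>" for Z Y
    by (rule fibre_derivative_eta_metric) (simp_all add: that fibre_derivative_apply[OF that] del: snd_slit_chart)
  show "slit.dvf (slit_bracket A B) (gf X Y) =
      slit.dvf A (slit.dvf B (gf X Y)) - slit.dvf B (slit.dvf A (gf X Y))"
    if "A \<in> slit_fields" "B \<in> slit_fields" "X \<in> pi_fields \<A>" "Y \<in> pi_fields \<A>"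
    for A B X Y
    by (rule slit.dvf_lie_bracket[OF that(1,2) gf_smooth[OF that(3,4)]])
  show "slit.dvf A (gf X Y + gf Z W) = slit.dvf A (gf X Y) + slit.dvf A (gf Z W)"
    if "A \<in> slit_fields" "X \<in> pi_fields \<A>" "Y \<in> pi_fields \<A>" "Z \<in> pi_fields \<A>" "W \<in> pi_fields \<A>"
    for A X Y Z W
    by (rule slit.dvf_add[OF that(1) gf_smooth[OF that(2,3)] gf_smooth[OF that(4,5)]])
  show "slit_bracket A B = - slit_bracket B A" for A B
    by (rule slit.lie_bracket_anti)
qed (rule slit.vf_0 slit.vf_add slit.vf_minus pi_0 pi_add pi_minus slit.lie_bracket_closed slit.lie_bracket_add
    slit.lie_bracket_jacobi cov_pi cov_add_left cov_add_right rho_field_pi rho_field_add beta_field_vf beta_field_add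
    gam_field_vf gam_field_add eta_pi rho_beta_field rho_gam_field cov_beta_eta field_vertical_horizontal_zero
    rho_bracket_gam_gam gf_add gf_sym gf_definite metric_gf fibre_derivative_eta; assumption)+

section \<open>The canonical spray and the Barthel connection of the manifold\<close>

lemma vert_endo_field: "on_fields \<A> (vert_endo \<A>) A = gam_field \<A> (rho_field \<A> A)"
  by (auto simp: on_fields_def gam_field_def rho_field_def vert_endo_def)

lemma dJE_eq:
  assumes A: "A \<in> slit_fields" and q: "q \<in> slit_bundle \<A>"
  shows "dJE \<A> L q (A q) = gf (rho_field \<A> A) (eta \<A>) q"
proof -
  have "rho_field \<A> A q = rho \<A> q (A q)" using q by (simp add: rho_field_def on_fields_def)
  then show ?thesis
    using differential_energy_vertical[OF q rho_field_pi[OF A]]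
    by (simp only: dJE_def vert_endo_def gf_sym[OF rho_field_pi[OF A] eta_pi])
qed

lemma ext_deriv_dJE:
  assumes G: "G \<in> slit_fields" and A: "A \<in> slit_fields" and u: "u \<in> slit_bundle \<A>"
  shows "ext_deriv (slit_atlas \<A>) (dJE \<A> L) G A u =
    slit.dvf G (gf (rho_field \<A> A) (eta \<A>)) u - slit.dvf A (gf (rho_field \<A> G) (eta \<A>)) u
    - gf (rho_field \<A> (slit_bracket G A)) (eta \<A>) u"
  unfolding ext_deriv_def
  by (simp only: dJE_eq[OF slit.lie_bracket_closed[OF G A] u]
      dvf_eq_differential[OF u dJE_eq[OF A], where A = G] dvf_eq_differential[OF u dJE_eq[OF G], where A = A])

text \<open>Differentiate 2 E = g(\<eta>, \<eta>) with the metric condition; the two resulting terms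
  are equal.\<close>

lemma differential_energy:
  assumes A: "A \<in> slit_fields" and u: "u \<in> slit_bundle \<A>"
  shows "differential (slit_atlas \<A>) (energy L) u (A u) = gf (cov \<A> D A (eta \<A>)) (eta \<A>) u"
proof -
  have "slit.dvf A (gf (eta \<A>) (eta \<A>)) u = differential (slit_atlas \<A>) (energy L + energy L) u (A u)"
    by (rule dvf_eq_differential[OF u]) (simp only: plus_fun_apply energy_eq)
  also have "\<dots> = slit.dvf A (energy L + energy L) u"
    using u by (simp add: slit.dvf_def)
  also have "\<dots> = slit.dvf A (energy L) u + slit.dvf A (energy L) u"
    by (simp only: slit.dvf_add[OF A energy_smooth energy_smooth] plus_fun_apply)
  finally have "gf (cov \<A> D A (eta \<A>)) (eta \<A>) u + gf (eta \<A>) (cov \<A> D A (eta \<A>)) u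
      = slit.dvf A (energy L) u + slit.dvf A (energy L) u"
    by (simp add: metric_gf[OF A eta_pi eta_pi])
  then have "gf (cov \<A> D A (eta \<A>)) (eta \<A>) u = slit.dvf A (energy L) u"
    by (simp add: gf_sym[OF eta_pi cov_pi[OF A eta_pi]])
  then show ?thesis using u by (simp add: slit.dvf_def)
qed

text \<open>With d_JE(A) = g(\<rho> A, \<eta>) the defining equation becomes that of
  \<open>ca.spray_unique\<close>, and \<open>ca.spray_be_eta\<close> shows that \<beta> \<eta>
  solves it.\<close>

lemma canonical_spray_eq: "canonical_spray \<A> L = beta_field \<A> D (eta \<A>)"
  unfolding canonical_spray_def
proof (rule the_equality)
  let ?G = "beta_field \<A> D (eta \<A>)"
  show "?G \<in> slit_fields \<and> (\<forall>A\<in>slit_fields. \<forall>u\<in>slit_bundle \<A>.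
      ext_deriv (slit_atlas \<A>) (dJE \<A> L) ?G A u = - differential (slit_atlas \<A>) (energy L) u (A u))"
  proof (intro conjI ballI)
    fix A u assume A: "A \<in> slit_fields" and u: "u \<in> slit_bundle \<A>"
    show "ext_deriv (slit_atlas \<A>) (dJE \<A> L) ?G A u = - differential (slit_atlas \<A>) (energy L) u (A u)"
      using fun_cong[OF ca.spray_be_eta[OF A], of u]
      by (simp add: ext_deriv_dJE[OF beta_field_vf[OF eta_pi] A u] differential_energy[OF A u])
  qed simp
next
  fix G
  assume G: "G \<in> slit_fields \<and> (\<forall>A\<in>slit_fields. \<forall>u\<in>slit_bundle \<A>.
      ext_deriv (slit_atlas \<A>) (dJE \<A> L) G A u = - differential (slit_atlas \<A>) (energy L) u (A u))"
  then have Gv: "G \<in> slit_fields" by blast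
  show "G = beta_field \<A> D (eta \<A>)"
  proof (rule ca.spray_unique[OF Gv])
    fix A assume A: "A \<in> slit_fields"
    show "slit.dvf G (gf (rho_field \<A> A) (eta \<A>)) - slit.dvf A (gf (rho_field \<A> G) (eta \<A>))
        - gf (rho_field \<A> (slit_bracket G A)) (eta \<A>) = - gf (cov \<A> D A (eta \<A>)) (eta \<A>)"
    proof
      fix u
      show "(slit.dvf G (gf (rho_field \<A> A) (eta \<A>)) - slit.dvf A (gf (rho_field \<A> G) (eta \<A>))
        - gf (rho_field \<A> (slit_bracket G A)) (eta \<A>)) u = (- gf (cov \<A> D A (eta \<A>)) (eta \<A>)) u"
      proof (cases "u \<in> slit_bundle \<A>")
        case True
        then have "ext_deriv (slit_atlas \<A>) (dJE \<A> L) G A u = - differential (slit_atlas \<A>) (energy L) u (A u)"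
          using G A by blast
        then show ?thesis
          by (simp add: ext_deriv_dJE[OF Gv A True] differential_energy[OF A True])
      next
        case False
        then show ?thesis by (simp add: slit.dvf_def gf_outside)
      qed
    qed
  qed
qed

lemma barthel_eq: "barthel \<A> L A = ca.Gam A"
  by (simp add: barthel_def Let_def vert_endo_field canonical_spray_eq ca.Gam_def)

lemma barthel_h_beta:
  assumes "X \<in> pi_fields \<A>"
  shows "barthel_h \<A> L (beta_field \<A> D X) = beta_field \<A> D X"
  unfolding barthel_h_def barthel_eq ca.Gam_be[OF assms]
  by (auto simp: tscale_def fun_eq_iff simp flip: scaleR_add_left)

text \<open>From v = (I - \<Gamma>)/2 and K \<circ> \<Gamma> = -K. The factor 1/2 is available for
  tangent vectors but not in the algebra of fields, hence the passage to points.\<close>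

lemma K_barthel_v:
  assumes A: "A \<in> slit_fields"
  shows "K_field \<A> D (- barthel_v \<A> L A) = - cov \<A> D A (eta \<A>)"
proof
  fix u
  show "K_field \<A> D (- barthel_v \<A> L A) u = (- cov \<A> D A (eta \<A>)) u"
  proof (cases "u \<in> slit_bundle \<A>")
    case True
    note G = ca.Gam_closed[OF A]
    have t: "A u \<in> slit_tangent u" "ca.Gam A u \<in> slit_tangent u"
      using slit.vf_tangent[OF A] slit.vf_tangent[OF G] True by simp_all
    have K: "D u (ca.Gam A u) (eta \<A>) = - D u (A u) (eta \<A>)"
      using fun_cong[OF ca.K_Gam[OF A], of u] True by (simp add: cov_def on_fields_def)
    have "(- barthel_v \<A> L A) u = tscale (- 1 / 2) (A u + tscale (- 1) (ca.Gam A u))"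
      by (auto simp: barthel_v_def barthel_eq tscale_def)
    then have "K_field \<A> D (- barthel_v \<A> L A) u
        = tscale (- 1 / 2) (D u (A u) (eta \<A>) + tscale (- 1) (- D u (A u) (eta \<A>)))"
      using True t K by (simp add: K_field_def on_fields_def connection_map_def D_tscale D_add)
    also have "\<dots> = - D u (A u) (eta \<A>)"
      by (rule ext) (simp add: tscale_def)
    finally show ?thesis using True by (simp add: cov_def on_fields_def)
  next
    case False
    then show ?thesis by (simp add: K_field_def cov_def on_fields_def)
  qed
qed

lemma curvature_eq: "curvature \<A> D = ca.curv"
  by (intro ext) (simp add: curvature_def ca.curv_def)

lemma torsion_eq: "torsion \<A> D = ca.tor"
  by (intro ext) (simp add: torsion_def ca.tor_def)

text \<open>R(X, Y)\<eta> is K[\<beta> X, \<beta> Y], and horizontal fields are fixed by h. The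
  minus sign is the one in the definition of the Barthel curvature.\<close>

lemma h_curvature_eta:
  assumes X: "X \<in> pi_fields \<A>" and Y: "Y \<in> pi_fields \<A>"
  shows "h_curvature \<A> D X Y (eta \<A>) = - K_field \<A> D (barthel_curvature \<A> L (beta_field \<A> D X) (beta_field \<A> D Y))"
  by (simp add: h_curvature_def curvature_eq barthel_curvature_def barthel_h_beta K_barthel_v X Y ca.curv_be_be_eta)

lemma cov_curv_h: "cov_curv \<A> D A (h_curvature \<A> D) = ca.nabla_h A"
  by (intro ext) (simp add: cov_curv_def h_curvature_def curvature_eq ca.nabla_h_def)

lemma cov_curv_hv: "cov_curv \<A> D A (hv_curvature \<A> D) = ca.nabla_hv A"
  by (intro ext) (simp add: cov_curv_def hv_curvature_def curvature_eq ca.nabla_hv_def)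

lemma metric_field_gf: "u \<in> slit_bundle \<A> \<Longrightarrow> metric_field L X Y u = gf X Y u"
  by (simp add: gf_def)

end

theorem theorem3p6:
  fixes X\<^sub>M :: "'m topology"
    and \<A> :: "('m, 'e::euclidean_space) chart set"
    and L :: "('m, 'e) tpoint \<Rightarrow> real"
    and D :: "('m, 'e) connection"
    and X Y Z W :: "('m, 'e) pifield"
  defines "g \<equiv> metric_field L"
    and "R \<equiv> h_curvature \<A> D"
    and "P \<equiv> hv_curvature \<A> D"
    and "S \<equiv> v_curvature \<A> D"
    and "T \<equiv> hv_torsion \<A> D"
    and "R\<^sub>\<eta> \<equiv> \<lambda>X Y. h_curvature \<A> D X Y (eta \<A>)"
    and "P\<^sub>\<eta> \<equiv> \<lambda>X Y. hv_curvature \<A> D X Y (eta \<A>)"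
    and "K \<equiv> K_field \<A> D"
    and "\<beta> \<equiv> beta_field \<A> D"
    and "\<gamma> \<equiv> gam_field \<A>"
    and "nabla \<equiv> cov_curv \<A> D"
    and "\<RR> \<equiv> barthel_curvature \<A> L"
  assumes "finsler_manifold X\<^sub>M \<A> L"
    and "cartan_connection \<A> L D"
    and "X \<in> pi_fields \<A>" and "Y \<in> pi_fields \<A>" and "Z \<in> pi_fields \<A>" and "W \<in> pi_fields \<A>"
  shows "\<forall>u\<in>slit_bundle \<A>.
    g (R X Y Z) W u = - g (R Y X Z) W u \<and>
    g (R X Y Z) W u = - g (R X Y W) Z u \<and>
    R\<^sub>\<eta> X Y u = (- K (\<RR> (\<beta> X) (\<beta> Y))) u \<and>
    cyclic_sum (\<lambda>X Y Z. R X Y Z - T (R\<^sub>\<eta> X Y) Z) X Y Z u = 0 \<and>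
    cyclic_sum (\<lambda>X Y Z. nabla (\<beta> X) R Y Z W + P X (R\<^sub>\<eta> Y Z) W) X Y Z u = 0 \<and>
    (nabla (\<gamma> X) R Y Z W + nabla (\<beta> Y) P Z X W - nabla (\<beta> Z) P Y X W
      - P Z (P\<^sub>\<eta> Y X) W + R (T X Y) Z W - S (R\<^sub>\<eta> Y Z) X W
      + P Y (P\<^sub>\<eta> Z X) W - R (T X Z) Y W) u = 0 \<and>
    nabla (\<gamma> (eta \<A>)) R X Y Z u = 0"
proof -
  have "smooth_manifold X\<^sub>M \<A>"
    using assms(13) by (simp add: finsler_manifold_def)
  then have h: "Hausdorff_space X\<^sub>M" "smooth_atlas X\<^sub>M \<A>"
    by (simp_all add: smooth_manifold_def)
  interpret atlas \<A> by (rule smooth_atlas_imp_atlas[OF h(2)])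
  interpret cartan_finsler \<A> X\<^sub>M L D
    by unfold_locales (fact h assms(13,14))+
  note XYZW = assms(15-18)
  note defs = g_def R_def P_def S_def T_def R\<^sub>\<eta>_def P\<^sub>\<eta>_def K_def \<beta>_def \<gamma>_def nabla_def \<RR>_def
  have h_curv: "h_curvature \<A> D X Y = ca.curv (beta_field \<A> D X) (beta_field \<A> D Y)" for X Y
    by (simp add: h_curvature_def curvature_eq)
  have hv_curv: "hv_curvature \<A> D X Y = ca.curv (beta_field \<A> D X) (gam_field \<A> Y)" for X Y
    by (simp add: hv_curvature_def curvature_eq)
  have v_curv: "v_curvature \<A> D X Y = ca.curv (gam_field \<A> X) (gam_field \<A> Y)" for X Y
    by (simp add: v_curvature_def curvature_eq)
  have hv_tor: "hv_torsion \<A> D X Y = ca.tor (gam_field \<A> X) (beta_field \<A> D Y)" for X Y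
    by (simp add: hv_torsion_def torsion_eq)
  have a: "gf (R X Y Z) W = - gf (R Y X Z) W"
    unfolding defs h_curv using XYZW
    by (subst ca.curv_anti) (simp_all add: ca.g_minus_left)
  have b: "gf (R X Y Z) W = - gf (R X Y W) Z"
    unfolding defs h_curv using XYZW by (intro ca.curv_skew) simp_all
  have c: "R\<^sub>\<eta> X Y = - K (\<RR> (\<beta> X) (\<beta> Y))"
    unfolding defs using XYZW by (intro h_curvature_eta)
  have d: "cyclic_sum (\<lambda>X Y Z. R X Y Z - T (R\<^sub>\<eta> X Y) Z) X Y Z = 0"
    unfolding defs h_curv hv_tor cyclic_sum_def by (rule ca.bianchi_h_torsion[OF XYZW(1-3)])
  have e: "cyclic_sum (\<lambda>X Y Z. nabla (\<beta> X) R Y Z W + P X (R\<^sub>\<eta> Y Z) W) X Y Z = 0"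
    unfolding defs cov_curv_h h_curv hv_curv cyclic_sum_def by (rule ca.bianchi_h[OF XYZW])
  have f: "nabla (\<gamma> X) R Y Z W + nabla (\<beta> Y) P Z X W - nabla (\<beta> Z) P Y X W
      - P Z (P\<^sub>\<eta> Y X) W + R (T X Y) Z W - S (R\<^sub>\<eta> Y Z) X W
      + P Y (P\<^sub>\<eta> Z X) W - R (T X Z) Y W = 0"
    unfolding defs cov_curv_h cov_curv_hv h_curv hv_curv v_curv hv_tor by (rule ca.bianchi_hv[OF XYZW])
  have g: "nabla (\<gamma> (eta \<A>)) R X Y Z = 0"
    unfolding defs cov_curv_h by (rule ca.nabla_eta_h[OF XYZW(1-3)])
  \<comment> \<open>The statements above are equalities of fields and use \<open>gf\<close>, which
    agrees with the metric at the points of the slit bundle.\<close>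
  have "g V V' u = gf V V' u" if "u \<in> slit_bundle \<A>" for V V' u
    by (simp add: g_def metric_field_gf that)
  with a b c d e f g show ?thesis
    by (simp add: fun_eq_iff del: split_paired_All)
qed

end
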